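(* Let $n$ be a composite number, and write $n=qk$ where $q$ is a prime divisor of $n$. Let $m$ be a positive integer, and define $$F(x_0,\ldots,x_m)=x_0^{kq}+2(x_1^k+\cdots+x_m^k)^q\in\mathbb{Z}[x_0,\dots,x_m].$$ Then $\mathrm{o}(F)=m+1$, and there are infinitely many primes $p$ such that $R(F)$ is not dense in $\mathbb{Q}_p$.
   Context: For an integral form $F$ in $r$ variables, $R(F)=\{F(\overline{x})/F(\overline{y}) : \overline{x},\overline{y}\in\mathbb{Z}^r,\ F(\overline{y})\neq 0\}$, and density is in the $p$-adic topology. The order $\mathrm{o}(F)$ (over $\mathbb{Q}$) is the smallest integer $m'$ such that $F$ is equivalent, via an invertible linear change of variables over $\mathbb{Q}$, to a form explicitly involving only $m'$ variables. *)

theory Defs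
  imports "Jordan_Normal_Form.Matrix" "HOL-Computational_Algebra.Primes"
begin

text \<open>Forms in r variables over Q are represented by their (polynomial) functions on
  rational vectors of dimension r. Over the infinite field Q a polynomial is determined
  by its function, so this is faithful.\<close>

definition form_order :: "nat \<Rightarrow> (rat vec \<Rightarrow> rat) \<Rightarrow> nat" where
  "form_order r F = (LEAST m'. \<exists>A \<in> carrier_mat r r. invertible_mat A \<and>
     (\<exists>S \<subseteq> {..<r}. card S = m' \<and>
        (\<forall>x \<in> carrier_vec r. \<forall>y \<in> carrier_vec r.
            (\<forall>i\<in>S. x $ i = y $ i) \<longrightarrow> F (A *\<^sub>v x) = F (A *\<^sub>v y))))"

definition ratio_set :: "nat \<Rightarrow> (rat vec \<Rightarrow> rat) \<Rightarrow> rat set" where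
  "ratio_set r F = {F x / F y | x y. x \<in> carrier_vec r \<and> y \<in> carrier_vec r \<and>
      (\<forall>i<r. x $ i \<in> \<int>) \<and> (\<forall>i<r. y $ i \<in> \<int>) \<and> F y \<noteq> 0}"

definition padic_val :: "nat \<Rightarrow> rat \<Rightarrow> int" where
  "padic_val p x = (case quotient_of x of (a, b) \<Rightarrow>
      int (multiplicity (int p) a) - int (multiplicity (int p) b))"

text \<open>A set of rationals is dense in Q_p. Since Q is dense in Q_p, this holds iff every
  rational can be approximated p-adically arbitrarily well by elements of the set.\<close>
definition padic_dense :: "nat \<Rightarrow> rat set \<Rightarrow> bool" where
  "padic_dense p R \<longleftrightarrow> (\<forall>a::rat. \<forall>e::int. \<exists>r\<in>R. r = a \<or> padic_val p (r - a) \<ge> e)"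

definition Fthm :: "nat \<Rightarrow> nat \<Rightarrow> nat \<Rightarrow> rat vec \<Rightarrow> rat" where
  "Fthm k q m x = (x $ 0) ^ (k * q) + 2 * (\<Sum>i\<in>{1..m}. (x $ i) ^ k) ^ q"

end

theory Submission
  imports Defs "HOL-Number_Theory.Number_Theory" "HOL-Computational_Algebra.Squarefree"
    "Jordan_Normal_Form.Determinant"
begin

text \<open>
  For integral arguments the form has a value \<open>a ^ q + 2 * b ^ q\<close>. If \<open>x ^ q + 2\<close> has no root modulo
  \<open>p\<close>, the \<open>p\<close>-adic valuation of every nonzero such value is a multiple of \<open>q\<close>, so no quotient of two
  values is close to \<open>p\<close>. It remains to find infinitely many such primes \<open>p\<close>.

  Suppose that \<open>x ^ q + 2\<close> has a root modulo almost every prime; then it has \<open>q\<close> roots modulo almost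
  every prime \<open>p \<equiv> 1 (mod q)\<close>. A root \<open>r\<close> modulo a squarefree \<open>n\<close> defines the lattice of all \<open>a\<close> with
  \<open>\<Sum> a\<^sub>i r\<^sup>i \<equiv> 0 (mod n)\<close>, which contains a vector with entries bounded by the \<open>q\<close>-th root of \<open>n\<close>.
  The norm of the corresponding element of \<open>\<int>[\<theta>]\<close>, \<open>\<theta> ^ q = - 2\<close>, is a bounded multiple of \<open>n\<close>, and
  hence the vector determines the pair \<open>(n, r)\<close> up to boundedly many choices. Counting vectors shows that
  the number of pairs with \<open>n \<le> X\<close> is \<open>O(X)\<close>. On the other hand, the \<open>q\<close> roots modulo the primes
  \<open>p \<equiv> 1 (mod q)\<close> make the sum of (number of roots modulo \<open>n\<close>) \<open>/ n\<close> over \<open>n \<le> X\<close> larger than any multiple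
  of \<open>ln X\<close>, because the sum of \<open>1 / p\<close> over these primes diverges.

  That divergence is proved following Shapiro: at most one \<open>L(1, \<chi>)\<close> vanishes, which forces \<open>\<chi>\<close> to be
  real, and real characters are treated by Monsky's argument.
\<close>

section \<open>Short vectors and norms in the ring generated by a \<open>q\<close>-th root of \<open>- 2\<close>\<close>

text \<open>Behind the construction stands the fact that an irreducible polynomial of degree at
  least 2 has no root modulo infinitely many primes, usually drawn from the density theorems of
  Frobenius or Chebotarev. The counting here is an elementary trace of the simple pole of the zeta
  function of Q(theta): weighted by 1 / p, the number of roots modulo p should be 1 on average. If
  almost every prime had a root and those congruent to 1 modulo q had q of them, the average would
  be at least q / (q - 1) + (q - 2) / (q - 1) = 2. Only the surplus on the class of 1 is exploited,
  so divergence of the sum of 1 / p is needed on that class alone.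

  No ideals occur: norms are determinants of integer matrices, and the constant
  \<open>fact q * 2 ^ q\<close> counts the Leibniz terms and the factors 2 coming from theta ^ q = -
  2. The norm must be nonzero for the count to work. This is obtained from parity instead of
  irreducibility: a vector with odd first entry has odd norm, which is why the short vectors are
  adjusted to have one.\<close>

lemma nat_root_bracket:
  fixes n q :: nat
  assumes "q \<ge> 1"
  obtains h where "h ^ q \<le> n" "n < (h + 1) ^ q"
proof -
  define h where "h = Max {h. h ^ q \<le> n}"
  have sub: "{h. h ^ q \<le> n} \<subseteq> {..n}"
  proof
    fix h assume "h \<in> {h. h ^ q \<le> n}"
    moreover have "h \<le> h ^ q" using assms by (cases "h = 0") (auto intro: self_le_power)
    ultimately show "h \<in> {..n}" by simp
  qed
  hence fin: "finite {h. h ^ q \<le> n}" by (rule finite_subset) simp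
  have "h \<in> {h. h ^ q \<le> n}" unfolding h_def
    using fin assms by (intro Max_in) (auto intro!: exI[of _ 0] simp: zero_power)
  moreover have "n < (h + 1) ^ q"
  proof (rule ccontr)
    assume "\<not> n < (h + 1) ^ q"
    hence "h + 1 \<le> h" unfolding h_def using fin by (intro Max_ge) auto
    thus False by simp
  qed
  ultimately show ?thesis using that by simp
qed

text \<open>Pigeonhole: with h the integer part of the q-th root of n, more than n vectors have all
  entries in \<open>{0..int h}\<close>, so two of them give the linear form the same value modulo n,
  and their difference is the vector sought. The bound is kept as a q-th power to avoid real
  roots.\<close>

lemma thue_vector:
  fixes n q :: nat and r :: int
  assumes n: "n > 0" and q: "q \<ge> 1"
  obtains a :: "nat \<Rightarrow> int" where "\<exists>i<q. a i \<noteq> 0" "\<And>i. i < q \<Longrightarrow> nat \<bar>a i\<bar> ^ q \<le> n"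
    "int n dvd (\<Sum>i<q. a i * r ^ i)"
proof -
  obtain h where h: "h ^ q \<le> n" "n < (h + 1) ^ q" using nat_root_bracket[OF q] by blast
  define B where "B = (PiE {..<q} (\<lambda>_. {0..int h}))"
  define f where "f = (\<lambda>b. (\<Sum>i<q. b i * r ^ i) mod int n)"
  have "card B = (h + 1) ^ q" unfolding B_def by (subst card_PiE) (auto simp: nat_add_distrib)
  moreover have "f ` B \<subseteq> {0..<int n}" using n by (auto simp: f_def)
  hence "card (f ` B) \<le> n" using card_mono[of "{0..<int n}" "f ` B"] by simp
  ultimately have "\<not> inj_on f B" using h by (auto dest: card_image)
  then obtain b c where bc: "b \<in> B" "c \<in> B" "b \<noteq> c" "f b = f c" unfolding inj_on_def by blast
  define a where "a = (\<lambda>i. b i - c i)"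
  have "\<exists>i<q. a i \<noteq> 0"
  proof (rule ccontr)
    assume "\<not> (\<exists>i<q. a i \<noteq> 0)"
    hence "b = c" using bc unfolding B_def a_def by (intro PiE_ext[of b _ _ c]) auto
    thus False using bc by simp
  qed
  moreover have "nat \<bar>a i\<bar> ^ q \<le> n" if "i < q" for i
  proof -
    have "b i \<in> {0..int h}" "c i \<in> {0..int h}" using bc(1,2) that unfolding B_def by (blast intro: PiE_mem)+
    hence "\<bar>a i\<bar> \<le> int h" unfolding a_def atLeastAtMost_iff by arith
    hence "nat \<bar>a i\<bar> \<le> h" by simp
    hence "nat \<bar>a i\<bar> ^ q \<le> h ^ q" by (rule power_mono) simp
    thus ?thesis using h(1) by linarith
  qed
  moreover have "int n dvd (\<Sum>i<q. a i * r ^ i)"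
  proof -
    have "(\<Sum>i<q. a i * r ^ i) = (\<Sum>i<q. b i * r ^ i) - (\<Sum>i<q. c i * r ^ i)"
      by (simp add: a_def algebra_simps sum_subtractf)
    thus ?thesis using bc(4) by (simp add: f_def mod_eq_dvd_iff)
  qed
  ultimately show ?thesis by (rule that)
qed

text \<open>Division by the root \<open>r\<close> of \<open>x ^ q + 2\<close> replaces \<open>a\<close> by
  \<open>(a\<^sub>1, \<dots>, a\<^sub>q\<^sub>-\<^sub>1, - a\<^sub>0 / 2)\<close>; the weight \<open>\<Sum> (q + i) \<bar>a\<^sub>i\<bar>\<close> makes this a descent.\<close>
lemma thue_vector_odd:
  fixes n q :: nat and r :: int
  assumes n: "odd n" and q: "q \<ge> 1" and r: "int n dvd r ^ q + 2"
  obtains a :: "nat \<Rightarrow> int" where "odd (a 0)" "\<And>i. i < q \<Longrightarrow> nat \<bar>a i\<bar> ^ q \<le> n"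
    "int n dvd (\<Sum>i<q. a i * r ^ i)"
proof -
  define P where "P = (\<lambda>a::nat\<Rightarrow>int. (\<forall>i<q. nat \<bar>a i\<bar> ^ q \<le> n) \<and> int n dvd (\<Sum>i<q. a i * r ^ i))"
  obtain q' where q': "q = Suc q'" using q by (cases q) auto
  have cop: "coprime (int n) r"
  proof (rule coprimeI)
    fix c assume c: "c dvd int n" "c dvd r"
    hence "c dvd r ^ q" using q dvd_trans[OF c(2) dvd_power[of q r]] by simp
    moreover have "c dvd r ^ q + 2" using c r dvd_trans by blast
    ultimately have "c dvd 2" by (simp add: dvd_add_right_iff)
    moreover have "coprime (int n) 2" using n by simp
    ultimately show "is_unit c" using c(1) coprime_common_divisor by blast
  qed
  have "\<exists>b. odd (b 0) \<and> P b" if "P a" "\<exists>i<q. a i \<noteq> 0" for a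
    using that
  proof (induction "\<Sum>i<q. (q + i) * nat \<bar>a i\<bar>" arbitrary: a rule: less_induct)
    case less
    show ?case
    proof (cases "odd (a 0)")
      case True thus ?thesis using less by blast
    next
      case False
      then obtain c where c: "a 0 = 2 * c" by (auto elim: evenE)
      define b where "b = (\<lambda>i. if i < q' then a (Suc i) else - c)"
      have sb: "(\<Sum>i<q. g i (b i)) = (\<Sum>i<q'. g i (a (Suc i))) + g q' (- c)"
        for g :: "nat \<Rightarrow> int \<Rightarrow> 'b::comm_monoid_add"
        unfolding q' by (simp add: b_def)
      have sa: "(\<Sum>i<q. g i (a i)) = g 0 (2 * c) + (\<Sum>i<q'. g (Suc i) (a (Suc i)))"
        for g :: "nat \<Rightarrow> int \<Rightarrow> 'b::comm_monoid_add"
        unfolding q' by (subst sum.lessThan_Suc_shift) (simp add: c)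
      have "P b" unfolding P_def
      proof safe
        fix i assume i: "i < q"
        have "nat \<bar>c\<bar> \<le> nat \<bar>a 0\<bar>" using c by auto
        hence "nat \<bar>c\<bar> ^ q \<le> nat \<bar>a 0\<bar> ^ q" by (rule power_mono) simp
        also have "\<dots> \<le> n" using less.prems q by (auto simp: P_def)
        finally show "nat \<bar>b i\<bar> ^ q \<le> n" using less.prems i by (auto simp: b_def P_def q')
      next
        \<comment> \<open>With theta in place of r this reads theta * b = a - c * (theta ^ q + 2): b
          is a divided by theta.\<close>
        have "r * (\<Sum>i<q. b i * r ^ i) = (\<Sum>i<q. a i * r ^ i) - c * (r ^ q + 2)"
          unfolding sb[of "\<lambda>i x. x * r ^ i"] sa[of "\<lambda>i x. x * r ^ i"]
          by (simp add: q' algebra_simps sum_distrib_left)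
        moreover have "int n dvd \<dots>" using less.prems r by (auto simp: P_def)
        ultimately have "int n dvd r * (\<Sum>i<q. b i * r ^ i)" by simp
        thus "int n dvd (\<Sum>i<q. b i * r ^ i)" using cop coprime_dvd_mult_right_iff by blast
      qed
      moreover have nz: "\<exists>i<q. b i \<noteq> 0"
      proof -
        from less.prems obtain i where i: "i < q" "a i \<noteq> 0" by blast
        show ?thesis
        proof (cases i)
          case 0 thus ?thesis using i c by (intro exI[of _ q']) (auto simp: b_def q')
        next
          case (Suc j) thus ?thesis using i by (intro exI[of _ j]) (auto simp: b_def q')
        qed
      qed
      moreover have "(\<Sum>i<q. (q + i) * nat \<bar>b i\<bar>) < (\<Sum>i<q. (q + i) * nat \<bar>a i\<bar>)"
      proof -
        \<comment> \<open>An entry moved from place i + 1 to place i loses its absolute value in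
          weight. The entry 2 c at place 0 weighs 2 q |c|, and - c at place q - 1 weighs (2 q - 1)
          |c|, again a loss of the new absolute value.\<close>
        have "nat \<bar>2 * c\<bar> = 2 * nat \<bar>c\<bar>" by (simp add: abs_mult nat_mult_distrib)
        hence "(\<Sum>i<q. (q + i) * nat \<bar>a i\<bar>) = (\<Sum>i<q. (q + i) * nat \<bar>b i\<bar>) + (\<Sum>i<q. nat \<bar>b i\<bar>)"
          unfolding sb[of "\<lambda>i x. (q + i) * nat \<bar>x\<bar>"] sa[of "\<lambda>i x. (q + i) * nat \<bar>x\<bar>"]
            sb[of "\<lambda>i x. nat \<bar>x\<bar>"]
          by (simp add: q' algebra_simps sum.distrib)
        moreover have "(\<Sum>i<q. nat \<bar>b i\<bar>) > 0" using nz by (auto intro!: sum_pos2)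
        ultimately show ?thesis by linarith
      qed
      ultimately show ?thesis using less.hyps by blast
    qed
  qed
  moreover have "n > 0" using n by (rule odd_pos)
  then obtain a where "\<exists>i<q. a i \<noteq> 0" "P a"
    using thue_vector[of n q r] q unfolding P_def by metis
  ultimately show ?thesis using that unfolding P_def by blast
qed

text \<open>The matrix of multiplication by \<open>\<Sum> a\<^sub>i \<theta>\<^sup>i\<close> on \<open>\<int>[\<theta>]\<close>, where \<open>\<theta>\<close> is a root of \<open>x ^ q + 2\<close>.\<close>
definition mult_mat :: "nat \<Rightarrow> (nat \<Rightarrow> int) \<Rightarrow> int mat" where
  "mult_mat q a = mat q q (\<lambda>(i, l). if i \<le> l then a (l - i) else - 2 * a (q + l - i))"

lemma mult_mat_carrier [simp]: "mult_mat q a \<in> carrier_mat q q"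
  by (simp add: mult_mat_def)

section \<open>Determinants of multiplication matrices: parity, size, divisibility\<close>

text \<open>Modulo 2 the matrix is upper triangular with \<open>a 0\<close> on the diagonal, because
  the entries below the diagonal carry the factor - 2.\<close>

lemma odd_det_mult_mat:
  assumes "odd (a 0)"
  shows "odd (det (mult_mat q a))"
proof -
  let ?t = "\<lambda>p. signof p * (\<Prod>i = 0..<q. mult_mat q a $$ (i, p i))"
  have fin: "finite {p. p permutes {0..<q}}" by (simp add: finite_permutations)
  have "det (mult_mat q a) = (\<Sum>p\<in>{p. p permutes {0..<q}}. ?t p)"
    by (rule det_def') simp
  also have "\<dots> = ?t id + (\<Sum>p\<in>{p. p permutes {0..<q}} - {id}. ?t p)"
    using fin by (subst sum.remove[of _ id]) (auto simp: permutes_id)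
  finally have eq: "det (mult_mat q a) = \<dots>" .
  have "(\<Prod>i = 0..<q. mult_mat q a $$ (i, id i)) = a 0 ^ q"
    by (simp add: mult_mat_def)
  hence 1: "odd (?t id)" using assms by simp
  have 2: "even (\<Sum>p\<in>{p. p permutes {0..<q}} - {id}. ?t p)"
  proof (rule dvd_sum)
    fix p assume p: "p \<in> {p. p permutes {0..<q}} - {id}"
    \<comment> \<open>A permutation other than the identity moves some index down and so picks an
      entry below the diagonal.\<close>
    obtain i where i: "i \<in> {0..<q}" "p i < i"
      using p permutes_natset_ge[of p "{0..<q}"] by (force simp: not_le)
    have "p i < q" using i by auto
    hence "even (mult_mat q a $$ (i, p i))" using i by (simp add: mult_mat_def)
    hence "even (\<Prod>i = 0..<q. mult_mat q a $$ (i, p i))"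
      using i by (meson dvd_prodI dvd_trans finite_atLeastLessThan)
    thus "even (?t p)" by simp
  qed
  show ?thesis unfolding eq using 1 2 by simp
qed

text \<open>Leibniz formula: \<open>fact q\<close> terms, each a product of q entries of size at
  most 2 h, where h ^ q \<le> n.\<close>

lemma abs_det_mult_mat_le:
  assumes "\<And>i. i < q \<Longrightarrow> nat \<bar>a i\<bar> ^ q \<le> n" "q \<ge> 1"
  shows "\<bar>det (mult_mat q a)\<bar> \<le> int (fact q * 2 ^ q * n)"
proof -
  obtain h where h: "h ^ q \<le> n" "n < (h + 1) ^ q" using nat_root_bracket[OF assms(2)] by blast
  have ah: "\<bar>a i\<bar> \<le> int h" if "i < q" for i
  proof (rule ccontr)
    assume "\<not> \<bar>a i\<bar> \<le> int h"
    hence "h + 1 \<le> nat \<bar>a i\<bar>" by linarith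
    hence "(h + 1) ^ q \<le> nat \<bar>a i\<bar> ^ q" by (rule power_mono) simp
    thus False using assms(1)[OF that] h by linarith
  qed
  have "\<bar>det (mult_mat q a)\<bar> \<le> (\<Sum>p\<in>{p. p permutes {0..<q}}.
      \<bar>signof p * (\<Prod>i = 0..<q. mult_mat q a $$ (i, p i))\<bar>)"
    by (subst det_def'[of _ q]) (auto intro: sum_abs)
  also have "\<dots> \<le> (\<Sum>p\<in>{p. p permutes {0..<q}}. (2 * int h) ^ q)"
  proof (rule sum_mono)
    fix p assume p: "p \<in> {p. p permutes {0..<q}}"
    have "\<bar>signof p * (\<Prod>i = 0..<q. mult_mat q a $$ (i, p i))\<bar> =
        (\<Prod>i = 0..<q. \<bar>mult_mat q a $$ (i, p i)\<bar>)"
      by (simp add: abs_mult sign_def abs_prod)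
    also have "\<dots> \<le> (\<Prod>i = 0..<q. 2 * int h)"
    proof (rule prod_mono, safe)
      fix i assume i: "i \<in> {0..<q}"
      hence pi: "p i < q" using p permutes_in_image[of p "{0..<q}" i] by auto
      have "p i - i < q" "p i < i \<longrightarrow> q + p i - i < q" using i pi by auto
      hence "\<bar>a (p i - i)\<bar> \<le> int h" "p i < i \<longrightarrow> \<bar>a (q + p i - i)\<bar> \<le> int h" using ah by blast+
      thus "\<bar>mult_mat q a $$ (i, p i)\<bar> \<le> 2 * int h"
        using i pi by (auto simp: mult_mat_def abs_mult not_le)
    qed simp
    also have "\<dots> = (2 * int h) ^ q" by simp
    finally show "\<bar>signof p * (\<Prod>i = 0..<q. mult_mat q a $$ (i, p i))\<bar> \<le> (2 * int h) ^ q" .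
  qed
  also have "\<dots> = int (fact q * (2 ^ q * h ^ q))"
    by (simp add: card_permutations power_mult_distrib)
  also have "\<dots> \<le> int (fact q * 2 ^ q * n)" using h by (simp only: of_nat_le_iff mult.assoc) simp
  finally show ?thesis .
qed

lemma prod_dvd_det_columns:
  fixes A :: "int mat"
  assumes A: "A \<in> carrier_mat q q" and "\<And>i j. i < q \<Longrightarrow> j < q \<Longrightarrow> c j dvd A $$ (i, j)"
  shows "(\<Prod>j<q. c j) dvd det A"
  unfolding det_col[OF A]
proof (rule dvd_sum)
  fix p assume p: "p \<in> {p. p permutes {0..<q}}"
  have "(\<Prod>j<q. c j) dvd (\<Prod>j<q. A $$ (p j, j))"
  proof (rule prod_dvd_prod)
    fix j assume "j \<in> {..<q}"
    hence j: "j < q" by simp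
    hence "p j < q" using p permutes_in_image[of p "{0..<q}" j] by auto
    thus "c j dvd A $$ (p j, j)" using assms(2) j by blast
  qed
  thus "(\<Prod>j<q. c j) dvd signof p * (\<Prod>j<q. A $$ (p j, j))" by (rule dvd_mult)
qed

text \<open>Row i holds the coefficients of theta ^ i times the given element. Substituting r for
  theta respects theta ^ q = - 2 modulo d, so the row evaluates to r ^ i times the value of the
  element at r.\<close>

lemma dvd_mult_mat_row:
  fixes d r :: int
  assumes "d dvd r ^ q + 2" "d dvd (\<Sum>i<q. a i * r ^ i)" "i < q"
  shows "d dvd (\<Sum>l<q. mult_mat q a $$ (i, l) * r ^ l)"
proof -
  have dec: "{..<q} = {..<q - i} \<union> {q - i..<q}" using assms(3) by auto
  have 1: "(\<Sum>l=i..<q. mult_mat q a $$ (i, l) * r ^ l) = (\<Sum>j<q-i. a j * r ^ (i + j))"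
    by (rule sum.reindex_bij_witness[of _ "\<lambda>j. i + j" "\<lambda>l. l - i"])
       (use assms(3) in \<open>auto simp: mult_mat_def\<close>)
  have 2: "(\<Sum>l<i. mult_mat q a $$ (i, l) * r ^ l) = (\<Sum>j=q-i..<q. - 2 * (a j * r ^ (i + j - q)))"
    by (rule sum.reindex_bij_witness[of _ "\<lambda>j. i + j - q" "\<lambda>l. q + l - i"])
       (use assms(3) in \<open>auto simp: mult_mat_def\<close>)
  have 3: "(\<Sum>j=q-i..<q. a j * r ^ (i + j)) = (\<Sum>j=q-i..<q. r ^ q * (a j * r ^ (i + j - q)))"
  proof (rule sum.cong)
    fix j assume "j \<in> {q - i..<q}"
    hence "i + j = q + (i + j - q)" by auto
    hence "r ^ (i + j) = r ^ q * r ^ (i + j - q)" by (metis power_add)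
    thus "a j * r ^ (i + j) = r ^ q * (a j * r ^ (i + j - q))" by simp
  qed simp
  have dec': "{..<q} = {..<i} \<union> {i..<q}" using assms(3) by auto
  have "(\<Sum>l<q. mult_mat q a $$ (i, l) * r ^ l) =
      (\<Sum>l<i. mult_mat q a $$ (i, l) * r ^ l) + (\<Sum>l=i..<q. mult_mat q a $$ (i, l) * r ^ l)"
    by (subst dec') (rule sum.union_disjoint, auto)
  moreover have "(\<Sum>j<q. a j * r ^ (i + j)) =
      (\<Sum>j<q-i. a j * r ^ (i + j)) + (\<Sum>j=q-i..<q. a j * r ^ (i + j))"
    by (subst dec) (rule sum.union_disjoint, auto)
  ultimately have "(\<Sum>l<q. mult_mat q a $$ (i, l) * r ^ l) =
      (\<Sum>j<q. a j * r ^ (i + j)) - (r ^ q + 2) * (\<Sum>j=q-i..<q. a j * r ^ (i + j - q))"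
    unfolding 1 2 3 sum_distrib_left[symmetric] by (simp add: distrib_right)
  also have "(\<Sum>j<q. a j * r ^ (i + j)) = r ^ i * (\<Sum>j<q. a j * r ^ j)"
    by (simp add: sum_distrib_left power_add algebra_simps)
  finally show ?thesis using assms by simp
qed

text \<open>The vector (1, r, ..., r ^ (q - 1)) is made the first column of a unimodular matrix; the
  first column of the product then consists of the row evaluations, all divisible by d.\<close>

lemma dvd_det_mult_mat:
  fixes d r :: int
  assumes "d dvd r ^ q + 2" "d dvd (\<Sum>i<q. a i * r ^ i)" "q \<ge> 1"
  shows "d dvd det (mult_mat q a)"
proof -
  define U where "U = mat q q (\<lambda>(l, j). if j = 0 then r ^ l else if l = j then 1 else 0)"
  have U: "U \<in> carrier_mat q q" by (simp add: U_def)
  have "det U = prod_list (diag_mat U)"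
    by (rule det_lower_triangular[OF _ U]) (auto simp: U_def)
  also have "diag_mat U = map (\<lambda>_. 1) [0..<q]"
    by (auto simp: diag_mat_def U_def)
  finally have dU: "det U = 1" by (simp add: map_replicate_const)
  have "(\<Prod>j<q. if j = 0 then d else 1) dvd det (mult_mat q a * U)"
  proof (rule prod_dvd_det_columns)
    fix i j assume ij: "i < q" "j < q"
    have "(mult_mat q a * U) $$ (i, 0) = (\<Sum>l<q. mult_mat q a $$ (i, l) * r ^ l)"
      using ij U by (simp add: scalar_prod_def U_def mult_mat_def atLeast0LessThan)
    thus "(if j = 0 then d else 1) dvd (mult_mat q a * U) $$ (i, j)"
      using dvd_mult_mat_row[OF assms(1,2) ij(1)] by simp
  qed (use mult_carrier_mat[OF mult_mat_carrier U] in auto)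
  thus ?thesis using assms(3) dU by (simp add: det_mult[OF _ U] prod.delta)
qed

text \<open>Two roots that differ modulo p give two columns divisible by p. The second column of U
  consists not of the powers of s but of the divided differences w l = (r ^ l - s ^ l) / (r - s): as
  w 0 = 0 and w 1 = 1, U stays triangular with unit diagonal, and r - s can be cancelled modulo
  p.\<close>

lemma square_dvd_det_mult_mat:
  fixes p r s :: int
  assumes p: "prime p" and r: "p dvd r ^ q + 2" "p dvd (\<Sum>i<q. a i * r ^ i)"
    and s: "p dvd s ^ q + 2" "p dvd (\<Sum>i<q. a i * s ^ i)" and rs: "\<not> p dvd r - s" and q: "q \<ge> 2"
  shows "p ^ 2 dvd det (mult_mat q a)"
proof -
  define w where "w = (\<lambda>l. \<Sum>t<l. r ^ t * s ^ (l - 1 - t))"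
  have w: "r ^ l - s ^ l = (r - s) * w l" for l
    by (cases l) (use diff_power_eq_sum[of r "l - 1" s] in \<open>simp_all add: w_def\<close>)
  define U where "U = mat q q (\<lambda>(l, j). if j = 0 then r ^ l else if j = 1 then w l else if l = j then 1 else 0)"
  have U: "U \<in> carrier_mat q q" by (simp add: U_def)
  have "det U = prod_list (diag_mat U)"
    by (rule det_lower_triangular[OF _ U]) (auto simp: U_def w_def)
  also have "diag_mat U = map (\<lambda>_. 1) [0..<q]"
    by (auto simp: diag_mat_def U_def w_def)
  finally have dU: "det U = 1" by (simp add: map_replicate_const)
  have "(\<Prod>j<q. if j \<le> 1 then p else 1) dvd det (mult_mat q a * U)"
  proof (rule prod_dvd_det_columns)
    fix i j assume ij: "i < q" "j < q"
    have 0: "(mult_mat q a * U) $$ (i, 0) = (\<Sum>l<q. mult_mat q a $$ (i, l) * r ^ l)"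
      using ij U by (simp add: scalar_prod_def U_def mult_mat_def atLeast0LessThan)
    have 1: "(mult_mat q a * U) $$ (i, 1) = (\<Sum>l<q. mult_mat q a $$ (i, l) * w l)"
      using ij U q by (simp add: scalar_prod_def U_def mult_mat_def atLeast0LessThan)
    have "(r - s) * (\<Sum>l<q. mult_mat q a $$ (i, l) * w l) =
        (\<Sum>l<q. mult_mat q a $$ (i, l) * r ^ l) - (\<Sum>l<q. mult_mat q a $$ (i, l) * s ^ l)"
      by (subst sum_distrib_left, subst sum_subtractf[symmetric], rule sum.cong)
         (simp_all add: w mult.left_commute flip: right_diff_distrib)
    also have "p dvd \<dots>"
      using dvd_mult_mat_row[OF r ij(1)] dvd_mult_mat_row[OF s ij(1)] by (rule dvd_diff)
    finally have "p dvd (\<Sum>l<q. mult_mat q a $$ (i, l) * w l)"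
      using rs p by (simp add: prime_dvd_mult_iff)
    moreover have "j = 0 \<or> j = 1 \<or> \<not> j \<le> 1" by linarith
    ultimately show "(if j \<le> 1 then p else 1) dvd (mult_mat q a * U) $$ (i, j)"
      using dvd_mult_mat_row[OF r ij(1)] 0 1 by auto
  qed (use mult_carrier_mat[OF mult_mat_carrier U] in auto)
  moreover have "(\<Prod>j<q. if j \<le> 1 then p else 1) = (\<Prod>j\<in>{0,1::nat}. p)"
    using q by (intro prod.mono_neutral_cong_right) (auto simp: not_le)
  ultimately show ?thesis using dU by (simp add: det_mult[OF _ U] power2_eq_square)
qed

section \<open>Counting roots modulo squarefree numbers\<close>

definition root_count :: "nat \<Rightarrow> nat \<Rightarrow> nat" where
  "root_count q n = card {r. r < n \<and> n dvd r ^ q + 2}"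

text \<open>Squarefree moduli are used so that distinct roots differ modulo a prime factor. U
  collects primes excluded for any reason: those up to the norm constant, those without a root, and
  those split off in the sieve steps.\<close>

definition sqfree_avoiding :: "nat set \<Rightarrow> nat \<Rightarrow> nat set" where
  "sqfree_avoiding U X = {n \<in> {1..X}. squarefree n \<and> (\<forall>p\<in>U. \<not> p dvd n)}"

lemma finite_sqfree_avoiding [simp]: "finite (sqfree_avoiding U X)"
  by (simp add: sqfree_avoiding_def)

lemma squarefree_separating_prime:
  fixes n r s :: nat
  assumes "squarefree n" "r < n" "s < n" "r \<noteq> s"
  obtains p where "prime p" "p dvd n" "\<not> int p dvd int r - int s"
proof -
  have n0: "n \<noteq> 0" using assms by auto
  have "\<not> int n dvd int r - int s"
  proof
    assume "int n dvd int r - int s"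
    hence "[int r = int s] (mod int n)" by (simp add: cong_iff_dvd_diff)
    hence "[r = s] (mod n)" by (simp add: cong_int_iff)
    thus False using assms by (simp add: cong_def)
  qed
  hence nd: "\<not> n dvd nat \<bar>int r - int s\<bar>" by simp
  have D0: "nat \<bar>int r - int s\<bar> \<noteq> 0" using assms(4) by simp
  have "\<exists>p. prime p \<and> p dvd n \<and> \<not> p dvd nat \<bar>int r - int s\<bar>"
  proof (rule ccontr)
    assume *: "\<not> ?thesis"
    have "n dvd nat \<bar>int r - int s\<bar>"
    proof (rule multiplicity_le_imp_dvd[OF n0])
      fix p :: nat assume p: "prime p"
      show "multiplicity p n \<le> multiplicity p (nat \<bar>int r - int s\<bar>)"
      proof (cases "p dvd n")
        case True
        hence "p dvd nat \<bar>int r - int s\<bar>" using * p by blast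
        hence "1 \<le> multiplicity p (nat \<bar>int r - int s\<bar>)"
          using D0 p by (intro multiplicity_geI) auto
        moreover have "multiplicity p n \<le> 1"
          using assms(1) p True n0 by (simp add: squarefree_factorial_semiring'' )
        ultimately show ?thesis by linarith
      qed (simp add: not_dvd_imp_multiplicity_0)
    qed
    thus False using nd by contradiction
  qed
  thus ?thesis using that by auto
qed

text \<open>To (n, r) belongs a short vector of norm D = n c with c \<le> C0, and the vector
  together with c determines (n, r). The vector fixes D, and c then fixes n. Two roots for the same
  n and vector would differ modulo a prime p dividing n, so p ^ 2 would divide n c; as n is
  squarefree, p would divide c, and the primes up to C0 lie in U. The entries are bounded by the
  q-th root of X, so there are O(X) vectors.\<close>

lemma sum_root_count_le:
  fixes q X :: nat
  assumes q: "q \<ge> 2" and X: "X \<ge> 1" and U: "{p. prime p \<and> p \<le> fact q * 2 ^ q} \<subseteq> U"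
  shows "(\<Sum>n\<in>sqfree_avoiding U X. root_count q n) \<le> fact q * 2 ^ q * 3 ^ q * X"
proof -
  define C0 :: nat where "C0 = fact q * 2 ^ q"
  define E where "E = Sigma (sqfree_avoiding U X) (\<lambda>n. {r. r < n \<and> n dvd r ^ q + 2})"
  have q1: "q \<ge> 1" using q by simp
  have "2 \<le> C0"
    using mult_le_mono[OF fact_ge_1[of q, where 'a=nat] self_le_power[of "2::nat" q]] q
    by (simp add: C0_def)
  hence two: "2 \<in> U" using U by (auto simp: C0_def)
  have "\<forall>x\<in>E. \<exists>a::nat\<Rightarrow>int. odd (a 0) \<and> (\<forall>i<q. nat \<bar>a i\<bar> ^ q \<le> fst x) \<and>
      int (fst x) dvd (\<Sum>i<q. a i * int (snd x) ^ i)"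
  proof
    fix x assume x: "x \<in> E"
    have o: "odd (fst x)" using x two by (auto simp: E_def sqfree_avoiding_def)
    have "fst x dvd snd x ^ q + 2" using x by (auto simp: E_def)
    hence "int (fst x) dvd int (snd x) ^ q + 2"
      by (metis of_nat_add of_nat_dvd_iff of_nat_numeral of_nat_power)
    from thue_vector_odd[OF o q1 this] show "\<exists>a::nat\<Rightarrow>int. odd (a 0) \<and> (\<forall>i<q. nat \<bar>a i\<bar> ^ q \<le> fst x) \<and>
      int (fst x) dvd (\<Sum>i<q. a i * int (snd x) ^ i)" by metis
  qed
  then obtain a where a: "\<And>x. x \<in> E \<Longrightarrow> odd (a x 0 :: int)"
    "\<And>x i. x \<in> E \<Longrightarrow> i < q \<Longrightarrow> nat \<bar>a x i\<bar> ^ q \<le> fst x"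
    "\<And>x. x \<in> E \<Longrightarrow> int (fst x) dvd (\<Sum>i<q. a x i * int (snd x) ^ i)"
    by metis
  \<comment> \<open>Restriction to the indices below q makes D a function of the first component of
    \<open>\<phi>\<close>.\<close>
  define D where "D = (\<lambda>x. nat \<bar>det (mult_mat q (restrict (a x) {..<q}))\<bar>)"
  have mres: "mult_mat q (restrict b {..<q}) = mult_mat q b" for b
    by (rule eq_matI) (auto simp: mult_mat_def)
  have Edvd: "int (fst x) dvd int (snd x) ^ q + 2" if "x \<in> E" for x
  proof -
    have "fst x dvd snd x ^ q + 2" using that by (auto simp: E_def)
    thus ?thesis by (metis of_nat_add of_nat_dvd_iff of_nat_numeral of_nat_power)
  qed
  have D0: "D x \<noteq> 0" if "x \<in> E" for x
    using odd_det_mult_mat[of "a x" q] a(1)[OF that] by (auto simp: D_def mres)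
  have Ddvd: "fst x dvd D x" if "x \<in> E" for x
  proof -
    have "int (fst x) dvd det (mult_mat q (a x))"
      using dvd_det_mult_mat[OF Edvd[OF that] a(3)[OF that] q1] .
    thus ?thesis by (simp add: D_def mres)
  qed
  have Dle: "D x \<le> C0 * fst x" if "x \<in> E" for x
    using abs_det_mult_mat_le[of q "a x" "fst x"] a(2)[OF that] q1
    by (simp add: D_def mres C0_def nat_le_iff)
  obtain H where H: "H ^ q \<le> X" "X < (H + 1) ^ q" using nat_root_bracket[OF q1] by blast
  define \<phi> where "\<phi> = (\<lambda>x. (restrict (a x) {..<q}, D x div fst x))"
  define T where "T = (PiE {..<q} (\<lambda>_. {- int H..int H})) \<times> {1..C0}"
  have im: "\<phi> ` E \<subseteq> T"
  proof (rule image_subsetI)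
    fix x assume x: "x \<in> E"
    have x1: "fst x > 0" "fst x \<le> X" using x by (auto simp: E_def sqfree_avoiding_def)
    have "a x i \<in> {- int H..int H}" if i: "i < q" for i
    proof -
      have le: "nat \<bar>a x i\<bar> ^ q < (H + 1) ^ q" using a(2)[OF x i] x1 H by simp
      hence "nat \<bar>a x i\<bar> < H + 1" by (rule power_less_imp_less_base) simp
      thus ?thesis by auto
    qed
    moreover have "D x div fst x \<in> {1..C0}"
    proof -
      obtain c where c: "D x = fst x * c" using Ddvd[OF x] by auto
      thus ?thesis using D0[OF x] Dle[OF x] x1 by auto
    qed
    ultimately show "\<phi> x \<in> T" by (auto simp: \<phi>_def T_def)
  qed
  have inj: "inj_on \<phi> E"
  proof (rule inj_onI)
    fix x y assume x: "x \<in> E" and y: "y \<in> E" and eq: "\<phi> x = \<phi> y"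
    have ra: "restrict (a x) {..<q} = restrict (a y) {..<q}" using eq by (simp add: \<phi>_def)
    hence Dxy: "D x = D y" by (simp add: D_def)
    obtain c where c: "D x = fst x * c" using Ddvd[OF x] by auto
    obtain d where d: "D y = fst y * d" using Ddvd[OF y] by auto
    have pos: "fst x > 0" "fst y > 0" using x y by (auto simp: E_def sqfree_avoiding_def)
    have cd: "c = d" using eq c d pos by (simp add: \<phi>_def)
    hence fxy: "fst x = fst y" using c d Dxy D0[OF x] by auto
    have cC: "c \<le> C0" using Dle[OF x] c pos by simp
    have "snd x = snd y"
    proof (rule ccontr)
      assume ne: "snd x \<noteq> snd y"
      have sf: "squarefree (fst x)" using x by (auto simp: E_def sqfree_avoiding_def)
      have lt: "snd x < fst x" "snd y < fst x" using x y fxy by (auto simp: E_def)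
      from squarefree_separating_prime[OF sf lt ne] obtain p where
        p: "prime p" "p dvd fst x" "\<not> int p dvd int (snd x) - int (snd y)" by blast
      have pi: "prime (int p)" "int p dvd int (fst x)" "int p dvd int (fst y)" using p fxy by auto
      have "(\<Sum>i<q. a y i * int (snd y) ^ i) = (\<Sum>i<q. a x i * int (snd y) ^ i)"
      proof (rule sum.cong)
        fix i assume "i \<in> {..<q}"
        thus "a y i * int (snd y) ^ i = a x i * int (snd y) ^ i" using fun_cong[OF ra, of i] by simp
      qed simp
      hence "int p ^ 2 dvd det (mult_mat q (a x))"
        using dvd_trans[OF pi(2) Edvd[OF x]] dvd_trans[OF pi(2) a(3)[OF x]]
          dvd_trans[OF pi(3) Edvd[OF y]] dvd_trans[OF pi(3) a(3)[OF y]]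
        by (intro square_dvd_det_mult_mat[OF pi(1) _ _ _ _ p(3) q]) auto
      hence "int (p ^ 2) dvd int (D x)" by (simp add: D_def mres)
      hence "p ^ 2 dvd fst x * c" unfolding c by (simp only: of_nat_dvd_iff)
      moreover obtain e where e: "fst x = p * e" using p by auto
      moreover have "\<not> p dvd e"
      proof
        assume "p dvd e"
        hence "p ^ 2 dvd fst x" using e by (simp add: power2_eq_square)
        thus False using sf p(1) unfolding squarefree_def by (metis not_prime_unit)
      qed
      ultimately have "p dvd c"
        using p(1) by (auto simp: power2_eq_square mult.assoc prime_dvd_mult_iff prime_gt_0_nat)
      moreover have "c > 0" using D0[OF x] c by (cases c) auto
      ultimately have "p \<le> C0" using cC dvd_imp_le le_trans by blast
      hence "p \<in> U" using U p(1) by (auto simp: C0_def)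
      thus False using x p(2) by (auto simp: E_def sqfree_avoiding_def)
    qed
    thus "x = y" using fxy by (simp add: prod_eq_iff)
  qed
  have "(\<Sum>n\<in>sqfree_avoiding U X. root_count q n) = card E"
    unfolding E_def root_count_def by (subst card_SigmaI) auto
  also have "\<dots> = card (\<phi> ` E)" using inj by (simp add: card_image)
  also have "\<dots> \<le> card T" using im by (intro card_mono) (auto simp: T_def intro!: finite_PiE)
  also have "card T = nat (2 * int H + 1) ^ q * C0"
    unfolding T_def card_cartesian_product by (subst card_PiE) (auto simp: algebra_simps)
  also have "nat (2 * int H + 1) = 2 * H + 1" by (simp add: nat_add_distrib nat_mult_distrib)
  \<comment> \<open>H \<ge> 1 because X \<ge> 1; this is the origin of the factor 3 ^ q.\<close>
  also have "(2 * H + 1) ^ q \<le> (3 * H) ^ q"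
  proof -
    have "H \<noteq> 0" using H X by (intro notI) simp
    thus ?thesis by (intro power_mono) auto
  qed
  also have "(3 * H) ^ q = 3 ^ q * H ^ q" by (rule power_mult_distrib)
  finally have "(\<Sum>n\<in>sqfree_avoiding U X. root_count q n) \<le> 3 ^ q * H ^ q * C0" by simp
  also have "\<dots> \<le> 3 ^ q * X * C0" using H by simp
  finally show ?thesis by (simp add: C0_def mult_ac)
qed

section \<open>Root counts of products and of primes\<close>

text \<open>Chinese remaindering maps pairs of roots injectively to roots modulo m n.\<close>

lemma root_count_mult_le:
  assumes "coprime m n" "m \<noteq> 0" "n \<noteq> 0"
  shows "root_count q m * root_count q n \<le> root_count q (m * n)"
proof -
  define R where "R = (\<lambda>n::nat. {r. r < n \<and> n dvd r ^ q + 2})"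
  have "\<forall>u v. \<exists>x. x < m * n \<and> [x = u] (mod m) \<and> [x = v] (mod n)"
    using binary_chinese_remainder_unique_nat[OF assms] by blast
  then obtain c where c: "\<And>u v. c u v < m * n" "\<And>u v. [c u v = u] (mod m)" "\<And>u v. [c u v = v] (mod n)"
    by metis
  have "inj_on (\<lambda>(u, v). c u v) (R m \<times> R n)"
  proof (rule inj_onI, safe)
    fix u v u' v' assume *: "u \<in> R m" "v \<in> R n" "u' \<in> R m" "v' \<in> R n" "c u v = c u' v'"
    have "[u = u'] (mod m)" using c(2)[of u v] c(2)[of u' v'] *(5) by (metis cong_sym cong_trans)
    thus "u = u'" using * by (auto simp: R_def cong_def)
    have "[v = v'] (mod n)" using c(3)[of u v] c(3)[of u' v'] *(5) by (metis cong_sym cong_trans)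
    thus "v = v'" using * by (auto simp: R_def cong_def)
  qed
  moreover have "(\<lambda>(u, v). c u v) ` (R m \<times> R n) \<subseteq> R (m * n)"
  proof safe
    fix u v assume *: "u \<in> R m" "v \<in> R n"
    have "[c u v ^ q + 2 = u ^ q + 2] (mod m)" "[c u v ^ q + 2 = v ^ q + 2] (mod n)"
      by (intro cong_add cong_pow c cong_refl)+
    hence "m dvd c u v ^ q + 2" "n dvd c u v ^ q + 2" using * cong_dvd_iff by (auto simp: R_def)
    hence "m * n dvd c u v ^ q + 2" using assms(1) divides_mult by blast
    thus "c u v \<in> R (m * n)" using c(1) by (simp add: R_def)
  qed
  ultimately have "card (R m \<times> R n) \<le> card (R (m * n))"
    by (rule card_inj_on_le) (simp add: R_def)
  thus ?thesis by (simp add: card_cartesian_product root_count_def R_def)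
qed

lemma root_count_prime_pos:
  assumes "p > 0" "p dvd r ^ q + 2"
  shows "root_count q p > 0"
proof -
  have "[(r mod p) ^ q + 2 = r ^ q + 2] (mod p)" by (intro cong_add cong_pow) (auto simp: cong_def)
  hence "r mod p \<in> {r. r < p \<and> p dvd r ^ q + 2}" using assms by (simp add: cong_dvd_iff)
  moreover have "finite {r. r < p \<and> p dvd r ^ q + 2}" by simp
  ultimately show ?thesis unfolding root_count_def using card_gt_0_iff by blast
qed

text \<open>With g a primitive root and e = (p - 1) / q, the powers of g ^ e are q distinct q-th
  roots of unity modulo p; multiplying the given root by them yields q roots. The condition p
  \<noteq> 2 makes r invertible.\<close>

lemma root_count_prime_ge:
  assumes p: "prime p" "p \<noteq> 2" "[p = 1] (mod q)" and q: "q \<ge> 1" and r: "p dvd r ^ q + 2"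
  shows "root_count q p \<ge> q"
proof -
  obtain g where g: "residue_primroot p g" using prime_primitive_root_exists[of p] p(1) prime_gt_1_nat by auto
  have p1: "p > 1" using p prime_gt_1_nat by blast
  have "q dvd p - 1" using p(3) p1 by (metis cong_altdef_nat less_imp_le_nat)
  then obtain e where e: "p - 1 = q * e" by auto
  have e0: "e > 0" using e p1 by (cases e) auto
  have cg: "coprime p g" and og: "ord p g = p - 1"
    using g p(1) by (auto simp: residue_primroot_def totient_prime)
  have "\<not> p dvd r"
  proof
    assume "p dvd r"
    hence "p dvd r ^ q" using q dvd_trans[OF _ dvd_power[of q r]] by simp
    hence "p dvd 2" using r dvd_add_right_iff by blast
    thus False using p primes_dvd_imp_eq two_is_prime_nat by blast
  qed
  hence cr: "coprime r p" using p(1) by (metis coprime_commute prime_imp_coprime)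
  define f where "f = (\<lambda>i. (r * g ^ (e * i)) mod p)"
  have "inj_on f {..<q}"
  proof (rule inj_onI)
    fix i j assume ij: "i \<in> {..<q}" "j \<in> {..<q}" "f i = f j"
    hence "[r * g ^ (e * i) = r * g ^ (e * j)] (mod p)" by (simp add: f_def cong_def)
    hence "[g ^ (e * i) = g ^ (e * j)] (mod p)" using cr cong_mult_lcancel_nat by blast
    hence "g ^ (e * i) mod p = g ^ (e * j) mod p" by (simp add: cong_def)
    moreover have "e * i < ord p g" "e * j < ord p g" using ij e0 unfolding og e by (auto simp: mult.commute)
    ultimately have "e * i = e * j" 
      using inj_onD[OF inj_power_mod[OF cg], of "e * i" "e * j"] by simp
    thus "i = j" using e0 by simp
  qed
  moreover have "f ` {..<q} \<subseteq> {r. r < p \<and> p dvd r ^ q + 2}"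
  proof safe
    fix i assume "i < q"
    have "[g ^ (p - 1) = 1] (mod p)" using ord_works[of g p] og by (metis ord)
    hence "[(g ^ (p - 1)) ^ i = 1 ^ i] (mod p)" by (rule cong_pow)
    moreover have "(g ^ (p - 1)) ^ i = (g ^ (e * i)) ^ q" unfolding e
      by (simp add: power_mult[symmetric] mult_ac)
    ultimately have 1: "[(g ^ (e * i)) ^ q = 1] (mod p)" by simp
    have "[f i ^ q + 2 = (r * g ^ (e * i)) ^ q + 2] (mod p)"
      by (intro cong_add cong_pow) (auto simp: f_def cong_def)
    also have "[(r * g ^ (e * i)) ^ q + 2 = r ^ q * 1 + 2] (mod p)"
      unfolding power_mult_distrib using 1 by (intro cong_add cong_mult) auto
    finally show "p dvd f i ^ q + 2" using r by (simp add: cong_dvd_iff)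
    show "f i < p" using p1 by (simp add: f_def)
  qed
  ultimately have "card {..<q} \<le> card {r. r < p \<and> p dvd r ^ q + 2}"
    by (rule card_inj_on_le) simp
  thus ?thesis by (simp add: root_count_def)
qed

lemma squarefree_prime_multE:
  fixes n p :: nat
  assumes "squarefree n" "prime p" "p dvd n"
  obtains e where "n = p * e" "coprime p e" "squarefree e" "e > 0" "e < n"
proof -
  obtain e where e: "n = p * e" using assms(3) by auto
  have "\<not> p dvd e"
  proof
    assume "p dvd e"
    hence "p ^ 2 dvd n" using e by (simp add: power2_eq_square)
    thus False using assms(1,2) unfolding squarefree_def by (metis not_prime_unit)
  qed
  hence "coprime p e" using assms(2) prime_imp_coprime by blast
  moreover have "squarefree e" using assms(1) e squarefree_multD by blast
  moreover have "e > 0" using assms(1) e by (cases "e = 0") auto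
  moreover from this have "e < n" using e prime_gt_1_nat[OF assms(2)] by simp
  ultimately show ?thesis using that e by blast
qed

lemma root_count_pos:
  assumes "squarefree n" "\<And>p. prime p \<Longrightarrow> p dvd n \<Longrightarrow> root_count q p > 0"
  shows "root_count q n > 0"
  using assms
proof (induction n rule: less_induct)
  case (less n)
  show ?case
  proof (cases "n = 1")
    case True thus ?thesis by (simp add: root_count_def)
  next
    case False
    then obtain p where p: "prime p" "p dvd n" using prime_factor_nat by blast
    obtain e where e: "n = p * e" "coprime p e" "squarefree e" "e > 0" "e < n"
      using squarefree_prime_multE[OF less.prems(1) p] by blast
    have "root_count q e > 0" using less.IH[of e] less.prems(2) e by simp
    moreover have "root_count q p > 0" using less.prems(2) p by blast
    moreover have "root_count q p * root_count q e \<le> root_count q n"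
      unfolding e(1) using root_count_mult_le[OF e(2)] e(4) p(1) prime_gt_0_nat by auto
    ultimately show ?thesis by (metis gr_zeroI le_zero_eq mult_is_0)
  qed
qed

section \<open>Harmonic sums over squarefree numbers\<close>

lemma ln_Suc_le_sum_inverse: "ln (real (Suc X)) \<le> (\<Sum>n=1..X. 1 / real n)"
proof (induction X)
  case (Suc X)
  have "real (Suc (Suc X)) = real (Suc X) * (1 + 1 / real (Suc X))"
    by (simp add: distrib_left del: of_nat_Suc)
  moreover have "ln (real (Suc X) * (1 + 1 / real (Suc X))) = ln (real (Suc X)) + ln (1 + 1 / real (Suc X))"
    by (rule ln_mult_pos) (auto intro: add_pos_pos)
  ultimately have "ln (real (Suc (Suc X))) = ln (real (Suc X)) + ln (1 + 1 / real (Suc X))"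
    by simp
  also have "ln (1 + 1 / real (Suc X)) \<le> 1 / real (Suc X)" by (rule ln_add_one_self_le_self) simp
  finally show ?case using Suc by simp
qed simp

lemma sum_inverse_le_ln:
  assumes "X \<ge> 1"
  shows "(\<Sum>n=1..X. 1 / real n) \<le> 1 + ln (real X)"
  using assms
proof (induction X rule: dec_induct)
  case (step X)
  have "real X = real (Suc X) * (1 - 1 / real (Suc X))"
    by (simp add: right_diff_distrib del: of_nat_Suc)
  moreover have "ln (real (Suc X) * (1 - 1 / real (Suc X))) = ln (real (Suc X)) + ln (1 - 1 / real (Suc X))"
    using step by (intro ln_mult_pos) auto
  ultimately have "ln (real X) = ln (real (Suc X)) + ln (1 - 1 / real (Suc X))" by simp
  also have "ln (1 - 1 / real (Suc X)) \<le> - 1 / real (Suc X)"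
    using ln_le_minus_one[of "1 - 1 / real (Suc X)"] step by simp
  finally show ?case using step by simp
qed simp

lemma sum_inverse_squares_le: "(\<Sum>n=1..X. 1 / real n ^ 2) \<le> 2"
proof -
  \<comment> \<open>Subtracting 1 / X makes the induction telescope. Since \<open>1 / real 0\<close>
    is 0, the step from X = 0 is treated apart.\<close>
  have "(\<Sum>n=1..X. 1 / real n ^ 2) \<le> 2 - 1 / real X"
  proof (induction X)
    case (Suc X)
    show ?case
    proof (cases "X = 0")
      case False
      define x where "x = real X"
      have x: "x > 0" using False by (simp add: x_def)
      have "1 / (x + 1) ^ 2 \<le> 1 / (x * (x + 1))"
        using x by (intro frac_le) (auto simp: power2_eq_square)
      also have "\<dots> = 1 / x - 1 / (x + 1)" using x by (simp add: field_simps)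
      finally show ?thesis using Suc by (simp add: x_def add.commute)
    qed simp
  qed simp
  moreover have "1 / real X \<ge> 0" by simp
  ultimately show ?thesis by linarith
qed

text \<open>Each n is a squarefree number times a square, so the harmonic sum is at most the
  squarefree one times the sum of the inverse squares.\<close>

lemma sum_inverse_le_sqfree:
  "(\<Sum>n=1..X. 1 / real n) \<le> 2 * (\<Sum>n\<in>sqfree_avoiding {} X. 1 / real n)"
proof -
  define \<phi> :: "nat \<Rightarrow> nat \<times> nat" where "\<phi> = (\<lambda>n. (squarefree_part n, square_part n))"
  define h where "h = (\<lambda>(a, b). 1 / real a * (1 / real b ^ 2))"
  have dec: "n = squarefree_part n * square_part n ^ 2" for n :: nat by (rule squarefree_decompose)
  have inj: "inj_on \<phi> {1..X}" by (rule inj_onI) (metis \<phi>_def dec prod.inject)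
  have im: "\<phi> ` {1..X} \<subseteq> sqfree_avoiding {} X \<times> {1..X}"
  proof (rule image_subsetI)
    fix n assume n: "n \<in> {1..X}"
    have "squarefree_part n dvd n" "square_part n ^ 2 dvd n" using dec[of n] by (metis dvd_triv_left, simp)
    moreover have "square_part n dvd square_part n ^ 2" by simp
    ultimately have "squarefree_part n dvd n" "square_part n dvd n" using dvd_trans by blast+
    hence "squarefree_part n \<le> X" "square_part n \<le> X" "squarefree_part n > 0" "square_part n > 0"
      using n by (auto dest!: dvd_imp_le intro!: Nat.gr0I)
    thus "\<phi> n \<in> sqfree_avoiding {} X \<times> {1..X}" by (auto simp: \<phi>_def sqfree_avoiding_def)
  qed
  have "(\<Sum>n=1..X. 1 / real n) = (\<Sum>n=1..X. h (\<phi> n))"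
  proof (rule sum.cong)
    fix n
    have "real n = real (squarefree_part n) * real (square_part n) ^ 2"
      using dec[of n] by (metis of_nat_mult of_nat_power)
    thus "1 / real n = h (\<phi> n)" by (simp add: h_def \<phi>_def)
  qed simp
  also have "\<dots> = (\<Sum>x\<in>\<phi> ` {1..X}. h x)" using inj by (simp add: sum.reindex)
  also have "\<dots> \<le> (\<Sum>x\<in>sqfree_avoiding {} X \<times> {1..X}. h x)"
    using im by (intro sum_mono2) (auto simp: h_def)
  also have "\<dots> = (\<Sum>n\<in>sqfree_avoiding {} X. 1 / real n) * (\<Sum>n=1..X. 1 / real n ^ 2)"
    by (simp only: h_def sum.cartesian_product[symmetric] sum_product)
  also have "\<dots> \<le> (\<Sum>n\<in>sqfree_avoiding {} X. 1 / real n) * 2"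
    using sum_inverse_squares_le by (intro mult_left_mono sum_nonneg) auto
  finally show ?thesis by simp
qed

lemma sqfree_avoiding_insert:
  assumes "prime p"
  shows "sqfree_avoiding U X = sqfree_avoiding (insert p U) X \<union> {n \<in> sqfree_avoiding U X. p dvd n}"
    "{n \<in> sqfree_avoiding U X. p dvd n} \<subseteq> (*) p ` sqfree_avoiding (insert p U) X"
proof -
  show "{n \<in> sqfree_avoiding U X. p dvd n} \<subseteq> (*) p ` sqfree_avoiding (insert p U) X"
  proof
    fix n assume "n \<in> {n \<in> sqfree_avoiding U X. p dvd n}"
    hence n: "squarefree n" "p dvd n" "n \<le> X" "\<forall>u\<in>U. \<not> u dvd n" by (auto simp: sqfree_avoiding_def)
    obtain e where e: "n = p * e" "coprime p e" "squarefree e" "e > 0" "e < n"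
      using squarefree_prime_multE[OF n(1) assms n(2)] by blast
    have "\<not> p dvd e" using e(2) assms by (metis coprime_absorb_left not_prime_unit)
    moreover have "e \<le> X" using e(5) n(3) by linarith
    moreover have "\<forall>u\<in>U. \<not> u dvd e" using n(4) e(1) by (metis dvd_mult)
    ultimately have "e \<in> sqfree_avoiding (insert p U) X" using e(3,4) by (simp add: sqfree_avoiding_def)
    thus "n \<in> (*) p ` sqfree_avoiding (insert p U) X" using e by blast
  qed
qed (auto simp: sqfree_avoiding_def)

text \<open>The multiples of p are p e with e free of p, so they contribute at most 1 / p of the sum
  over the numbers avoiding p. Iterated, excluding a finite set of primes costs a factor independent
  of X.\<close>

lemma sum_sqfree_insert_le:
  assumes "prime p"
  shows "(\<Sum>n\<in>sqfree_avoiding U X. 1 / real n) \<le>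
    (1 + 1 / real p) * (\<Sum>n\<in>sqfree_avoiding (insert p U) X. 1 / real n)"
proof -
  let ?S = "sqfree_avoiding (insert p U) X"
  have p0: "p > 0" using assms prime_gt_0_nat by blast
  have "(\<Sum>n\<in>sqfree_avoiding U X. 1 / real n) =
      (\<Sum>n\<in>?S. 1 / real n) + (\<Sum>n\<in>{n \<in> sqfree_avoiding U X. p dvd n}. 1 / real n)"
    by (subst sqfree_avoiding_insert(1)[OF assms], rule sum.union_disjoint)
       (auto simp: sqfree_avoiding_def)
  also have "(\<Sum>n\<in>{n \<in> sqfree_avoiding U X. p dvd n}. 1 / real n) \<le> (\<Sum>n\<in>(*) p ` ?S. 1 / real n)"
    using sqfree_avoiding_insert(2)[OF assms] by (intro sum_mono2) auto
  also have "\<dots> = (\<Sum>n\<in>?S. 1 / real (p * n))"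
    using p0 by (subst sum.reindex) (auto simp: inj_on_def)
  also have "\<dots> = 1 / real p * (\<Sum>n\<in>?S. 1 / real n)" by (simp add: sum_distrib_left)
  finally show ?thesis by (simp add: distrib_right)
qed

lemma sum_sqfree_le_prod:
  assumes "finite U" "\<And>p. p \<in> U \<Longrightarrow> prime p"
  shows "(\<Sum>n\<in>sqfree_avoiding {} X. 1 / real n) \<le>
    (\<Prod>p\<in>U. 1 + 1 / real p) * (\<Sum>n\<in>sqfree_avoiding U X. 1 / real n)"
  using assms
proof (induction U rule: finite_induct)
  case (insert p U)
  have "(\<Sum>n\<in>sqfree_avoiding {} X. 1 / real n) \<le>
      (\<Prod>p\<in>U. 1 + 1 / real p) * (\<Sum>n\<in>sqfree_avoiding U X. 1 / real n)" using insert by simp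
  also have "\<dots> \<le> (\<Prod>p\<in>U. 1 + 1 / real p) *
      ((1 + 1 / real p) * (\<Sum>n\<in>sqfree_avoiding (insert p U) X. 1 / real n))"
    using insert by (intro mult_left_mono sum_sqfree_insert_le prod_nonneg) auto
  finally show ?case using insert by (simp add: mult_ac)
qed simp

section \<open>Upper and lower estimates of the weighted root count\<close>

text \<open>Each n avoiding p is used twice, as n and as p n, and the latter has at least q times as
  many roots. The range grows from X to X p, which only shifts ln X by a constant.\<close>

lemma sum_root_count_insert_ge:
  assumes p: "prime p" "p \<notin> U" "root_count q p \<ge> q" and U: "\<And>u. u \<in> U \<Longrightarrow> prime u"
  shows "(1 + real q / real p) * (\<Sum>n\<in>sqfree_avoiding (insert p U) X. real (root_count q n) / real n)
    \<le> (\<Sum>n\<in>sqfree_avoiding U (X * p). real (root_count q n) / real n)"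
proof -
  let ?S = "sqfree_avoiding (insert p U) X"
  let ?f = "\<lambda>n. real (root_count q n) / real n"
  have p0: "p > 0" using p prime_gt_0_nat by blast
  have cop: "coprime p n" if "n \<in> ?S" for n
    using that p(1) by (intro prime_imp_coprime) (auto simp: sqfree_avoiding_def)
  have "(1 + real q / real p) * (\<Sum>n\<in>?S. ?f n) = (\<Sum>n\<in>?S. ?f n) + (\<Sum>n\<in>?S. real q / real p * ?f n)"
    by (subst sum_distrib_left[symmetric]) (simp add: distrib_right)
  also have "(\<Sum>n\<in>?S. real q / real p * ?f n) \<le> (\<Sum>n\<in>?S. ?f (p * n))"
  proof (rule sum_mono)
    fix n assume n: "n \<in> ?S"
    have "q * root_count q n \<le> root_count q p * root_count q n" using p by simp
    also have "\<dots> \<le> root_count q (p * n)"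
      using root_count_mult_le[OF cop[OF n]] p0 n by (auto simp: sqfree_avoiding_def)
    finally have "real q * real (root_count q n) \<le> real (root_count q (p * n))"
      by (metis of_nat_le_iff of_nat_mult)
    thus "real q / real p * ?f n \<le> ?f (p * n)" by (simp add: divide_right_mono)
  qed
  also have "(\<Sum>n\<in>?S. ?f (p * n)) = (\<Sum>n\<in>(*) p ` ?S. ?f n)"
    using p0 by (subst sum.reindex) (auto simp: inj_on_def)
  also have "(\<Sum>n\<in>?S. ?f n) + (\<Sum>n\<in>(*) p ` ?S. ?f n) = (\<Sum>n\<in>?S \<union> (*) p ` ?S. ?f n)"
    by (rule sum.union_disjoint[symmetric]) (auto simp: sqfree_avoiding_def)
  also have "\<dots> \<le> (\<Sum>n\<in>sqfree_avoiding U (X * p). ?f n)"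
  proof (rule sum_mono2)
    show "?S \<union> (*) p ` ?S \<subseteq> sqfree_avoiding U (X * p)"
    proof safe
      fix n assume "n \<in> ?S"
      moreover have "X \<le> X * p" using p0 by simp
      ultimately show "n \<in> sqfree_avoiding U (X * p)" unfolding sqfree_avoiding_def
        by (auto intro: le_trans)
    next
      fix n assume n: "n \<in> ?S"
      have "squarefree (p * n)" using cop[OF n] n p(1)
        by (intro squarefree_mult_coprime) (auto simp: sqfree_avoiding_def squarefree_prime)
      moreover have "\<not> u dvd p * n" if u: "u \<in> U" for u
      proof
        assume "u dvd p * n"
        hence "u dvd p \<or> u dvd n" using U[OF u] prime_dvd_mult_iff by blast
        moreover have "\<not> u dvd n" using n u by (auto simp: sqfree_avoiding_def)
        ultimately show False using U[OF u] u p primes_dvd_imp_eq by blast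
      qed
      ultimately show "p * n \<in> sqfree_avoiding U (X * p)"
        using n p0 by (auto simp: sqfree_avoiding_def mult.commute)
    qed
  qed auto
  finally show ?thesis by simp
qed

lemma sum_root_count_ge_prod:
  assumes "finite T" "T \<inter> U = {}" "\<And>p. p \<in> T \<union> U \<Longrightarrow> prime p" "\<And>p. p \<in> T \<Longrightarrow> root_count q p \<ge> q"
  shows "(\<Prod>p\<in>T. 1 + real q / real p) * (\<Sum>n\<in>sqfree_avoiding (T \<union> U) X. real (root_count q n) / real n)
    \<le> (\<Sum>n\<in>sqfree_avoiding U (X * \<Prod>T). real (root_count q n) / real n)"
  using assms
proof (induction T arbitrary: X rule: finite_induct)
  case (insert p T)
  let ?f = "\<lambda>n. real (root_count q n) / real n"
  have "(\<Prod>p\<in>insert p T. 1 + real q / real p) * (\<Sum>n\<in>sqfree_avoiding (insert p T \<union> U) X. ?f n) =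
      (\<Prod>p\<in>T. 1 + real q / real p) *
      ((1 + real q / real p) * (\<Sum>n\<in>sqfree_avoiding (insert p (T \<union> U)) X. ?f n))"
    using insert by (simp add: mult_ac)
  also have "\<dots> \<le> (\<Prod>p\<in>T. 1 + real q / real p) * (\<Sum>n\<in>sqfree_avoiding (T \<union> U) (X * p). ?f n)"
    using insert by (intro mult_left_mono sum_root_count_insert_ge prod_nonneg) auto
  also have "\<dots> \<le> (\<Sum>n\<in>sqfree_avoiding U (X * p * \<Prod>T). ?f n)"
    using insert by (intro insert.IH) auto
  finally show ?case using insert by (simp add: mult_ac)
qed simp

text \<open>Partial summation: 1 / n is 1 / (X + 1) plus the telescoping sum of 1 / (j (j + 1)) over
  n \<le> j \<le> X.\<close>

lemma sum_div_le_of_sum_le: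
  fixes g :: "nat \<Rightarrow> real"
  assumes "\<And>Y. (\<Sum>n=1..Y. g n) \<le> C * real Y" "X \<ge> 1" "C \<ge> 0"
  shows "(\<Sum>n=1..X. g n / real n) \<le> C * (2 + ln (real X))"
proof -
  have "(\<Sum>n=1..X. g n / real n) = (\<Sum>n=1..X. g n) / real (Suc X) +
      (\<Sum>n=1..X. (\<Sum>k=1..n. g k) / (real n * real (Suc n)))" for X
  proof (induction X)
    case (Suc X)
    define A where "A = sum g {Suc 0..X}"
    define x where "x = real (Suc X)"
    have x: "x > 0" by (simp add: x_def)
    have "A / x + g (Suc X) / x = (A + g (Suc X)) / (x + 1) + (A + g (Suc X)) / (x * (x + 1))"
      using x by (simp add: divide_simps) (simp add: algebra_simps)
    moreover have "real (Suc (Suc X)) = x + 1" by (simp add: x_def)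
    ultimately show ?case using Suc by (simp add: A_def[symmetric] x_def[symmetric] del: of_nat_Suc)
  qed simp
  also have "(\<Sum>n=1..X. g n) / real (Suc X) \<le> C"
  proof -
    have "(\<Sum>n=1..X. g n) \<le> C * real X" by (rule assms)
    also have "\<dots> \<le> C * real (Suc X)" using assms(3) by (intro mult_left_mono) auto
    finally show ?thesis by (simp add: divide_le_eq)
  qed
  also have "(\<Sum>n=1..X. (\<Sum>k=1..n. g k) / (real n * real (Suc n))) \<le> (\<Sum>n=1..X. C * (1 / real n))"
  proof (rule sum_mono)
    fix n assume n: "n \<in> {1..X}"
    have "(\<Sum>k=1..n. g k) / (real n * real (Suc n)) \<le> C * real n / (real n * real (Suc n))"
      using assms(1) by (intro divide_right_mono) auto
    also have "\<dots> = C * (1 / real (Suc n))" using n by simp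
    also have "\<dots> \<le> C * (1 / real n)" using n assms(3) by (intro mult_left_mono) (auto simp: frac_le)
    finally show "(\<Sum>k=1..n. g k) / (real n * real (Suc n)) \<le> C * (1 / real n)" .
  qed
  also have "\<dots> = C * (\<Sum>n=1..X. 1 / real n)" by (simp add: sum_distrib_left)
  also have "\<dots> \<le> C * (1 + ln (real X))" using sum_inverse_le_ln[OF assms(2)] assms(3) by (rule mult_left_mono)
  finally show ?thesis by (simp add: algebra_simps)
qed

lemma one_add_sum_le_prod:
  fixes f :: "'a \<Rightarrow> real"
  assumes "finite T" "\<And>x. x \<in> T \<Longrightarrow> f x \<ge> 0"
  shows "1 + sum f T \<le> (\<Prod>x\<in>T. 1 + f x)"
  using assms
proof (induction T rule: finite_induct)
  case (insert x T)
  have "1 + sum f T \<le> (\<Prod>x\<in>T. 1 + f x)" using insert by simp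
  hence "(1 + f x) * (1 + sum f T) \<le> (1 + f x) * (\<Prod>x\<in>T. 1 + f x)"
    using insert.prems[of x] by (intro mult_left_mono) auto
  moreover have "f x * sum f T \<ge> 0" using insert by (intro mult_nonneg_nonneg sum_nonneg) auto
  ultimately show ?case using insert by (simp add: algebra_simps)
qed simp

lemma linear_bound_imp_le:
  fixes A C K :: real
  assumes "\<And>X::nat. X \<ge> 1 \<Longrightarrow> A * ln (real X) \<le> K + C * ln (real X)"
  shows "A \<le> C"
proof (rule ccontr)
  assume "\<not> A \<le> C"
  hence pos: "A - C > 0" by simp
  define y where "y = (\<bar>K\<bar> + 1) / (A - C)"
  obtain X :: nat where X: "exp y \<le> real X" using real_arch_simple by blast
  have X0: "real X > 0" using X exp_gt_zero[of y] by linarith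
  hence "y \<le> ln (real X)" using X by (simp add: ln_ge_iff)
  hence "(A - C) * y \<le> (A - C) * ln (real X)" using pos by (intro mult_left_mono) auto
  moreover have "(A - C) * y = \<bar>K\<bar> + 1" using pos by (simp add: y_def)
  moreover have "A * ln (real X) \<le> K + C * ln (real X)" using X0 by (intro assms) simp
  ultimately show False by (simp add: left_diff_distrib)
qed

text \<open>The sum of \<open>root_count q n / n\<close> over the admissible n is squeezed between C
  (2 + ln X) and, up to an error bounded in X, A ln X / (2 c B): each p in T contributes 1 + q / p
  to A for its q roots and 1 + 1 / p to B for being sieved out. Letting X grow gives A / B \<le> 2 c
  C, where c and C do not depend on T, while A / B dominates the sum of 1 / (2 p) because q \<ge>
  2.\<close>

lemma sum_inverse_primes_bounded:
  fixes C q :: nat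
  assumes U: "finite U" "\<And>p. p \<in> U \<Longrightarrow> prime p" "2 \<in> U" and q: "q \<ge> 2"
    and bound: "\<And>X. X \<ge> 1 \<Longrightarrow> (\<Sum>n\<in>sqfree_avoiding U X. root_count q n) \<le> C * X"
    and roots: "\<And>p. prime p \<Longrightarrow> p \<notin> U \<Longrightarrow> \<exists>r::nat. p dvd r ^ q + 2"
  obtains W :: real where
    "\<And>T. finite T \<Longrightarrow> T \<subseteq> {p. prime p \<and> p \<notin> U \<and> [p = 1] (mod q)} \<Longrightarrow> (\<Sum>p\<in>T. 1 / real p) \<le> W"
proof
  define c where "c = (\<Prod>p\<in>U. 1 + 1 / real p)"
  have c: "c > 0" unfolding c_def by (intro prod_pos) (auto intro: add_pos_nonneg)
  fix T assume T: "finite T" "T \<subseteq> {p. prime p \<and> p \<notin> U \<and> [p = 1] (mod q)}"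
  have Tp: "p > 0" if "p \<in> T" for p using T that by (auto intro: prime_gt_0_nat)
  define P where "P = (\<Prod>T)"
  have P: "P \<ge> 1" unfolding P_def by (intro prod_ge_1) (use Tp in \<open>auto simp: Suc_leI\<close>)
  let ?f = "\<lambda>n. real (root_count q n) / real n"
  define A where "A = (\<Prod>p\<in>T. 1 + real q / real p)"
  define B where "B = (\<Prod>p\<in>T. 1 + 1 / real p)"
  have A: "A > 0" unfolding A_def by (intro prod_pos) (auto intro: add_pos_nonneg)
  have B: "B > 0" unfolding B_def by (intro prod_pos) (auto intro: add_pos_nonneg)
  have up: "(\<Sum>n\<in>sqfree_avoiding U X. ?f n) \<le> real C * (2 + ln (real X))" if X: "X \<ge> 1" for X
  proof -
    define g where "g = (\<lambda>n. if squarefree n \<and> (\<forall>p\<in>U. \<not> p dvd n) then real (root_count q n) else 0)"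
    have "(\<Sum>n=1..Y. g n) \<le> real C * real Y" for Y
    proof (cases "Y \<ge> 1")
      case True
      have "(\<Sum>n=1..Y. g n) = real (\<Sum>n\<in>sqfree_avoiding U Y. root_count q n)"
        unfolding of_nat_sum g_def sqfree_avoiding_def by (rule sum.inter_filter[symmetric]) simp
      also have "\<dots> \<le> real (C * Y)" using bound[OF True] by (simp only: of_nat_le_iff)
      finally show ?thesis by simp
    qed simp
    hence "(\<Sum>n=1..X. g n / real n) \<le> real C * (2 + ln (real X))"
      using X by (intro sum_div_le_of_sum_le) auto
    moreover have "(\<Sum>n=1..X. g n / real n) = (\<Sum>n\<in>sqfree_avoiding U X. ?f n)"
    proof -
      have "(\<Sum>n\<in>sqfree_avoiding U X. ?f n) = (\<Sum>n=1..X. if squarefree n \<and> (\<forall>p\<in>U. \<not> p dvd n) then ?f n else 0)"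
        unfolding sqfree_avoiding_def by (rule sum.inter_filter) simp
      also have "\<dots> = (\<Sum>n=1..X. g n / real n)" by (rule sum.cong) (auto simp: g_def)
      finally show ?thesis by simp
    qed
    ultimately show ?thesis by simp
  qed
  have low: "ln (real X) \<le> 2 * (c * B * (\<Sum>n\<in>sqfree_avoiding (T \<union> U) X. ?f n))" if X: "X \<ge> 1" for X
  proof -
    have "ln (real X) \<le> ln (real (Suc X))" using X by simp
    also have "\<dots> \<le> (\<Sum>n=1..X. 1 / real n)" by (rule ln_Suc_le_sum_inverse)
    also have "\<dots> \<le> 2 * (\<Sum>n\<in>sqfree_avoiding {} X. 1 / real n)" by (rule sum_inverse_le_sqfree)
    also have "(\<Sum>n\<in>sqfree_avoiding {} X. 1 / real n) \<le>
        (\<Prod>p\<in>T \<union> U. 1 + 1 / real p) * (\<Sum>n\<in>sqfree_avoiding (T \<union> U) X. 1 / real n)"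
      using T U by (intro sum_sqfree_le_prod) auto
    also have "(\<Prod>p\<in>T \<union> U. 1 + 1 / real p) = c * B"
      unfolding c_def B_def using T U by (subst prod.union_disjoint) (auto simp: mult.commute)
    \<comment> \<open>Primes outside T enter only through having at least one root, which makes
      every root count here at least 1.\<close>
    also have "(\<Sum>n\<in>sqfree_avoiding (T \<union> U) X. 1 / real n) \<le> (\<Sum>n\<in>sqfree_avoiding (T \<union> U) X. ?f n)"
    proof (rule sum_mono)
      fix n assume n: "n \<in> sqfree_avoiding (T \<union> U) X"
      have "root_count q n > 0"
      proof (rule root_count_pos)
        fix p assume p: "prime p" "p dvd n"
        hence "p \<notin> U" using n by (auto simp: sqfree_avoiding_def)
        then obtain r where "p dvd r ^ q + 2" using roots p by blast
        thus "root_count q p > 0" using p prime_gt_0_nat root_count_prime_pos by blast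
      qed (use n in \<open>simp add: sqfree_avoiding_def\<close>)
      hence "1 \<le> real (root_count q n)" by simp
      thus "1 / real n \<le> ?f n" by (rule divide_right_mono) simp
    qed
    finally show ?thesis using c B by (simp add: mult_left_mono)
  qed
  have mid: "A * (\<Sum>n\<in>sqfree_avoiding (T \<union> U) X. ?f n) \<le> (\<Sum>n\<in>sqfree_avoiding U (X * P). ?f n)" for X
    unfolding A_def P_def
  proof (rule sum_root_count_ge_prod)
    fix p assume "p \<in> T"
    hence p: "prime p" "p \<notin> U" "[p = 1] (mod q)" using T by auto
    obtain r where "p dvd r ^ q + 2" using roots[OF p(1,2)] by blast
    moreover have "p \<noteq> 2" using p(2) U(3) by blast
    ultimately show "q \<le> root_count q p" using p q by (intro root_count_prime_ge) auto
  qed (use T U in auto)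
  have "A / (2 * c * B) \<le> real C"
  proof (rule linear_bound_imp_le)
    fix X :: nat assume X: "X \<ge> 1"
    have "A / (2 * c * B) * ln (real X) \<le>
        A / (2 * c * B) * (2 * (c * B * (\<Sum>n\<in>sqfree_avoiding (T \<union> U) X. ?f n)))"
      using low[OF X] A B c by (intro mult_left_mono) auto
    also have "\<dots> = A * (\<Sum>n\<in>sqfree_avoiding (T \<union> U) X. ?f n)"
      using B c by (simp add: field_simps)
    also have "\<dots> \<le> (\<Sum>n\<in>sqfree_avoiding U (X * P). ?f n)" by (rule mid)
    also have "\<dots> \<le> real C * (2 + ln (real (X * P)))"
    proof (rule up)
      show "1 \<le> X * P" using X P by (metis mult_le_mono mult.right_neutral)
    qed
    also have "\<dots> = real C * (2 + ln (real P)) + real C * ln (real X)"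
      using X P by (simp add: ln_mult_pos distrib_left)
    finally show "A / (2 * c * B) * ln (real X) \<le> real C * (2 + ln (real P)) + real C * ln (real X)" .
  qed
  hence AB: "A / B \<le> 2 * c * real C" using B c by (simp add: field_simps)
  have "(\<Sum>p\<in>T. 1 / real p) / 2 = (\<Sum>p\<in>T. 1 / (2 * real p))" by (simp add: sum_divide_distrib mult.commute)
  also have "\<dots> \<le> 1 + (\<Sum>p\<in>T. 1 / (2 * real p))" by simp
  also have "\<dots> \<le> (\<Prod>p\<in>T. 1 + 1 / (2 * real p))" using T by (intro one_add_sum_le_prod) auto
  also have "\<dots> \<le> (\<Prod>p\<in>T. (1 + real q / real p) / (1 + 1 / real p))"
  proof (rule prod_mono, safe)
    fix p assume "p \<in> T"
    hence p: "real p \<ge> 1" using Tp[of p] by simp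
    have q2: "real q \<ge> 2" using q by simp
    have "(1 + 1 / (2 * real p)) * (1 + 1 / real p) = 1 + 1 / real p * (3 / 2 + 1 / (2 * real p))"
      using p by (simp add: field_simps)
    also have "\<dots> \<le> 1 + 1 / real p * 2"
      using p by (intro add_left_mono mult_left_mono) (auto simp: field_simps)
    also have "\<dots> \<le> 1 + real q / real p" using q2 p by (simp add: divide_right_mono)
    finally show "1 + 1 / (2 * real p) \<le> (1 + real q / real p) / (1 + 1 / real p)"
      using p by (subst pos_le_divide_eq) (auto intro: add_pos_nonneg)
  qed simp
  also have "\<dots> = A / B" unfolding A_def B_def by (rule prod_dividef)
  also note AB
  finally show "(\<Sum>p\<in>T. 1 / real p) \<le> 2 * (2 * c * real C)" by simp
qed

section \<open>Primes congruent to 1 modulo a prime\<close>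

lemma sum_divisors_swap:
  fixes F :: "nat \<Rightarrow> nat \<Rightarrow> 'a::comm_monoid_add"
  shows "(\<Sum>n=1..x. \<Sum>d | d dvd n. F d (n div d)) = (\<Sum>d=1..x. \<Sum>m=1..x div d. F d m)"
proof -
  have "(\<Sum>n=1..x. \<Sum>d | d dvd n. F d (n div d)) =
      (\<Sum>(n, d)\<in>(SIGMA n:{1..x}. {d. d dvd n}). F d (n div d))"
    by (rule sum.Sigma) (auto intro: finite_divisors_nat)
  also have "\<dots> = (\<Sum>(d, m)\<in>(SIGMA d:{1..x}. {1..x div d}). F d m)"
  proof (rule sum.reindex_bij_witness[of _ "\<lambda>(d, m). (d * m, d)" "\<lambda>(n, d). (d, n div d)"], goal_cases)
    case (2 a)
    then obtain n d where a: "a = (n, d)" "n \<in> {1..x}" "d dvd n" by auto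
    have "d > 0" using a by (auto intro: Nat.gr0I)
    moreover have "d \<le> x" using a dvd_imp_le[of d n] by auto
    moreover have "1 \<le> n div d" using a \<open>d > 0\<close> by (simp add: Suc_leI div_greater_zero_iff dvd_imp_le)
    moreover have "n div d \<le> x div d" using a by (intro div_le_mono) auto
    ultimately show ?case using a by auto
  next
    case (4 b)
    then obtain d m where b: "b = (d, m)" "d \<in> {1..x}" "m \<in> {1..x div d}" by auto
    have "d * m \<le> x" using b by (metis atLeastAtMost_iff le_trans mult_le_mono2 times_div_less_eq_dividend)
    thus ?case using b by auto
  qed auto
  also have "\<dots> = (\<Sum>d=1..x. \<Sum>m=1..x div d. F d m)"
    by (rule sum.Sigma[symmetric]) auto
  finally show ?thesis .
qed

text \<open>Both sides range over the pairs (d, e) with d e dividing n.\<close>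

lemma sum_divisors_commute:
  fixes h :: "nat \<Rightarrow> nat \<Rightarrow> 'a::comm_monoid_add"
  assumes "n > 0"
  shows "(\<Sum>d | d dvd n. \<Sum>e | e dvd n div d. h d e) = (\<Sum>e | e dvd n. \<Sum>d | d dvd n div e. h d e)"
proof -
  have fin: "finite {d. d dvd m}" if "m dvd n" for m
    using that assms by (intro finite_divisors_nat) (auto intro: Nat.gr0I)
  have nd: "n div d dvd n" if "d dvd n" for d using that by (metis dvd_div_mult_self dvd_triv_left)
  have sw: "e dvd n \<and> d dvd n div e" if "d dvd n" "e dvd n div d" for d e
    using that assms by (metis div_dvd_iff_mult dvd_div_iff_mult dvd_mult_right dvd_0_left_iff mult.commute not_gr_zero)
  have "(\<Sum>d | d dvd n. \<Sum>e | e dvd n div d. h d e) =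
      (\<Sum>(d, e)\<in>(SIGMA d:{d. d dvd n}. {e. e dvd n div d}). h d e)"
    using fin nd by (intro sum.Sigma) auto
  also have "\<dots> = (\<Sum>(e, d)\<in>(SIGMA e:{e. e dvd n}. {d. d dvd n div e}). h d e)"
    by (rule sum.reindex_bij_witness[of _ "\<lambda>(a, b). (b, a)" "\<lambda>(a, b). (b, a)"]) (use sw in auto)
  also have "\<dots> = (\<Sum>e | e dvd n. \<Sum>d | d dvd n div e. h d e)"
    using fin nd by (intro sum.Sigma[symmetric]) auto
  finally show ?thesis .
qed

lemma ln_fact_eq_sum_mangoldt:
  "ln (fact x) = (\<Sum>d=1..x. mangoldt d * real (x div d))"
proof -
  have "ln (fact x :: real) = (\<Sum>n=1..x. ln (real n))"
    by (induction x) (auto simp: ln_mult)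
  also have "\<dots> = (\<Sum>n=1..x. \<Sum>d | d dvd n. mangoldt d)"
    by (intro sum.cong) (auto simp: mangoldt_sum)
  also have "\<dots> = (\<Sum>d=1..x. \<Sum>m=1..x div d. mangoldt d)" by (rule sum_divisors_swap)
  finally show ?thesis by (simp add: mult.commute)
qed

lemma ln_fact_ge: "ln (fact x) \<ge> real x * ln (real x) - real x"
proof (induction x)
  case (Suc x)
  show ?case
  proof (cases "x = 0")
    case False
    have "ln (real (Suc x)) = ln (real x) + ln (1 + 1 / real x)"
      using False by (subst ln_mult_pos[symmetric]) (auto simp: distrib_left intro: add_pos_pos)
    moreover have "ln (1 + 1 / real x) \<le> 1 / real x" by (rule ln_add_one_self_le_self) simp
    hence "real x * ln (1 + 1 / real x) \<le> real x * (1 / real x)" by (intro mult_left_mono) auto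
    ultimately have "real x * ln (real (Suc x)) \<le> real x * ln (real x) + 1"
      using False by (simp add: distrib_left)
    moreover have "ln (fact (Suc x) :: real) = ln (real (Suc x)) + ln (fact x)"
      by (simp add: ln_mult_pos)
    ultimately show ?thesis using Suc by (simp add: algebra_simps)
  qed simp
qed simp

lemma ln_fact_le: "ln (fact x) \<le> real x * ln (real x)"
proof -
  have "ln (fact x :: real) \<le> ln (real x ^ x)"
  proof (cases "x = 0")
    case False
    have "(fact x :: real) \<le> real x ^ x" using fact_le_power[of x] by simp
    thus ?thesis using False by (subst ln_le_cancel_iff) auto
  qed simp
  thus ?thesis by (cases "x = 0") (auto simp: ln_realpow)
qed

text \<open>Chebyshev's argument with the central binomial coefficient: its logarithm is the sum of
  the \<open>mangoldt d\<close> weighted by floor(2 n / d) - 2 floor(n / d), and this weight is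
  never negative and equals 1 for n < d \<le> 2 n.\<close>

lemma sum_mangoldt_double: "(\<Sum>d=1..2*n. mangoldt d) \<le> (\<Sum>d=1..n. mangoldt d) + 2 * real n"
proof -
  have "(\<Sum>d=1..2*n. mangoldt d) - (\<Sum>d=1..n. mangoldt d) = (\<Sum>d\<in>{n<..2*n}. mangoldt d :: real)"
  proof -
    have "{1..2*n} = {1..n} \<union> {n<..2*n}" by auto
    moreover have "sum mangoldt ({1..n} \<union> {n<..2*n}) = sum mangoldt {1..n} + (sum mangoldt {n<..2*n} :: real)"
      by (rule sum.union_disjoint) auto
    ultimately show ?thesis by simp
  qed
  also have "\<dots> \<le> (\<Sum>d=1..2*n. mangoldt d * (real (2 * n div d) - 2 * real (n div d)))"
  proof -
    have nn: "real (2 * n div d) - 2 * real (n div d) \<ge> 0" for d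
    proof -
      have "2 * (n div d) \<le> 2 * n div d"
        by (cases "d = 0") (simp_all add: less_eq_div_iff_mult_less_eq)
      thus ?thesis by linarith
    qed
    have "(\<Sum>d\<in>{n<..2*n}. mangoldt d) = (\<Sum>d\<in>{n<..2*n}. mangoldt d * (real (2 * n div d) - 2 * real (n div d)))"
    proof (rule sum.cong)
      fix d assume d: "d \<in> {n<..2*n}"
      have "2 * n div d = 1" using d by (intro div_nat_eqI) auto
      moreover have "n div d = 0" using d by simp
      ultimately show "mangoldt d = mangoldt d * (real (2 * n div d) - 2 * real (n div d))" by simp
    qed simp
    also have "\<dots> \<le> (\<Sum>d=1..2*n. mangoldt d * (real (2 * n div d) - 2 * real (n div d)))"
      using nn by (intro sum_mono2) (auto intro!: mult_nonneg_nonneg mangoldt_nonneg)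
    finally show ?thesis .
  qed
  also have "\<dots> = ln (fact (2 * n)) - 2 * (\<Sum>d=1..2*n. mangoldt d * real (n div d))"
    unfolding ln_fact_eq_sum_mangoldt by (simp add: sum_subtractf sum_distrib_left algebra_simps)
  also have "(\<Sum>d=1..2*n. mangoldt d * real (n div d)) = (\<Sum>d=1..n. mangoldt d * real (n div d))"
    by (rule sum.mono_neutral_right) auto
  also have "\<dots> = ln (fact n)" by (rule ln_fact_eq_sum_mangoldt[symmetric])
  also have "ln (fact (2 * n)) - 2 * ln (fact n) = ln (real ((2 * n) choose n))"
  proof -
    have "real ((2 * n) choose n) = fact (2 * n) / (fact n * fact n)"
      by (subst binomial_fact) auto
    thus ?thesis by (simp add: ln_div ln_mult)
  qed
  also have "\<dots> \<le> ln (real (2 ^ (2 * n)))"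
  proof -
    have "((2 * n) choose n) \<le> 2 ^ (2 * n)"
      using member_le_sum[of n "{..2*n}" "\<lambda>k. (2 * n) choose k"] by (simp add: choose_row_sum)
    moreover have "((2 * n) choose n) > 0" by simp
    ultimately show ?thesis by (subst ln_le_cancel_iff) (simp_all only: of_nat_le_iff of_nat_0_less_iff zero_less_power zero_less_numeral)
  qed
  also have "\<dots> = 2 * real n * ln 2" by (simp add: ln_realpow)
  also have "\<dots> \<le> 2 * real n * 1" using ln_le_minus_one[of 2] by (intro mult_left_mono) auto
  finally show ?thesis by simp
qed

lemma sum_mangoldt_le: "(\<Sum>d=1..n. mangoldt d) \<le> 4 * real n"
proof (induction n rule: less_induct)
  case (less n)
  show ?case
  proof (cases "n = 0")
    case False
    define k where "k = n div 2"
    have k: "k < n" using False by (simp add: k_def)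
    have IH: "(\<Sum>d=1..2*k. mangoldt d) \<le> 6 * real k"
      using sum_mangoldt_double[of k] less.IH[OF k] by simp
    \<comment> \<open>For odd n the last term is at most ln n \<le> n - 1 = 2 k, and 6 k + 2 k \<le>
      4 n.\<close>
    consider "n = 2 * k" | "n = Suc (2 * k)" unfolding k_def by linarith
    thus ?thesis
    proof cases
      case 2
      have "mangoldt n \<le> ln (real n)" using False by (intro mangoldt_le) simp
      also have "\<dots> \<le> real n - 1" using False by (intro ln_le_minus_one) simp
      finally show ?thesis using 2 IH by simp
    qed (use IH in simp)
  qed simp
qed

text \<open>One half of Mertens' estimate: ln x! weights \<open>mangoldt d\<close> by floor(x / d),
  and replacing this by x / d only increases the sum.\<close>

lemma sum_mangoldt_div_ge:
  assumes "x \<ge> 1"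
  shows "(\<Sum>d=1..x. mangoldt d / real d) \<ge> ln (real x) - 1"
proof -
  have "real x * ln (real x) - real x \<le> ln (fact x)" by (rule ln_fact_ge)
  also have "\<dots> = (\<Sum>d=1..x. mangoldt d * real (x div d))" by (rule ln_fact_eq_sum_mangoldt)
  also have "\<dots> \<le> (\<Sum>d=1..x. mangoldt d * (real x / real d))"
    by (intro sum_mono mult_left_mono mangoldt_nonneg of_nat_div_le_of_nat)
  also have "\<dots> = real x * (\<Sum>d=1..x. mangoldt d / real d)" by (simp add: sum_distrib_left mult_ac)
  finally have "real x * (ln (real x) - 1) \<le> real x * (\<Sum>d=1..x. mangoldt d / real d)"
    by (simp add: right_diff_distrib)
  thus ?thesis using assms by simp
qed

lemma real_div_le_Suc_div:
  assumes "d > 0"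
  shows "real x / real d \<le> real (x div d) + 1"
proof -
  have "x < (x div d + 1) * d" using assms by (metis Suc_eq_plus1 dividend_less_div_times mult.commute mult_Suc_right add.commute)
  hence "real x < real ((x div d + 1) * d)" by (simp only: of_nat_less_iff)
  thus ?thesis using assms by (simp add: divide_le_eq distrib_right)
qed

text \<open>The other half: floor(x / d) + 1 is at least x / d, and the surplus is the Chebyshev
  sum, at most 4 x.\<close>

lemma sum_mangoldt_div_le:
  assumes "x \<ge> 1"
  shows "(\<Sum>d=1..x. mangoldt d / real d) \<le> ln (real x) + 4"
proof -
  have "real x * (\<Sum>d=1..x. mangoldt d / real d) = (\<Sum>d=1..x. mangoldt d * (real x / real d))"
    by (simp add: sum_distrib_left mult_ac)
  also have "\<dots> \<le> (\<Sum>d=1..x. mangoldt d * (real (x div d) + 1))"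
    by (intro sum_mono mult_left_mono mangoldt_nonneg real_div_le_Suc_div) auto
  also have "\<dots> = ln (fact x) + (\<Sum>d=1..x. mangoldt d)"
    unfolding ln_fact_eq_sum_mangoldt by (simp add: distrib_left sum.distrib)
  also have "\<dots> \<le> real x * ln (real x) + 4 * real x"
    using ln_fact_le sum_mangoldt_le by (rule add_mono)
  finally have "real x * (\<Sum>d=1..x. mangoldt d / real d) \<le> real x * (ln (real x) + 4)"
    by (simp add: distrib_left)
  thus ?thesis using assms by simp
qed

section \<open>The Moebius function\<close>

definition moebius :: "nat \<Rightarrow> real" where
  "moebius n = (if squarefree n then (- 1) ^ card (prime_factors n) else 0)"

lemma abs_moebius_le: "\<bar>moebius n\<bar> \<le> 1"
  by (simp add: moebius_def power_abs)

text \<open>For a prime p dividing n, the squarefree divisors pair off as d and p d with opposite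
  signs.\<close>

lemma sum_moebius:
  assumes "n > 0"
  shows "(\<Sum>d | d dvd n. moebius d) = (if n = 1 then 1 else 0)"
proof (cases "n = 1")
  case True
  have "{d::nat. d dvd 1} = {1}" by auto
  thus ?thesis using True by (simp add: moebius_def)
next
  case False
  then obtain p where p: "prime p" "p dvd n" using prime_factor_nat by blast
  define A where "A = {d. d dvd n \<and> squarefree d \<and> \<not> p dvd d}"
  define B where "B = {d. d dvd n \<and> squarefree d \<and> p dvd d}"
  have fin: "finite {d. d dvd n}" using assms by (rule finite_divisors_nat)
  have finAB: "finite A" "finite B" by (rule finite_subset[OF _ fin], force simp: A_def B_def)+
  have cop: "coprime p d" if "d \<in> A" for d using that p(1) by (auto simp: A_def intro: prime_imp_coprime)
  have B: "B = (*) p ` A"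
  proof safe
    fix d assume d: "d \<in> B"
    then obtain e where e: "d = p * e" by (auto simp: B_def)
    have "\<not> p dvd e"
    proof
      assume "p dvd e"
      hence "p ^ 2 dvd d" using e by (simp add: power2_eq_square)
      thus False using d p(1) unfolding B_def squarefree_def by (metis (mono_tags, lifting) mem_Collect_eq not_prime_unit)
    qed
    moreover have "squarefree e" using d e squarefree_multD by (auto simp: B_def)
    moreover have "e dvd n" using d e by (auto simp: B_def dest: dvd_mult_right)
    ultimately show "d \<in> (*) p ` A" using e by (auto simp: A_def)
  next
    fix d assume d: "d \<in> A"
    have "squarefree (p * d)" using cop[OF d] d p(1)
      by (intro squarefree_mult_coprime) (auto simp: A_def squarefree_prime)
    moreover have "p * d dvd n" using cop[OF d] d p(2) by (auto simp: A_def intro: divides_mult)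
    ultimately show "p * d \<in> B" by (simp add: B_def)
  qed
  have neg: "moebius (p * d) = - moebius d" if d: "d \<in> A" for d
  proof -
    have d0: "d \<noteq> 0" using d assms by (auto simp: A_def)
    have "squarefree (p * d)" using d B by (auto simp: B_def)
    moreover have "squarefree d" using d by (simp add: A_def)
    moreover have "prime_factors (p * d) = insert p (prime_factors d)"
      using p(1) d0 by (subst prime_factors_product) (auto simp: prime_prime_factors)
    moreover have "p \<notin> prime_factors d" using d by (auto simp: A_def)
    ultimately show ?thesis by (simp add: moebius_def)
  qed
  have "(\<Sum>d | d dvd n. moebius d) = (\<Sum>d\<in>A \<union> B. moebius d)"
    using fin by (intro sum.mono_neutral_right) (auto simp: A_def B_def moebius_def)
  also have "\<dots> = (\<Sum>d\<in>A. moebius d) + (\<Sum>d\<in>B. moebius d)"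
    using finAB by (intro sum.union_disjoint) (auto simp: A_def B_def)
  also have "(\<Sum>d\<in>B. moebius d) = (\<Sum>d\<in>A. moebius (p * d))"
    unfolding B using p(1) by (subst sum.reindex) (auto simp: inj_on_def)
  also have "\<dots> = - (\<Sum>d\<in>A. moebius d)" using neg by (simp add: sum_negf)
  finally show ?thesis using False by simp
qed

text \<open>Moebius inversion of \<open>mangoldt_sum\<close>, applied to ln (n / d). The part with
  ln n drops out: the Moebius sum vanishes for n > 1, and ln 1 = 0.\<close>

lemma sum_moebius_ln:
  assumes "n > 0"
  shows "(\<Sum>d | d dvd n. moebius d * ln (real d)) = - mangoldt n"
proof -
  have "(\<Sum>d | d dvd n. moebius d * (ln (real n) - ln (real d))) =
      (\<Sum>d | d dvd n. \<Sum>e | e dvd n div d. moebius d * mangoldt e)"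
  proof (rule sum.cong)
    fix d assume "d \<in> {d. d dvd n}"
    then obtain e where e: "n = d * e" by auto
    hence de: "d > 0" "e > 0" using assms by auto
    have "ln (real n) - ln (real d) = ln (real e)" using e de by (simp add: ln_mult_pos)
    also have "\<dots> = (\<Sum>e | e dvd n div d. mangoldt e)" using e de by (simp add: mangoldt_sum)
    finally show "moebius d * (ln (real n) - ln (real d)) = (\<Sum>e | e dvd n div d. moebius d * mangoldt e)"
      by (simp add: sum_distrib_left)
  qed simp
  also have "\<dots> = (\<Sum>e | e dvd n. \<Sum>d | d dvd n div e. moebius d * mangoldt e)"
    by (rule sum_divisors_commute[OF assms])
  also have "\<dots> = (\<Sum>e | e dvd n. if e = n then mangoldt n else 0)"
  proof (rule sum.cong)
    fix e assume "e \<in> {e. e dvd n}"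
    then obtain d where d: "n = e * d" by auto
    hence de: "d > 0" "e > 0" using assms by auto
    show "(\<Sum>d | d dvd n div e. moebius d * mangoldt e) = (if e = n then mangoldt n else 0)"
      using d de sum_moebius[OF de(1)] by (cases "d = 1") (simp_all flip: sum_distrib_right)
  qed simp
  also have "\<dots> = mangoldt n" using assms by (simp add: finite_divisors_nat)
  finally have "ln (real n) * (\<Sum>d | d dvd n. moebius d) - (\<Sum>d | d dvd n. moebius d * ln (real d)) = mangoldt n"
    by (simp add: right_diff_distrib sum_subtractf sum_distrib_left mult.commute)
  moreover have "ln (real n) * (\<Sum>d | d dvd n. moebius d) = 0" using sum_moebius[OF assms] by simp
  ultimately show ?thesis by simp
qed

section \<open>Characters with bounded partial sums\<close>

text \<open>Abel's inequality. The induction keeps the boundary term, the full partial sum times f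
  b, apart, so that the bound B (f a - f b) telescopes; adding the term back costs B f b.\<close>

lemma norm_sum_mult_antimono_le:
  fixes c :: "nat \<Rightarrow> complex" and f :: "nat \<Rightarrow> real"
  assumes bound: "\<And>N. norm (\<Sum>n=a..N. c n) \<le> B"
    and dec: "\<And>n. n \<ge> a \<Longrightarrow> f (Suc n) \<le> f n" and nonneg: "\<And>n. n \<ge> a \<Longrightarrow> f n \<ge> 0"
  shows "norm (\<Sum>n=a..b. c n * of_real (f n)) \<le> B * f a"
proof (cases "a \<le> b")
  case True
  have B: "B \<ge> 0" using norm_ge_zero bound by (rule order_trans)
  from True have "norm ((\<Sum>n=a..b. c n * of_real (f n)) - (\<Sum>n=a..b. c n) * of_real (f b)) \<le> B * (f a - f b)"
  proof (induction b rule: dec_induct)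
    case (step b)
    let ?S = "\<lambda>b. \<Sum>n=a..b. c n"
    let ?T = "\<lambda>b. \<Sum>n=a..b. c n * of_real (f n)"
    have "?T (Suc b) - ?S (Suc b) * of_real (f (Suc b)) =
        (?T b - ?S b * of_real (f b)) + ?S b * of_real (f b - f (Suc b))"
      using step by (simp add: algebra_simps)
    also have "norm \<dots> \<le> B * (f a - f b) + B * (f b - f (Suc b))"
    proof (rule norm_triangle_mono)
      have "norm (?S b * of_real (f b - f (Suc b))) = norm (?S b) * (f b - f (Suc b))"
        using dec[of b] step by (simp only: norm_mult norm_of_real) simp
      also have "\<dots> \<le> B * (f b - f (Suc b))" using bound dec[of b] step by (intro mult_right_mono) auto
      finally show "norm (?S b * of_real (f b - f (Suc b))) \<le> B * (f b - f (Suc b))" .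
    qed (rule step)
    finally show ?case by (simp add: algebra_simps)
  qed simp
  moreover have "norm ((\<Sum>n=a..b. c n) * of_real (f b)) \<le> B * f b"
    using bound nonneg[OF True] by (simp add: norm_mult mult_right_mono)
  ultimately have "norm (((\<Sum>n=a..b. c n * of_real (f n)) - (\<Sum>n=a..b. c n) * of_real (f b)) +
      (\<Sum>n=a..b. c n) * of_real (f b)) \<le> B * (f a - f b) + B * f b" by (rule norm_triangle_mono)
  thus ?thesis by (simp add: algebra_simps)
next
  case False
  have "B \<ge> 0" using norm_ge_zero bound by (rule order_trans)
  thus ?thesis using False nonneg[of a] by simp
qed

text \<open>This is what the arguments of Shapiro and Monsky use of a nonprincipal Dirichlet
  character; periodicity enters only through the bound K on the partial sums.\<close>

locale bounded_character =
  fixes \<chi> :: "nat \<Rightarrow> complex" and K :: real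
  assumes mult: "\<chi> (m * n) = \<chi> m * \<chi> n" and one: "\<chi> 1 = 1" and norm_le: "norm (\<chi> n) \<le> 1"
    and partial: "norm (\<Sum>n=1..N. \<chi> n) \<le> K"
begin

lemma K_nonneg: "K \<ge> 0"
  using norm_ge_zero partial by (rule order_trans)

lemma partial_from:
  assumes "a \<ge> 1"
  shows "norm (\<Sum>n=a..N. \<chi> n) \<le> 2 * K"
proof (cases "a \<le> N")
  case True
  have "{1..N} = {1..a - 1} \<union> {a..N}" using assms True by auto
  moreover have "sum \<chi> ({1..a - 1} \<union> {a..N}) = sum \<chi> {1..a - 1} + sum \<chi> {a..N}"
    by (rule sum.union_disjoint) (use assms in auto)
  ultimately have "sum \<chi> {a..N} = sum \<chi> {1..N} - sum \<chi> {1..a - 1}" by simp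
  also have "norm \<dots> \<le> K + K" using partial by (intro norm_triangle_le_diff add_mono)
  finally show ?thesis by simp
qed (use K_nonneg in simp)

text \<open>\<open>G\<close> has the partial sums of L(1, \<chi>), and \<open>S\<close> below has
  those of - L' / L at 1.\<close>

definition G :: "nat \<Rightarrow> complex" where "G y = (\<Sum>n=1..y. \<chi> n / of_nat n)"

definition L :: complex where "L = lim G"

definition S :: "nat \<Rightarrow> complex" where "S x = (\<Sum>n=1..x. \<chi> n * mangoldt n / of_nat n)"

lemma G_diff_le:
  assumes "y \<le> z"
  shows "norm (G z - G y) \<le> 2 * K / real (Suc y)"
proof -
  have "{1..z} = {1..y} \<union> {Suc y..z}" using assms by auto
  moreover have "(\<Sum>n\<in>{1..y} \<union> {Suc y..z}. \<chi> n / of_nat n) =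
      (\<Sum>n=1..y. \<chi> n / of_nat n) + (\<Sum>n=Suc y..z. \<chi> n / of_nat n)"
    by (rule sum.union_disjoint) auto
  ultimately have "G z - G y = (\<Sum>n=Suc y..z. \<chi> n * of_real (1 / real n))"
    by (simp add: G_def)
  also have "norm \<dots> \<le> (2 * K) * (1 / real (Suc y))"
    by (rule norm_sum_mult_antimono_le[OF partial_from]) (auto simp: frac_le)
  finally show ?thesis by simp
qed

lemma G_tendsto: "G \<longlonglongrightarrow> L"
proof -
  have "Cauchy G"
  proof (rule CauchyI)
    fix e :: real assume e: "e > 0"
    obtain M :: nat where M: "4 * K / e < real M" using reals_Archimedean2 by blast
    show "\<exists>M. \<forall>m\<ge>M. \<forall>n\<ge>M. norm (G m - G n) < e"
    proof (intro exI[of _ M] allI impI)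
      fix m n assume mn: "M \<le> m" "M \<le> n"
      have "G m - G n = (G m - G M) - (G n - G M)" by simp
      also have "norm \<dots> \<le> 2 * K / real (Suc M) + 2 * K / real (Suc M)"
        by (rule norm_triangle_le_diff[OF add_mono[OF G_diff_le[OF mn(1)] G_diff_le[OF mn(2)]]])
      also have "\<dots> = 4 * K / real (Suc M)" by simp
      also have "\<dots> < e"
      proof -
        have "4 * K < e * real M" using M e by (simp add: divide_less_eq mult.commute)
        also have "\<dots> \<le> e * real (Suc M)" using e by (intro mult_left_mono) auto
        finally show ?thesis by (simp add: divide_less_eq)
      qed
      finally show "norm (G m - G n) < e" .
    qed
  qed
  thus ?thesis by (simp add: L_def Cauchy_convergent_iff convergent_LIMSEQ_iff)
qed

lemma L_diff_le: "norm (L - G y) \<le> 2 * K / real (Suc y)"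
proof (rule LIMSEQ_le_const2)
  show "(\<lambda>z. norm (G z - G y)) \<longlonglongrightarrow> norm (L - G y)"
    by (intro tendsto_intros G_tendsto)
  show "\<exists>N. \<forall>n\<ge>N. norm (G n - G y) \<le> 2 * K / real (Suc y)" using G_diff_le by blast
qed

text \<open>An error proportional to d cancels the factor 1 / d of the sums to which it is applied,
  leaving the same 2 K / x in every term.\<close>

lemma L_diff_div_le:
  assumes "d \<in> {1..x}"
  shows "norm (L - G (x div d)) \<le> 2 * K * real d / real x"
proof -
  have "norm (L - G (x div d)) \<le> 2 * K / real (Suc (x div d))" by (rule L_diff_le)
  also have "\<dots> \<le> 2 * K / (real x / real d)"
    using real_div_le_Suc_div[of d x] assms K_nonneg by (intro divide_left_mono) (auto simp: add.commute)
  finally show ?thesis by simp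
qed

lemma sum_ln_bounded:
  "\<exists>C. \<forall>x. norm (\<Sum>n=1..x. \<chi> n * of_real (ln (real n)) / of_nat n) \<le> C"
proof (intro exI allI)
  fix x
  let ?f = "\<lambda>n. \<chi> n * of_real (ln (real n)) / of_nat n"
  \<comment> \<open>ln n / n decreases only from n = 3 on, since 2 < e < 3. The terms 1 and 2 are
    split off, and \<open>norm (?f 1)\<close> covers x < 2.\<close>
  have "norm (sum ?f {1..x}) \<le> 2 * K * (ln 3 / 3) + norm (\<Sum>n\<in>{1..2}. ?f n) + norm (?f 1)"
  proof (cases "x \<ge> 2")
    case True
    have "{1..x} = {1..2} \<union> {3..x}" using True by auto
    moreover have "sum ?f ({1..2} \<union> {3..x}) = sum ?f {1..2} + sum ?f {3..x}"
      by (rule sum.union_disjoint) auto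
    moreover have "norm (sum ?f {3..x}) \<le> 2 * K * (ln 3 / 3)"
    proof -
      have "norm (\<Sum>n=3..x. \<chi> n * of_real (ln (real n) / real n)) \<le> 2 * K * (ln (real 3) / real 3)"
      proof (rule norm_sum_mult_antimono_le[OF partial_from])
        fix n :: nat assume n: "3 \<le> n"
        have "exp 1 \<le> (3::real)" by (rule exp_le)
        hence "exp 1 \<le> real n" using n by linarith
        thus "ln (real (Suc n)) / real (Suc n) \<le> ln (real n) / real n" by (rule ln_x_over_x_mono) simp
      qed auto
      thus ?thesis by simp
    qed
    ultimately show ?thesis using norm_triangle_ineq[of "sum ?f {1..2}" "sum ?f {3..x}"] by simp
  next
    case False
    hence "x = 0 \<or> x = 1" by linarith
    thus ?thesis using K_nonneg by auto
  qed
  thus "norm (sum ?f {1..x}) \<le> 2 * K * (ln 3 / 3) + norm (\<Sum>n\<in>{1..2}. ?f n) + norm (?f 1)" .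
qed

lemma char_div_mult: "d dvd n \<Longrightarrow> n > 0 \<Longrightarrow> \<chi> d / of_nat d * (\<chi> (n div d) / of_nat (n div d)) = \<chi> n / of_nat n"
  by (metis dvd_mult_div_cancel mult of_nat_mult times_divide_times_eq)

text \<open>Complete multiplicativity splits \<chi>(n) / n along n = d (n / d), and the sum over the
  cofactor is \<open>G\<close>. It is applied with w = \<open>mangoldt\<close> and with w d =
  \<open>moebius d\<close> ln (x / d).\<close>

lemma sum_char_convolution:
  fixes w :: "nat \<Rightarrow> real"
  shows "(\<Sum>n=1..x. \<chi> n / of_nat n * of_real (\<Sum>d | d dvd n. w d)) =
    (\<Sum>d=1..x. \<chi> d / of_nat d * of_real (w d) * G (x div d))"
proof -
  have "(\<Sum>n=1..x. \<chi> n / of_nat n * of_real (\<Sum>d | d dvd n. w d)) =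
      (\<Sum>n=1..x. \<Sum>d | d dvd n. \<chi> d / of_nat d * of_real (w d) * (\<chi> (n div d) / of_nat (n div d)))"
  proof (rule sum.cong)
    fix n assume n: "n \<in> {1..x}"
    have "\<chi> n / of_nat n * of_real (\<Sum>d | d dvd n. w d) = (\<Sum>d | d dvd n. \<chi> n / of_nat n * of_real (w d))"
      by (simp add: sum_distrib_left)
    also have "\<dots> = (\<Sum>d | d dvd n. \<chi> d / of_nat d * of_real (w d) * (\<chi> (n div d) / of_nat (n div d)))"
    proof (rule sum.cong)
      fix d assume "d \<in> {d. d dvd n}"
      hence "\<chi> n / of_nat n = \<chi> d / of_nat d * (\<chi> (n div d) / of_nat (n div d))"
        using char_div_mult[of d n] n by simp
      thus "\<chi> n / of_nat n * of_real (w d) = \<chi> d / of_nat d * of_real (w d) * (\<chi> (n div d) / of_nat (n div d))"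
        by (simp only: mult_ac)
    qed simp
    finally show "\<chi> n / of_nat n * of_real (\<Sum>d | d dvd n. w d) =
        (\<Sum>d | d dvd n. \<chi> d / of_nat d * of_real (w d) * (\<chi> (n div d) / of_nat (n div d)))" .
  qed simp
  also have "\<dots> = (\<Sum>d=1..x. \<Sum>m=1..x div d. \<chi> d / of_nat d * of_real (w d) * (\<chi> m / of_nat m))"
    by (rule sum_divisors_swap)
  finally show ?thesis by (simp add: G_def sum_distrib_left)
qed

lemma norm_char_div_le: "norm (\<chi> d / of_nat d) \<le> 1 / real d"
  using norm_le[of d] by (simp add: norm_divide divide_right_mono)

text \<open>With w = \<open>mangoldt\<close> the convolution identity equates the bounded sum of
  \<chi>(n) ln n / n with a sum over \<open>G (x div d)\<close>. Replacing
  \<open>G (x div d)\<close> by \<open>L\<close> turns the latter into \<open>L * S x\<close>, at a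
  cost of 2 K / x times the Chebyshev sum, hence at most 8 K.\<close>

lemma S_bounded:
  assumes "L \<noteq> 0"
  shows "\<exists>C. \<forall>x. norm (S x) \<le> C"
proof -
  obtain C where C: "\<And>x. norm (\<Sum>n=1..x. \<chi> n * of_real (ln (real n)) / of_nat n) \<le> C"
    using sum_ln_bounded by blast
  have "norm (S x) \<le> (C + 8 * K) / norm L" for x
  proof -
    have "(\<Sum>n=1..x. \<chi> n * of_real (ln (real n)) / of_nat n) =
        (\<Sum>n=1..x. \<chi> n / of_nat n * of_real (\<Sum>d | d dvd n. mangoldt d))"
      by (intro sum.cong) (auto simp: mangoldt_sum)
    also have "\<dots> = (\<Sum>d=1..x. \<chi> d / of_nat d * of_real (mangoldt d) * G (x div d))"
      by (rule sum_char_convolution)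
    finally have "(\<Sum>n=1..x. \<chi> n * of_real (ln (real n)) / of_nat n) =
        (\<Sum>d=1..x. \<chi> d / of_nat d * of_real (mangoldt d) * G (x div d))" .
    moreover have "L * S x = (\<Sum>d=1..x. \<chi> d / of_nat d * of_real (mangoldt d) * L)"
      unfolding S_def sum_distrib_left by (intro sum.cong) (auto simp: mult_ac)
    ultimately have eq: "L * S x = (\<Sum>n=1..x. \<chi> n * of_real (ln (real n)) / of_nat n) +
        (\<Sum>d=1..x. \<chi> d / of_nat d * of_real (mangoldt d) * (L - G (x div d)))"
      by (simp only: right_diff_distrib sum_subtractf) simp
    have "norm (\<Sum>d=1..x. \<chi> d / of_nat d * of_real (mangoldt d) * (L - G (x div d))) \<le>
        (\<Sum>d=1..x. 2 * K / real x * mangoldt d)"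
    proof (rule sum_norm_le)
      fix d assume d: "d \<in> {1..x}"
      have "norm (\<chi> d / of_nat d * of_real (mangoldt d) * (L - G (x div d))) =
          norm (\<chi> d / of_nat d) * mangoldt d * norm (L - G (x div d))"
        by (simp only: norm_mult norm_of_real abs_mangoldt)
      also have "\<dots> \<le> 1 / real d * mangoldt d * (2 * K * real d / real x)"
        using norm_char_div_le L_diff_div_le[OF d]
        by (intro mult_mono) (auto intro!: mangoldt_nonneg mult_nonneg_nonneg divide_nonneg_nonneg)
      also have "\<dots> = 2 * K / real x * mangoldt d" using d by simp
      finally show "norm (\<chi> d / of_nat d * of_real (mangoldt d) * (L - G (x div d))) \<le> 2 * K / real x * mangoldt d" .
    qed
    also have "\<dots> = 2 * K / real x * (\<Sum>d=1..x. mangoldt d)" by (simp add: sum_distrib_left)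
    also have "\<dots> \<le> 2 * K / real x * (4 * real x)"
      using sum_mangoldt_le K_nonneg by (intro mult_left_mono) auto
    also have "\<dots> \<le> 8 * K" using K_nonneg by simp
    finally have "norm (L * S x) \<le> C + 8 * K" unfolding eq by (intro norm_triangle_mono C)
    thus ?thesis using assms by (simp add: norm_mult pos_le_divide_eq mult.commute)
  qed
  thus ?thesis by blast
qed

text \<open>The weights \<open>moebius d\<close> ln (x / d) have divisor sum
  \<open>mangoldt n\<close>, plus ln x at n = 1, so the convolution identity represents S x + ln x.
  As L = 0, \<open>G (x div d)\<close> is itself an error term, and the errors add up to (2 K / x)
  (x ln x - ln x!) \<le> 2 K. A vanishing L thus drives \<open>S\<close> to minus infinity like - ln
  x.\<close>

lemma S_add_ln_bounded:
  assumes "L = 0" "x \<ge> 1"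
  shows "norm (S x + of_real (ln (real x))) \<le> 2 * K"
proof -
  define w where "w = (\<lambda>d. moebius d * (ln (real x) - ln (real d)))"
  have "(\<Sum>n=1..x. \<chi> n / of_nat n * of_real (\<Sum>d | d dvd n. w d)) =
      (\<Sum>n=1..x. (if n = 1 then of_real (ln (real x)) else 0) + \<chi> n * mangoldt n / of_nat n)"
  proof (rule sum.cong)
    fix n assume "n \<in> {1..x}"
    hence n: "n > 0" by simp
    have "(\<Sum>d | d dvd n. w d) = ln (real x) * (\<Sum>d | d dvd n. moebius d) - (\<Sum>d | d dvd n. moebius d * ln (real d))"
      by (simp add: w_def right_diff_distrib sum_subtractf sum_distrib_left mult.commute)
    also have "\<dots> = (if n = 1 then ln (real x) else 0) + mangoldt n"
      using sum_moebius[OF n] sum_moebius_ln[OF n] by simp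
    finally show "\<chi> n / of_nat n * of_real (\<Sum>d | d dvd n. w d) =
        (if n = 1 then of_real (ln (real x)) else 0) + \<chi> n * mangoldt n / of_nat n"
      using one by simp
  qed simp
  also have "\<dots> = of_real (ln (real x)) + S x"
    using assms(2) by (simp only: sum.distrib S_def) (simp add: sum.delta)
  finally have eq: "S x + of_real (ln (real x)) = (\<Sum>d=1..x. \<chi> d / of_nat d * of_real (w d) * G (x div d))"
    unfolding sum_char_convolution by simp
  also have "norm \<dots> \<le> (\<Sum>d=1..x. 2 * K / real x * (ln (real x) - ln (real d)))"
  proof (rule sum_norm_le)
    fix d assume d: "d \<in> {1..x}"
    have nn: "ln (real x) - ln (real d) \<ge> 0" using d by simp
    have "norm (\<chi> d / of_nat d * of_real (w d) * G (x div d)) = norm (\<chi> d / of_nat d) * \<bar>w d\<bar> * norm (G (x div d))"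
      by (simp only: norm_mult norm_of_real)
    also have "\<dots> \<le> 1 / real d * (ln (real x) - ln (real d)) * (2 * K * real d / real x)"
    proof (intro mult_mono norm_char_div_le)
      have "\<bar>w d\<bar> = \<bar>moebius d\<bar> * (ln (real x) - ln (real d))" using nn by (simp add: w_def abs_mult)
      also have "\<dots> \<le> 1 * (ln (real x) - ln (real d))" using nn abs_moebius_le by (intro mult_right_mono)
      finally show "\<bar>w d\<bar> \<le> ln (real x) - ln (real d)" by simp
      show "norm (G (x div d)) \<le> 2 * K * real d / real x" using L_diff_div_le[OF d] assms by simp
    qed (use nn in auto)
    also have "\<dots> = 2 * K / real x * (ln (real x) - ln (real d))" using d by simp
    finally show "norm (\<chi> d / of_nat d * of_real (w d) * G (x div d)) \<le> 2 * K / real x * (ln (real x) - ln (real d))" .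
  qed
  also have "\<dots> = 2 * K / real x * (real x * ln (real x) - ln (fact x))"
  proof -
    have "ln (fact x :: real) = (\<Sum>n=1..x. ln (real n))"
      by (induction x) (auto simp: ln_mult)
    thus ?thesis unfolding sum_distrib_left[symmetric] by (simp add: sum_subtractf)
  qed
  also have "\<dots> \<le> 2 * K / real x * real x"
    using ln_fact_ge[of x] K_nonneg by (intro mult_left_mono) auto
  also have "\<dots> = 2 * K" using assms by simp
  finally show ?thesis .
qed

end

section \<open>Nonvanishing for real characters\<close>

lemma sum_divisors_mult_coprime:
  fixes c :: "nat \<Rightarrow> real"
  assumes "coprime a b" "a > 0" "b > 0" "\<And>m n. c (m * n) = c m * c n"
  shows "(\<Sum>d | d dvd a * b. c d) = (\<Sum>d | d dvd a. c d) * (\<Sum>d | d dvd b. c d)"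
proof -
  have gcds: "gcd (x * y) a = x \<and> gcd (x * y) b = y" if "x dvd a" "y dvd b" for x y
  proof -
    have "coprime x b" "coprime y a" using that assms(1) by (meson coprime_divisors dvd_refl coprime_commute)+
    thus ?thesis
      using that by (simp add: gcd_mult_left_right_cancel gcd_mult_left_left_cancel coprime_commute gcd_nat.absorb1)
  qed
  have "(\<Sum>d | d dvd a. c d) * (\<Sum>d | d dvd b. c d) = (\<Sum>(x, y)\<in>{d. d dvd a} \<times> {d. d dvd b}. c x * c y)"
    by (simp add: sum_product sum.cartesian_product)
  also have "\<dots> = (\<Sum>d | d dvd a * b. c d)"
  proof (rule sum.reindex_bij_witness[of _ "\<lambda>d. (gcd d a, gcd d b)" "\<lambda>(x, y). x * y"], goal_cases)
    case (1 z)
    then show ?case using gcds by auto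
  next
    case (3 d)
    then obtain x y where "d = x * y" "x dvd a" "y dvd b" by (auto elim: dvd_productE)
    then show ?case using gcds by simp
  qed (auto simp: assms mult_dvd_mono)
  finally show ?thesis by simp
qed

text \<open>The divisor sum is multiplicative. At p ^ k it is k + 1 if c p = 1, it is 1 if c p = 0,
  and for c p = - 1 it is 1 or 0 by the parity of k. Even multiplicities describe the
  squares.\<close>

lemma sum_divisors_sign_character:
  fixes c :: "nat \<Rightarrow> real"
  assumes mult: "\<And>m n. c (m * n) = c m * c n" and one: "c 1 = 1" and val: "\<And>n. c n \<in> {-1, 0, 1}"
    and n: "n > 0"
  shows "(\<Sum>d | d dvd n. c d) \<ge> 0 \<and> ((\<forall>p. prime p \<longrightarrow> even (multiplicity p n)) \<longrightarrow> (\<Sum>d | d dvd n. c d) \<ge> 1)"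
  using n
proof (induction n rule: less_induct)
  case (less n)
  have cpow: "c (m ^ i) = c m ^ i" for m i by (induction i) (simp_all add: mult one[simplified])
  show ?case
  proof (cases "n = 1")
    case True
    have "{d::nat. d dvd 1} = {1}" by auto
    thus ?thesis using True one by simp
  next
    case False
    then obtain p where p: "prime p" "p dvd n" using prime_factor_nat by blast
    define k where "k = multiplicity p n"
    obtain m where m: "n = p ^ k * m" "\<not> p dvd m"
      unfolding k_def using multiplicity_decompose'[of n p] less.prems p(1) not_prime_unit[of p] by blast
    have k0: "k > 0"
      unfolding k_def using p less.prems not_prime_unit[of p] by (subst multiplicity_gt_zero_iff) auto
    have m0: "m > 0" using m less.prems by (auto intro: Nat.gr0I)
    have "p ^ k > 1" using one_less_power[OF prime_gt_1_nat[OF p(1)] k0] .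
    hence mn: "m < n" using m m0 by simp
    have cop: "coprime (p ^ k) m" using p(1) m(2) by (simp add: prime_imp_coprime)
    have "{d. d dvd p ^ k} = (\<lambda>i. p ^ i) ` {..k}" using divides_primepow_nat[OF p(1)] by auto
    moreover have "inj_on (\<lambda>i. p ^ i) {..k}"
      using prime_gt_1_nat[OF p(1)] by (auto simp: inj_on_def power_inject_exp)
    ultimately have pk: "(\<Sum>d | d dvd p ^ k. c d) = (\<Sum>i\<le>k. c p ^ i)" by (simp add: sum.reindex cpow)
    have eq: "(\<Sum>d | d dvd n. c d) = (\<Sum>i\<le>k. c p ^ i) * (\<Sum>d | d dvd m. c d)"
      unfolding pk[symmetric] m(1) using cop p(1) m0 prime_gt_0_nat mult by (intro sum_divisors_mult_coprime) auto
    have alt: "(\<Sum>i\<le>j. (- 1 :: real) ^ i) = (if even j then 1 else 0)" for j by (induction j) auto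
    have zer: "(\<Sum>i\<le>j. (0 :: real) ^ i) = 1" for j by (induction j) auto
    have 1: "(\<Sum>i\<le>k. c p ^ i) \<ge> 0" "even k \<Longrightarrow> (\<Sum>i\<le>k. c p ^ i) \<ge> 1"
      using val[of p] by (auto simp: alt zer)
    have IH: "(\<Sum>d | d dvd m. c d) \<ge> 0" "(\<forall>p. prime p \<longrightarrow> even (multiplicity p m)) \<Longrightarrow> (\<Sum>d | d dvd m. c d) \<ge> 1"
      using less.IH[OF mn m0] by auto
    show ?thesis
    proof (intro conjI impI)
      show "(\<Sum>d | d dvd n. c d) \<ge> 0" unfolding eq using 1 IH by simp
      assume ev: "\<forall>p. prime p \<longrightarrow> even (multiplicity p n)"
      hence "even k" using p(1) by (simp add: k_def)
      moreover have "even (multiplicity r m)" if r: "prime r" for r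
      proof (cases "r = p")
        case True thus ?thesis using m(2) by (simp add: not_dvd_imp_multiplicity_0)
      next
        case False
        have "multiplicity r n = multiplicity r (p ^ k) + multiplicity r m"
          unfolding m(1) using r m0 p(1) by (intro prime_elem_multiplicity_mult_distrib) (auto simp: prime_gt_0_nat)
        also have "multiplicity r (p ^ k) = 0"
          using False r p(1) by (meson not_dvd_imp_multiplicity_0 prime_dvd_power primes_dvd_imp_eq)
        finally show ?thesis using ev r by (metis add_0)
      qed
      ultimately have "1 \<le> (\<Sum>i\<le>k. c p ^ i)" "1 \<le> (\<Sum>d | d dvd m. c d)" using 1 IH by blast+
      thus "(\<Sum>d | d dvd n. c d) \<ge> 1" unfolding eq using mult_mono[of 1 "\<Sum>i\<le>k. c p ^ i" 1 "\<Sum>d | d dvd m. c d"] by simp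
    qed
  qed
qed

text \<open>The terms with exponents i and n - i are paired, and the sum of two squares is at least
  twice the product.\<close>

lemma geometric_sum_ge_power:
  fixes u :: real
  assumes "0 \<le> u"
  shows "(\<Sum>i<Suc n. (u ^ 2) ^ i) \<ge> real (Suc n) * u ^ n"
proof -
  have "2 * (\<Sum>i<Suc n. (u ^ 2) ^ i) = (\<Sum>i<Suc n. (u ^ 2) ^ i) + (\<Sum>i<Suc n. (u ^ 2) ^ (n - i))"
    using sum.nat_diff_reindex[of "\<lambda>i. (u ^ 2) ^ i" "Suc n"] by simp
  also have "\<dots> = (\<Sum>i<Suc n. (u ^ 2) ^ i + (u ^ 2) ^ (n - i))" by (rule sum.distrib[symmetric])
  also have "\<dots> \<ge> (\<Sum>i<Suc n. 2 * u ^ n)"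
  proof (rule sum_mono)
    fix i assume "i \<in> {..<Suc n}"
    hence "u ^ n = u ^ i * u ^ (n - i)" by (simp flip: power_add)
    moreover have "(u ^ i - u ^ (n - i)) ^ 2 \<ge> 0" by simp
    moreover have "(u ^ 2) ^ j = (u ^ j) ^ 2" for j by (simp add: power_mult[symmetric] mult.commute)
    ultimately show "2 * u ^ n \<le> (u ^ 2) ^ i + (u ^ 2) ^ (n - i)"
      by (simp add: power2_diff)
  qed
  finally show ?thesis by simp
qed

lemma sum_power_eq_diff:
  fixes x :: real
  assumes "x \<noteq> 1"
  shows "(\<Sum>m=1..M. x ^ m) = x / (1 - x) - x ^ Suc M / (1 - x)"
proof (induction M)
  case (Suc M)
  have "x ^ Suc M = (x ^ Suc M - x ^ Suc (Suc M)) / (1 - x)"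
    using assms by (simp add: eq_divide_eq algebra_simps)
  hence "x ^ Suc M = x ^ Suc M / (1 - x) - x ^ Suc (Suc M) / (1 - x)" by (simp add: diff_divide_distrib)
  thus ?case using Suc by simp
qed simp

text \<open>For a real character with \<open>L(1, \<chi>) = 0\<close>, the Lambert series \<open>\<Sum> \<chi>(n) t\<^sup>n / (1 - t\<^sup>n)\<close> equals
  \<open>- \<Sum> \<chi>(n) b\<^sub>n\<close> with decreasing weights \<open>b\<^sub>n\<close>, \<open>b\<^sub>1 = 1\<close>, so it stays bounded as \<open>t \<rightarrow> 1\<close>; but its power
  series coefficients are nonnegative, and at least \<open>1\<close> at squares.\<close>
definition monsky_weight :: "real \<Rightarrow> nat \<Rightarrow> real" where
  "monsky_weight t n = 1 / (real n * (1 - t)) - t ^ n / (1 - t ^ n)"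

lemma monsky_weight_eq:
  assumes "0 < t" "t < 1"
  shows "monsky_weight t (Suc n) = (1 / real (Suc n) - t ^ Suc n / (\<Sum>i<Suc n. t ^ i)) / (1 - t)"
proof -
  have "1 - t ^ Suc n = (1 - t) * (\<Sum>i<Suc n. t ^ i)" by (rule one_diff_power_eq)
  thus ?thesis using assms by (simp only: monsky_weight_def) (simp add: diff_divide_distrib mult.commute)
qed

text \<open>With s and s' the geometric sums of n and n + 1 terms, s' = 1 + t s reduces the claim to
  t ^ n / (s s') \<le> 1 / (n (n + 1)). For u = sqrt t the preceding mean inequality gives s \<ge> n
  u ^ (n - 1) and s' \<ge> (n + 1) u ^ n, and u ^ (2 n - 1) \<ge> t ^ n.\<close>

lemma monsky_weight_antimono:
  assumes "0 < t" "t < 1" "n \<ge> 1"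
  shows "monsky_weight t (Suc n) \<le> monsky_weight t n"
proof -
  obtain k where k: "n = Suc k" using assms(3) by (cases n) auto
  define u where "u = sqrt t"
  have u: "0 < u" "u < 1" "t = u ^ 2" using assms by (auto simp: u_def)
  define s where "s = (\<Sum>i<n. t ^ i)"
  define s' where "s' = (\<Sum>i<Suc n. t ^ i)"
  have ss: "s' = 1 + t * s"
    unfolding s_def s'_def by (subst sum.lessThan_Suc_shift) (simp add: sum_distrib_left)
  have s: "s \<ge> real n * u ^ k" using geometric_sum_ge_power[of u k] u unfolding s_def u(3) k by simp
  have s': "s' \<ge> real (Suc n) * u ^ n" using geometric_sum_ge_power[of u n] u unfolding s'_def u(3) by simp
  have pos: "real n * u ^ k > 0" "real (Suc n) * u ^ n > 0" using u assms by simp_all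
  hence spos: "s > 0" "s' > 0" using s s' by linarith+
  have "t ^ n = u ^ n * u ^ n" unfolding u(3) by (simp add: power2_eq_square power_mult_distrib)
  hence "t ^ n = u ^ k * u ^ n * u" by (simp add: k)
  hence "real n * real (Suc n) * t ^ n = (real n * u ^ k) * (real (Suc n) * u ^ n) * u" by (simp add: mult_ac)
  also have "\<dots> \<le> (real n * u ^ k) * (real (Suc n) * u ^ n) * 1"
    using u pos by (intro mult_left_mono) auto
  also have "\<dots> \<le> s * s'" using s s' pos spos by (simp only: mult_1_right) (intro mult_mono, auto)
  finally have key: "t ^ n / (s * s') \<le> 1 / (real n * real (Suc n))"
    using spos assms by (simp add: divide_le_eq le_divide_eq mult.commute)
  have "t ^ n / s - t ^ Suc n / s' = t ^ n * (s' - t * s) / (s * s')"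
    using spos by (simp add: field_simps)
  also have "\<dots> = t ^ n / (s * s')" by (simp add: ss)
  also note key
  also have "1 / (real n * real (Suc n)) = 1 / real n - 1 / real (Suc n)"
    using assms by (simp add: field_simps)
  finally have "1 / real (Suc n) - t ^ Suc n / s' \<le> 1 / real n - t ^ n / s" by simp
  hence "(1 / real (Suc n) - t ^ Suc n / s') / (1 - t) \<le> (1 / real n - t ^ n / s) / (1 - t)"
    using assms by (intro divide_right_mono) auto
  thus ?thesis using monsky_weight_eq[OF assms(1,2), of n] monsky_weight_eq[OF assms(1,2), of k]
    by (simp only: s_def s'_def k)
qed

lemma monsky_weight_nonneg:
  assumes "0 < t" "t < 1" "n \<ge> 1"
  shows "monsky_weight t n \<ge> 0"
proof -
  obtain k where k: "n = Suc k" using assms(3) by (cases n) auto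
  have "real n * t ^ n = (\<Sum>i<n. t ^ n)" by simp
  also have "\<dots> \<le> (\<Sum>i<n. t ^ i)" using assms by (intro sum_mono power_decreasing) auto
  finally have le: "real n * t ^ n \<le> (\<Sum>i<n. t ^ i)" .
  moreover have "real n * t ^ n > 0" using assms by simp
  ultimately have "(\<Sum>i<n. t ^ i) > 0" by linarith
  hence "t ^ n / (\<Sum>i<n. t ^ i) \<le> 1 / real n" using le assms by (simp add: divide_le_eq le_divide_eq mult.commute)
  thus ?thesis using monsky_weight_eq[OF assms(1,2), of k] assms unfolding k by simp
qed

context bounded_character
begin

text \<open>The Lambert series is cut off at N, so that no infinite sum occurs. The first error term
  bounds \<open>G N\<close>, which is small because L = 0; the last comes from truncating the inner
  geometric series; both vanish as N grows. The K between them is Abel's inequality for the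
  decreasing weights.\<close>

lemma sum_monsky_le:
  assumes real: "\<And>n. \<chi> n = of_real (c n)" and L0: "L = 0" and t: "0 < t" "t < 1"
  shows "(\<Sum>n=1..N. (\<Sum>d | d dvd n. c d) * t ^ n) \<le>
    2 * K / real (Suc N) / (1 - t) + K + real N * t ^ N / (1 - t)"
proof -
  have c1: "\<bar>c n\<bar> \<le> 1" for n using norm_le[of n] by (simp add: real)
  have t1: "t ^ d < 1" if "d \<ge> 1" for d using t that power_strict_decreasing[of 0 d t] by simp
  have "(\<Sum>n=1..N. (\<Sum>d | d dvd n. c d) * t ^ n) = (\<Sum>n=1..N. \<Sum>d | d dvd n. c d * t ^ (d * (n div d)))"
    by (intro sum.cong) (auto simp: sum_distrib_right)
  also have "\<dots> = (\<Sum>d=1..N. \<Sum>m=1..N div d. c d * t ^ (d * m))" by (rule sum_divisors_swap)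
  also have "\<dots> \<le> (\<Sum>d=1..N. c d * (t ^ d / (1 - t ^ d)) + t ^ N / (1 - t))"
  proof (rule sum_mono)
    fix d assume d: "d \<in> {1..N}"
    define M where "M = N div d"
    have "(\<Sum>m=1..M. c d * t ^ (d * m)) = c d * (\<Sum>m=1..M. (t ^ d) ^ m)"
      by (simp add: sum_distrib_left power_mult)
    also have "(\<Sum>m=1..M. (t ^ d) ^ m) = t ^ d / (1 - t ^ d) - (t ^ d) ^ Suc M / (1 - t ^ d)"
      using t1[of d] d by (intro sum_power_eq_diff) auto
    also have "c d * (t ^ d / (1 - t ^ d) - (t ^ d) ^ Suc M / (1 - t ^ d)) =
        c d * (t ^ d / (1 - t ^ d)) - c d * ((t ^ d) ^ Suc M / (1 - t ^ d))" by (simp only: right_diff_distrib)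
    also have "\<dots> \<le> c d * (t ^ d / (1 - t ^ d)) + t ^ N / (1 - t)"
    proof -
    have "- (c d * ((t ^ d) ^ Suc M / (1 - t ^ d))) \<le> t ^ N / (1 - t)"
    proof -
      have "- (c d * ((t ^ d) ^ Suc M / (1 - t ^ d))) \<le> \<bar>c d\<bar> * ((t ^ d) ^ Suc M / (1 - t ^ d))"
      proof -
        have "(t ^ d) ^ Suc M / (1 - t ^ d) \<ge> 0" using t t1[of d] d by simp
        thus ?thesis by (metis abs_ge_minus_self minus_mult_left mult_right_mono)
      qed
      also have "\<dots> \<le> 1 * (t ^ N / (1 - t))"
      proof (intro mult_mono frac_le c1)
        \<comment> \<open>The omitted part of the geometric series starts at an exponent not below
          N.\<close>
        have "N \<le> d * Suc M" using d dividend_less_times_div[of d N] unfolding M_def by simp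
        thus "(t ^ d) ^ Suc M \<le> t ^ N" using t by (simp only: power_mult[symmetric]) (intro power_decreasing, auto)
        have "t ^ d \<le> t ^ 1" using t d by (intro power_decreasing) auto
        thus "1 - t \<le> 1 - t ^ d" by simp
      qed (use t t1[of d] d in auto)
      finally show ?thesis by simp
    qed
    thus ?thesis by linarith
    qed
    finally show "(\<Sum>m=1..N div d. c d * t ^ (d * m)) \<le> c d * (t ^ d / (1 - t ^ d)) + t ^ N / (1 - t)"
      unfolding M_def .
  qed
  finally have le: "(\<Sum>n=1..N. (\<Sum>d | d dvd n. c d) * t ^ n) \<le>
      (\<Sum>d=1..N. c d * (t ^ d / (1 - t ^ d))) + real N * t ^ N / (1 - t)"
    by (simp add: sum.distrib)
  have eq: "(\<Sum>d=1..N. c d * (t ^ d / (1 - t ^ d))) =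
      (\<Sum>d=1..N. c d / real d) / (1 - t) - (\<Sum>d=1..N. c d * monsky_weight t d)"
    unfolding sum_divide_distrib sum_subtractf[symmetric]
    by (intro sum.cong) (auto simp: monsky_weight_def right_diff_distrib)
  have "(\<Sum>d=1..N. c d / real d) \<le> 2 * K / real (Suc N)"
  proof -
    have "G N = of_real (\<Sum>d=1..N. c d / real d)" by (simp add: G_def real)
    hence "\<bar>\<Sum>d=1..N. c d / real d\<bar> \<le> 2 * K / real (Suc N)" using L_diff_le[of N] L0 by (simp del: of_real_sum)
    thus ?thesis by linarith
  qed
  hence "(\<Sum>d=1..N. c d / real d) / (1 - t) \<le> 2 * K / real (Suc N) / (1 - t)"
    using t by (intro divide_right_mono) auto
  moreover have "- (\<Sum>d=1..N. c d * monsky_weight t d) \<le> K"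
  proof -
    have "norm (\<Sum>d=1..N. \<chi> d * of_real (monsky_weight t d)) \<le> K * monsky_weight t 1"
      using t by (intro norm_sum_mult_antimono_le partial monsky_weight_antimono monsky_weight_nonneg) auto
    moreover have "monsky_weight t 1 = 1" using t by (simp add: monsky_weight_def diff_divide_distrib[symmetric])
    moreover have "(\<Sum>d=1..N. \<chi> d * of_real (monsky_weight t d)) = of_real (\<Sum>d=1..N. c d * monsky_weight t d)"
      by (simp add: real)
    ultimately have "\<bar>\<Sum>d=1..N. c d * monsky_weight t d\<bar> \<le> K" by (simp del: of_real_sum)
    thus ?thesis by linarith
  qed
  ultimately show ?thesis using le eq by linarith
qed

text \<open>For fixed M, let N tend to infinity and then t to 1 from the left: K bounds every
  partial sum of the coefficients r n. The squares up to m ^ 2 alone contribute at least m, which is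
  unbounded.\<close>

lemma L_nonzero_of_sign:
  assumes real: "\<And>n. \<chi> n = of_real (c n)" and val: "\<And>n. c n \<in> {-1, 0, 1}"
  shows "L \<noteq> 0"
proof
  assume L0: "L = 0"
  define r where "r = (\<lambda>n. \<Sum>d | d dvd n. c d)"
  have cm: "c (m * n) = c m * c n" for m n
    using mult[of m n] unfolding real by (metis of_real_eq_iff of_real_mult)
  have c1: "c 1 = 1" using one unfolding real by (simp only: of_real_eq_1_iff)
  have r0: "r n \<ge> 0" if "n > 0" for n
    using sum_divisors_sign_character[of c n, OF cm c1 val that] by (simp add: r_def)
  have r1: "r (i ^ 2) \<ge> 1" if i: "i > 0" for i
  proof -
    have "\<forall>p. prime p \<longrightarrow> even (multiplicity p (i ^ 2))"
      using i by (simp add: prime_elem_multiplicity_power_distrib)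
    thus ?thesis using sum_divisors_sign_character[of c "i ^ 2", OF cm c1 val] i by (simp add: r_def)
  qed
  have bt: "(\<Sum>n=1..M. r n * t ^ n) \<le> K" if t: "0 < t" "t < 1" for M t
  proof (rule LIMSEQ_le_const)
    have "(\<lambda>N. real N * t ^ N) \<longlonglongrightarrow> 0" using powser_times_n_limit_0[of t] t by simp
    moreover have "(\<lambda>N. 2 * K / real (Suc N)) \<longlonglongrightarrow> 0"
      by (rule LIMSEQ_Suc) (rule lim_const_over_n)
    ultimately have "(\<lambda>N. 2 * K / real (Suc N) / (1 - t) + K + real N * t ^ N / (1 - t)) \<longlonglongrightarrow>
        0 / (1 - t) + K + 0 / (1 - t)"
      using t by (intro tendsto_add tendsto_divide tendsto_const) auto
    thus "(\<lambda>N. 2 * K / real (Suc N) / (1 - t) + K + real N * t ^ N / (1 - t)) \<longlonglongrightarrow> K" by simp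
    show "\<exists>N. \<forall>n\<ge>N. (\<Sum>n=1..M. r n * t ^ n) \<le> 2 * K / real (Suc n) / (1 - t) + K + real n * t ^ n / (1 - t)"
    proof (intro exI[of _ M] allI impI)
      fix N assume N: "M \<le> N"
      have "(\<Sum>n=1..M. r n * t ^ n) \<le> (\<Sum>n=1..N. r n * t ^ n)"
        using N r0 t by (intro sum_mono2) auto
      also have "\<dots> \<le> 2 * K / real (Suc N) / (1 - t) + K + real N * t ^ N / (1 - t)"
        unfolding r_def by (rule sum_monsky_le[OF real L0 t])
      finally show "(\<Sum>n=1..M. r n * t ^ n) \<le> 2 * K / real (Suc N) / (1 - t) + K + real N * t ^ N / (1 - t)" .
    qed
  qed
  have b1: "(\<Sum>n=1..M. r n) \<le> K" for M
  proof -
    have "((\<lambda>t. \<Sum>n=1..M. r n * t ^ n) \<longlongrightarrow> (\<Sum>n=1..M. r n * 1 ^ n)) (at_left 1)"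
      by (intro tendsto_intros)
    moreover have "eventually (\<lambda>t. (\<Sum>n=1..M. r n * t ^ n) \<le> K) (at_left (1::real))"
      using eventually_at_left_real[of 0 "1::real"] by (rule eventually_mono) (use bt in auto)
    ultimately have "(\<Sum>n=1..M. r n * 1 ^ n) \<le> K" by (rule tendsto_upperbound) simp
    thus ?thesis by simp
  qed
  obtain m :: nat where m: "K < real m" using reals_Archimedean2 by blast
  have "real m = (\<Sum>i=1..m. 1)" by simp
  also have "\<dots> \<le> (\<Sum>i=1..m. r (i ^ 2))" using r1 by (intro sum_mono) auto
  also have "\<dots> = (\<Sum>n\<in>(\<lambda>i. i ^ 2) ` {1..m}. r n)"
    by (subst sum.reindex) (auto simp: inj_on_def)
  also have "\<dots> \<le> (\<Sum>n=1..m ^ 2. r n)"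
    using r0 by (intro sum_mono2) (auto simp: power_mono Suc_leI)
  also have "\<dots> \<le> K" by (rule b1)
  finally show False using m by simp
qed

end

section \<open>Dirichlet characters modulo a prime\<close>

lemma power_eq_of_cong:
  fixes z :: "'a::monoid_mult"
  assumes "z ^ k = 1" "[a = b] (mod k)"
  shows "z ^ a = z ^ b"
proof -
  have red: "z ^ a = z ^ (a mod k)" for a
  proof -
    have "z ^ a = z ^ (k * (a div k) + a mod k)" by simp
    also have "\<dots> = z ^ (a mod k)" by (simp only: power_add power_mult assms(1)) simp
    finally show ?thesis .
  qed
  show ?thesis using red[of a] red[of b] assms(2) by (simp add: cong_def)
qed

lemma norm_sum_periodic_le:
  fixes f :: "nat \<Rightarrow> complex"
  assumes per: "\<And>n. f (n + q) = f n" and zero: "(\<Sum>n<q. f n) = 0" and le: "\<And>n. norm (f n) \<le> 1"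
    and q: "q > 0"
  shows "norm (\<Sum>n<N. f n) \<le> real q"
proof (induction N rule: less_induct)
  case (less N)
  show ?case
  proof (cases "N < q")
    case True
    have "norm (\<Sum>n<N. f n) \<le> (\<Sum>n<N. 1)" using le by (intro sum_norm_le) auto
    thus ?thesis using True by simp
  next
    case False
    then obtain M where M: "N = q + M" using le_Suc_ex not_less by blast
    have "(\<Sum>n<q + M. f n) = (\<Sum>n<q. f n) + (\<Sum>n<M. f n)"
      by (induction M) (auto simp: per add.commute[of q] add.assoc[symmetric])
    thus ?thesis using less.IH[of M] M zero q by simp
  qed
qed

lemma ln_nat_unbounded: "\<exists>x::nat. x \<ge> 1 \<and> B < ln (real x)"
proof -
  obtain x :: nat where x: "exp (B + 1) \<le> real x" using real_arch_simple by blast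
  moreover have x0: "real x > 0" using x exp_gt_zero[of "B + 1"] by linarith
  ultimately have "B + 1 \<le> ln (real x)" by (simp add: ln_ge_iff)
  thus ?thesis using x0 by (intro exI[of _ x]) simp
qed

locale prime_generator =
  fixes q g :: nat
  assumes q: "prime q" and g: "residue_primroot q g"
begin

definition ind :: "nat \<Rightarrow> nat" where
  "ind n = inv_into {..<q - 1} (\<lambda>i. g ^ i mod q) (n mod q)"

definition root :: "nat \<Rightarrow> complex" where
  "root j = cis (2 * pi * real j / real (q - 1))"

text \<open>All q - 1 characters modulo q, indexed by j through the discrete logarithm
  \<open>ind\<close> to the base g; j = 0 is the principal one.\<close>

definition dchar :: "nat \<Rightarrow> nat \<Rightarrow> complex" where
  "dchar j n = (if q dvd n then 0 else root j ^ ind n)"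

lemma q_gt_1: "q > 1" using q by (rule prime_gt_1_nat)

lemma cop_g: "coprime q g" and ord_g: "ord q g = q - 1"
  using g q by (auto simp: residue_primroot_def totient_prime)

lemma bij_g: "bij_betw (\<lambda>i. g ^ i mod q) {..<q - 1} (totatives q)"
  using residue_primroot_is_generator[OF q_gt_1 g] q by (simp add: totient_prime)

lemma totatives_q: "totatives q = {1..<q}"
  by (auto simp: totatives_prime[OF q])

lemma ind:
  assumes "\<not> q dvd n"
  shows "ind n < q - 1" "[g ^ ind n = n] (mod q)"
proof -
  have "n mod q \<in> totatives q" unfolding totatives_q using assms q_gt_1
    by (auto simp: Suc_le_eq dvd_eq_mod_eq_0)
  hence im: "n mod q \<in> (\<lambda>i. g ^ i mod q) ` {..<q - 1}" using bij_g by (simp add: bij_betw_def)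
  show "ind n < q - 1" using inv_into_into[OF im] by (simp add: ind_def)
  show "[g ^ ind n = n] (mod q)" using f_inv_into_f[OF im] by (simp add: ind_def cong_def)
qed

lemma ind_unique:
  assumes "\<not> q dvd n" "[g ^ i = n] (mod q)"
  shows "[i = ind n] (mod (q - 1))"
proof -
  have "[g ^ i = g ^ ind n] (mod q)" using assms ind(2)[OF assms(1)] by (metis cong_sym cong_trans)
  thus ?thesis using order_divides_expdiff[OF cop_g] ord_g by simp
qed

lemma root_power: "root j ^ (q - 1) = 1"
proof -
  have "root j ^ (q - 1) = cis (2 * pi * real j)"
    using q_gt_1 unfolding root_def DeMoivre by (simp del: of_nat_diff)
  thus ?thesis by simp
qed

lemma norm_root [simp]: "norm (root j) = 1" by (simp add: root_def)

lemma root_0 [simp]: "root 0 = 1" by (simp add: root_def)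

lemma root_neq_1:
  assumes "0 < j" "j < q - 1"
  shows "root j \<noteq> 1"
proof
  assume "root j = 1"
  moreover have "inj_on (\<lambda>k. cis (2 * pi * real k / real (q - 1))) {..<q - 1}"
    using bij_betw_roots_unity[of "q - 1"] q_gt_1 by (simp add: bij_betw_def)
  ultimately show False using assms root_0 unfolding root_def inj_on_def by (metis lessThan_iff less_trans neq0_conv)
qed

lemma root_power_commute: "root j ^ i = root i ^ j"
  unfolding root_def DeMoivre by (simp add: mult_ac)

lemma cnj_root:
  assumes "j \<le> q - 1"
  shows "cnj (root j) = root (q - 1 - j)"
proof -
  have "2 * pi * real (q - 1 - j) / real (q - 1) = 2 * pi - 2 * pi * real j / real (q - 1)"
  proof -
    have "real (q - 1 - j) = real (q - 1) - real j" using assms by (rule of_nat_diff)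
    moreover have "real (q - 1) > 0" using q_gt_1 by simp
    ultimately show ?thesis by (simp only: right_diff_distrib diff_divide_distrib) simp
  qed
  hence "root (q - 1 - j) = cis (2 * pi) / cis (2 * pi * real j / real (q - 1))"
    unfolding root_def by (simp only: cis_divide)
  also have "\<dots> = cis (- (2 * pi * real j / real (q - 1)))" by (simp add: divide_inverse)
  finally show ?thesis by (simp add: root_def cis_cnj)
qed

lemma dchar_mult: "dchar j (m * n) = dchar j m * dchar j n"
proof (cases "q dvd m \<or> q dvd n")
  case False
  hence nd: "\<not> q dvd m * n" using q by (simp add: prime_dvd_mult_iff)
  have "[g ^ (ind m + ind n) = m * n] (mod q)"
    unfolding power_add using False ind(2) by (intro cong_mult) auto
  hence "root j ^ (ind m + ind n) = root j ^ ind (m * n)"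
    using ind_unique[OF nd] by (intro power_eq_of_cong[OF root_power])
  thus ?thesis using False nd by (simp add: dchar_def power_add)
qed (auto simp: dchar_def)

lemma dchar_1: "dchar j 1 = 1"
proof -
  have nd: "\<not> q dvd 1" using q_gt_1 by simp
  have "root j ^ 0 = root j ^ ind 1"
    by (rule power_eq_of_cong[OF root_power ind_unique[OF nd]]) simp
  thus ?thesis using nd by (simp add: dchar_def)
qed

lemma norm_dchar_le: "norm (dchar j n) \<le> 1"
  by (simp add: dchar_def norm_power)

lemma dchar_periodic: "dchar j (n + q) = dchar j n"
  by (simp add: dchar_def ind_def)

lemma sum_dchar_period:
  assumes "0 < j" "j < q - 1"
  shows "(\<Sum>n<q. dchar j n) = 0"
proof -
  have "(\<Sum>n<q. dchar j n) = (\<Sum>n\<in>totatives q. dchar j n)"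
    unfolding totatives_q by (rule sum.mono_neutral_right) (auto simp: dchar_def not_le)
  also have "\<dots> = (\<Sum>i<q - 1. dchar j (g ^ i mod q))"
    by (rule sum.reindex_bij_betw[OF bij_g, symmetric])
  also have "\<dots> = (\<Sum>i<q - 1. root j ^ i)"
  proof (rule sum.cong)
    fix i assume "i \<in> {..<q - 1}"
    hence "g ^ i mod q \<in> totatives q" using bij_g by (auto simp: bij_betw_def)
    hence nd: "\<not> q dvd g ^ i mod q" unfolding totatives_q by (auto dest: dvd_imp_le)
    have "[g ^ i = g ^ i mod q] (mod q)" by (simp add: cong_def)
    hence "root j ^ i = root j ^ ind (g ^ i mod q)"
      using ind_unique[OF nd] by (intro power_eq_of_cong[OF root_power]) auto
    thus "dchar j (g ^ i mod q) = root j ^ i" using nd by (simp add: dchar_def)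
  qed simp
  also have "\<dots> = 0" unfolding geometric_sum[OF root_neq_1[OF assms]] root_power by simp
  finally show ?thesis .
qed

lemma bounded_character_dchar:
  assumes "0 < j" "j < q - 1"
  shows "bounded_character (dchar j) (real q)"
proof
  fix N
  have "norm (\<Sum>n<Suc N. dchar j n) \<le> real q"
    using q_gt_1 by (intro norm_sum_periodic_le dchar_periodic sum_dchar_period[OF assms] norm_dchar_le) auto
  moreover have "(\<Sum>n<Suc N. dchar j n) = (\<Sum>n=1..N. dchar j n)"
    by (rule sum.mono_neutral_right) (auto simp: dchar_def not_le)
  ultimately show "norm (\<Sum>n=1..N. dchar j n) \<le> real q" by simp
qed (use dchar_mult dchar_1 norm_dchar_le in auto)

text \<open>Orthogonality in the index: \<open>root j ^ i\<close> is symmetric in i and j, so the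
  sum over j is geometric with ratio \<open>root (ind n)\<close>.\<close>

lemma sum_dchar_index: "(\<Sum>j<q - 1. dchar j n) = (if [n = 1] (mod q) then of_nat (q - 1) else 0)"
proof (cases "q dvd n")
  case True
  hence "\<not> [n = 1] (mod q)" using q_gt_1 by (auto simp: cong_def)
  thus ?thesis using True by (simp add: dchar_def)
next
  case False
  have "(\<Sum>j<q - 1. dchar j n) = (\<Sum>j<q - 1. root (ind n) ^ j)"
    using False by (simp add: dchar_def root_power_commute[of _ "ind n"])
  also have "\<dots> = (if ind n = 0 then of_nat (q - 1) else 0)"
    using geometric_sum[OF root_neq_1, of "ind n" "q - 1"] ind(1)[OF False] root_power[of "ind n"]
    by auto
  also have "ind n = 0 \<longleftrightarrow> [n = 1] (mod q)"
  proof
    assume "ind n = 0" thus "[n = 1] (mod q)" using ind(2)[OF False] by (simp add: cong_sym)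
  next
    assume "[n = 1] (mod q)"
    hence "[g ^ 0 = n] (mod q)" by (simp add: cong_sym)
    hence "[0 = ind n] (mod (q - 1))" by (rule ind_unique[OF False])
    thus "ind n = 0" using ind(1)[OF False] by (simp add: cong_def)
  qed
  finally show ?thesis .
qed

definition D :: "nat \<Rightarrow> real" where
  "D x = (\<Sum>n=1..x. if [n = 1] (mod q) then mangoldt n / real n else 0)"

text \<open>The sum \<open>S\<close> again, but available for j = 0 too, where the partial sums of
  the character are unbounded and \<open>bounded_character\<close> does not apply.\<close>

definition CS :: "nat \<Rightarrow> nat \<Rightarrow> complex" where
  "CS j x = (\<Sum>n=1..x. dchar j n * mangoldt n / of_nat n)"

abbreviation Lval :: "nat \<Rightarrow> complex" where
  "Lval j \<equiv> bounded_character.L (dchar j)"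

lemma CS_eq:
  assumes "0 < j" "j < q - 1"
  shows "bounded_character.S (dchar j) = CS j"
  unfolding fun_eq_iff bounded_character.S_def[OF bounded_character_dchar[OF assms]] CS_def by simp

lemma D_nonneg: "D x \<ge> 0"
  unfolding D_def by (intro sum_nonneg) (auto intro!: divide_nonneg_nonneg mangoldt_nonneg)

lemma sum_CS_eq_D: "(\<Sum>j<q - 1. Re (CS j x)) = real (q - 1) * D x"
proof -
  have "(\<Sum>j<q - 1. CS j x) = (\<Sum>n=1..x. (\<Sum>j<q - 1. dchar j n) * (mangoldt n / of_nat n))"
    unfolding CS_def by (subst sum.swap) (simp add: sum_distrib_right mult.assoc flip: times_divide_eq_right)
  also have "\<dots> = of_real (real (q - 1) * D x)"
    unfolding sum_dchar_index D_def sum_distrib_left of_real_sum by (intro sum.cong) auto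
  finally show ?thesis by (metis Re_sum Re_complex_of_real)
qed

text \<open>The sum is bounded if L \<noteq> 0 and within a constant of - ln x if L = 0, so its real
  part never becomes large.\<close>

lemma CS_bounded_above:
  assumes "0 < j" "j < q - 1"
  shows "\<exists>C. \<forall>x\<ge>1. Re (CS j x) \<le> C"
proof -
  interpret bounded_character "dchar j" "real q" by (rule bounded_character_dchar[OF assms])
  show ?thesis
  proof (cases "L = 0")
    case True
    have "Re (CS j x) \<le> 2 * real q" if x: "x \<ge> 1" for x
    proof -
      have "Re (CS j x + of_real (ln (real x))) \<le> 2 * real q"
        using S_add_ln_bounded[OF True x] complex_Re_le_cmod order_trans unfolding CS_eq[OF assms] by blast
      moreover have "ln (real x) \<ge> 0" using x by simp
      ultimately show ?thesis by simp
    qed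
    thus ?thesis by blast
  next
    case False
    then obtain C where "\<And>x. norm (CS j x) \<le> C" using S_bounded unfolding CS_eq[OF assms] by blast
    thus ?thesis using complex_Re_le_cmod order_trans by blast
  qed
qed

lemma dchar_0: "dchar 0 n = (if q dvd n then 0 else 1)"
  by (simp add: dchar_def)

lemma CS_0_le:
  assumes "x \<ge> 1"
  shows "Re (CS 0 x) \<le> ln (real x) + 4"
proof -
  have "Re (CS 0 x) = (\<Sum>n=1..x. if q dvd n then 0 else mangoldt n / real n)"
    unfolding CS_def Re_sum by (intro sum.cong) (auto simp: dchar_0)
  also have "\<dots> \<le> (\<Sum>n=1..x. mangoldt n / real n)"
    by (intro sum_mono) (auto intro!: divide_nonneg_nonneg mangoldt_nonneg)
  also have "\<dots> \<le> ln (real x) + 4" by (rule sum_mangoldt_div_le[OF assms])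
  finally show ?thesis .
qed

lemma Lval_cnj:
  assumes "0 < j" "j < q - 1"
  shows "Lval (q - 1 - j) = cnj (Lval j)"
proof -
  have j': "0 < q - 1 - j" "q - 1 - j < q - 1" using assms by auto
  interpret A: bounded_character "dchar j" "real q" by (rule bounded_character_dchar[OF assms])
  interpret B: bounded_character "dchar (q - 1 - j)" "real q" by (rule bounded_character_dchar[OF j'])
  have "dchar (q - 1 - j) n = cnj (dchar j n)" for n
    using cnj_root[of j] assms by (simp add: dchar_def del: One_nat_def)
  hence "B.G = (\<lambda>y. cnj (A.G y))"
    unfolding fun_eq_iff A.G_def B.G_def by simp
  hence "B.G \<longlonglongrightarrow> cnj A.L" using A.G_tendsto by (simp add: tendsto_cnj)
  thus ?thesis using B.G_tendsto LIMSEQ_unique by blast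
qed

text \<open>The real parts of all \<open>CS j x\<close> add up to (q - 1) D x \<ge> 0. The principal
  character supplies at most ln x + 4, each vanishing L costs ln x, and the others are bounded
  above, so two zeros would make the total negative. A zero at j comes with one at the conjugate
  index q - 1 - j, so the two indices coincide.\<close>

lemma Lval_nonzero:
  assumes j: "0 < j" "j < q - 1"
  shows "Lval j \<noteq> 0"
proof
  assume L0: "Lval j = 0"
  define j' where "j' = q - 1 - j"
  have j': "0 < j'" "j' < q - 1" using j by (auto simp: j'_def)
  have L0': "Lval j' = 0" using Lval_cnj[OF j] L0 by (simp add: j'_def)
  show False
  proof (cases "j = j'")
    case True
    \<comment> \<open>At the self-conjugate index the root of unity is - 1, so the character is real
      and Monsky's argument applies.\<close>
    have "real (q - 1) = 2 * real j" using True j unfolding j'_def by linarith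
    hence "2 * pi * real j / real (q - 1) = pi" using j by simp
    hence "root j = - 1" unfolding root_def by (simp only: cis_pi)
    define c :: "nat \<Rightarrow> real" where "c = (\<lambda>n. if q dvd n then 0 else (- 1) ^ ind n)"
    have "dchar j n = of_real (c n)" for n using \<open>root j = - 1\<close> by (simp add: dchar_def c_def)
    moreover have "c n \<in> {-1, 0, 1}" for n
      by (cases "even (ind n)") (auto simp: c_def)
    ultimately have "Lval j \<noteq> 0"
      by (rule bounded_character.L_nonzero_of_sign[OF bounded_character_dchar[OF j]])
    thus False using L0 by contradiction
  next
    case False
    have "\<forall>i. \<exists>C. 0 < i \<and> i < q - 1 \<longrightarrow> (\<forall>x\<ge>1. Re (CS i x) \<le> C)"
      using CS_bounded_above by blast
    then obtain C where C: "\<And>i x. 0 < i \<Longrightarrow> i < q - 1 \<Longrightarrow> x \<ge> 1 \<Longrightarrow> Re (CS i x) \<le> C i" by metis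
    have van: "Re (CS i x) \<le> 2 * real q - ln (real x)" if "i \<in> {j, j'}" "x \<ge> 1" for i x
    proof -
      have i: "0 < i" "i < q - 1" "Lval i = 0" using that j j' L0 L0' by auto
      have "norm (CS i x + of_real (ln (real x))) \<le> 2 * real q"
        using bounded_character.S_add_ln_bounded[OF bounded_character_dchar[OF i(1,2)] i(3) that(2)]
        unfolding CS_eq[OF i(1,2)] .
      hence "Re (CS i x + of_real (ln (real x))) \<le> 2 * real q" using complex_Re_le_cmod order_trans by blast
      thus ?thesis by simp
    qed
    define J where "J = {..<q - 1} - {0, j, j'}"
    define B where "B = 4 + 4 * real q + (\<Sum>i\<in>J. C i)"
    have "ln (real x) \<le> B" if x: "x \<ge> 1" for x
    proof -
      have "0 \<le> real (q - 1) * D x" using D_nonneg by simp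
      also have "\<dots> = (\<Sum>i<q - 1. Re (CS i x))" by (rule sum_CS_eq_D[symmetric])
      also have "{..<q - 1} = {0, j, j'} \<union> J" using j j' by (auto simp: J_def)
      also have "(\<Sum>i\<in>{0, j, j'} \<union> J. Re (CS i x)) = (\<Sum>i\<in>{0, j, j'}. Re (CS i x)) + (\<Sum>i\<in>J. Re (CS i x))"
        by (rule sum.union_disjoint) (auto simp: J_def)
      also have "(\<Sum>i\<in>{0, j, j'}. Re (CS i x)) = Re (CS 0 x) + Re (CS j x) + Re (CS j' x)"
        using j j' False by simp
      also have "(\<Sum>i\<in>J. Re (CS i x)) \<le> (\<Sum>i\<in>J. C i)"
        using x by (intro sum_mono C) (auto simp: J_def)
      finally have "0 \<le> Re (CS 0 x) + Re (CS j x) + Re (CS j' x) + (\<Sum>i\<in>J. C i)" by simp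
      thus ?thesis using CS_0_le[OF x] van[of j x] van[of j' x] x by (simp add: B_def)
    qed
    thus False using ln_nat_unbounded by (metis not_le)
  qed
qed

end

section \<open>Prime powers, and the divergence of the sum of 1 / p\<close>

lemma sum_inverse_power_le:
  assumes "p \<ge> 2"
  shows "(\<Sum>k=1..x. 1 / real p ^ k) \<le> 2 / real p"
proof -
  define y where "y = 1 / real p"
  have y: "0 < y" "y \<le> 1 / 2" using assms by (auto simp: y_def divide_le_eq)
  have "(\<Sum>k=1..x. 1 / real p ^ k) = (\<Sum>k=1..x. y ^ k)" by (simp add: y_def power_one_over)
  also have "\<dots> = y / (1 - y) - y ^ Suc x / (1 - y)" using y by (intro sum_power_eq_diff) auto
  also have "\<dots> \<le> y / (1 - y)" using y by simp
  also have "\<dots> \<le> y / (1 / 2)" using y by (intro divide_left_mono) auto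
  finally show ?thesis by (simp add: y_def)
qed

lemma sum_inverse_sqrt_le: "(\<Sum>m=2..x. 1 / (real m * sqrt (real m))) \<le> 2"
proof (cases "x \<ge> 1")
  case True
  \<comment> \<open>The subtracted 2 / sqrt x is the tail of the corresponding integral and makes
    the induction telescope.\<close>
  hence "(\<Sum>m=2..x. 1 / (real m * sqrt (real m))) \<le> 2 - 2 / sqrt (real x)"
  proof (induction x rule: dec_induct)
    case (step x)
    define a where "a = sqrt (real x)"
    define b where "b = sqrt (real (Suc x))"
    have a: "a > 0" and ab: "a \<le> b" using step by (auto simp: a_def b_def)
    have b: "b > 0" using a ab by linarith
    have "b ^ 2 - a ^ 2 = 1" by (simp add: a_def b_def)
    hence d: "(b - a) * (b + a) = 1" by (simp add: power2_eq_square algebra_simps)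
    have "1 / (b ^ 2 * b) \<le> 2 / (a * b * (b + a))"
    proof -
      have "a * b * (b + a) \<le> b * b * (b + b)" using a b ab by (intro mult_mono) auto
      hence "2 / (b * b * (b + b)) \<le> 2 / (a * b * (b + a))" using a b by (intro divide_left_mono) auto
      moreover have "2 / (b * b * (b + b)) = 1 / (b ^ 2 * b)" using b by (simp add: power2_eq_square field_simps)
      ultimately show ?thesis by (simp only:)
    qed
    also have "\<dots> = 2 * ((b - a) * (b + a)) / (a * b * (b + a))" by (simp add: d)
    also have "\<dots> = 2 * (b - a) / (a * b)" using a b by simp
    also have "\<dots> = 2 / a - 2 / b" using a b by (simp add: field_simps)
    finally have "1 / (real (Suc x) * sqrt (real (Suc x))) \<le> 2 / sqrt (real x) - 2 / sqrt (real (Suc x))"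
      by (simp add: a_def b_def)
    thus ?case using step by simp
  qed simp
  moreover have "2 / sqrt (real x) \<ge> 0" by simp
  ultimately show ?thesis by linarith
qed simp

lemma ln_le_twice_sqrt:
  assumes "x \<ge> 1"
  shows "ln x \<le> 2 * sqrt x"
proof -
  have "ln x = 2 * ln (sqrt x)" using assms by (simp add: ln_sqrt)
  also have "ln (sqrt x) \<le> sqrt x - 1" using assms by (intro ln_le_minus_one) auto
  finally show ?thesis by simp
qed

lemma primepow_le_self:
  fixes p k :: nat
  assumes "p \<ge> 2" "k \<ge> 1"
  shows "p \<le> p ^ k" "k \<le> p ^ k"
  using assms by (auto intro: self_le_power less_imp_le power_gt_expt)

text \<open>Only p ^ k with k \<ge> 2 matter. For each p they give at most 2 ln p / p ^ 2, hence at
  most 4 / (p sqrt p), and the sum of 1 / (m sqrt m) over m \<ge> 2 is at most 2.\<close>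

lemma sum_mangoldt_nonprime_le: "(\<Sum>n\<in>{n\<in>{1..x}. \<not> prime n}. mangoldt n / real n) \<le> 8"
proof -
  define I where "I = {p\<in>{2..x}. prime p} \<times> {2..x}"
  define f where "f = (\<lambda>(p, k). p ^ k :: nat)"
  define h where "h = (\<lambda>n. mangoldt n / real n)"
  have h0: "h n \<ge> 0" for n unfolding h_def by (intro divide_nonneg_nonneg mangoldt_nonneg) simp
  have sub: "{n\<in>{1..x}. \<not> prime n \<and> primepow n} \<subseteq> f ` I"
  proof
    fix n assume n: "n \<in> {n\<in>{1..x}. \<not> prime n \<and> primepow n}"
    then obtain p k where pk: "prime p" "k > 0" "n = p ^ k" by (auto simp: primepow_def)
    have "k \<noteq> 1" using n pk by auto
    hence k2: "k \<ge> 2" using pk by simp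
    have p2: "p \<ge> 2" using pk by (simp add: prime_ge_2_nat)
    have "p \<le> x" "k \<le> x" using primepow_le_self[OF p2, of k] k2 pk n by auto
    thus "n \<in> f ` I" using pk p2 k2 by (force simp: f_def I_def)
  qed
  have "(\<Sum>n\<in>{n\<in>{1..x}. \<not> prime n}. h n) = (\<Sum>n\<in>{n\<in>{1..x}. \<not> prime n \<and> primepow n}. h n)"
    by (rule sum.mono_neutral_right) (auto simp: h_def mangoldt_def)
  also have "\<dots> \<le> (\<Sum>n\<in>f ` I. h n)" using sub h0 by (intro sum_mono2) (auto simp: I_def)
  also have "\<dots> \<le> (\<Sum>i\<in>I. h (f i))"
    using sum_image_le[of I h f] h0 by (simp add: I_def o_def)
  also have "\<dots> = (\<Sum>p\<in>{p\<in>{2..x}. prime p}. \<Sum>k=2..x. ln (real p) / real p ^ k)"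
    unfolding I_def by (subst sum.cartesian_product) (auto simp: f_def h_def intro!: sum.cong)
  also have "\<dots> \<le> (\<Sum>p\<in>{p\<in>{2..x}. prime p}. 4 * (1 / (real p * sqrt (real p))))"
  proof (rule sum_mono)
    fix p assume "p \<in> {p\<in>{2..x}. prime p}"
    hence p: "p \<ge> 2" by simp
    have "(\<Sum>k=2..x. ln (real p) / real p ^ k) \<le> (\<Sum>k=2..Suc x. ln (real p) / real p ^ k)"
      using p by (intro sum_mono2) auto
    also have "\<dots> = (\<Sum>k=1..x. ln (real p) / real p ^ Suc k)"
      using sum.shift_bounds_cl_Suc_ivl[of "\<lambda>k. ln (real p) / real p ^ k" 1 x] by (simp add: numeral_2_eq_2)
    also have "\<dots> = ln (real p) / real p * (\<Sum>k=1..x. 1 / real p ^ k)"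
      by (simp add: sum_distrib_left)
    also have "\<dots> \<le> ln (real p) / real p * (2 / real p)"
      using p sum_inverse_power_le[OF p] by (intro mult_left_mono) auto
    also have "\<dots> \<le> (2 * sqrt (real p)) / real p * (2 / real p)"
      using p ln_le_twice_sqrt[of "real p"] by (intro mult_right_mono divide_right_mono) auto
    also have "\<dots> = 4 * (1 / (real p * sqrt (real p)))"
    proof -
      define s where "s = sqrt (real p)"
      have "s > 0" "real p = s * s" using p by (auto simp: s_def)
      thus ?thesis unfolding s_def[symmetric] by (simp add: field_simps)
    qed
    finally show "(\<Sum>k=2..x. ln (real p) / real p ^ k) \<le> 4 * (1 / (real p * sqrt (real p)))" .
  qed
  also have "\<dots> \<le> (\<Sum>m=2..x. 4 * (1 / (real m * sqrt (real m))))" by (intro sum_mono2) auto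
  also have "\<dots> = 4 * (\<Sum>m=2..x. 1 / (real m * sqrt (real m)))" by (simp add: sum_distrib_left)
  also have "\<dots> \<le> 4 * 2" using sum_inverse_sqrt_le by (intro mult_left_mono) auto
  finally show ?thesis by (simp add: h_def)
qed

context prime_generator
begin

text \<open>The principal character drops the multiples of q, of which only the powers of q carry
  weight: ln q times the sum of the 1 / q ^ k, at most ln q.\<close>

lemma CS_0_ge:
  assumes "x \<ge> 1"
  shows "Re (CS 0 x) \<ge> ln (real x) - 1 - ln (real q)"
proof -
  define h where "h = (\<lambda>n. mangoldt n / real n)"
  have h0: "h n \<ge> 0" for n unfolding h_def by (intro divide_nonneg_nonneg mangoldt_nonneg) simp
  have q2: "q \<ge> 2" using q_gt_1 by simp
  have sub: "{n\<in>{1..x}. q dvd n \<and> primepow n} \<subseteq> (\<lambda>k. q ^ k) ` {1..x}"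
  proof
    fix n assume n: "n \<in> {n\<in>{1..x}. q dvd n \<and> primepow n}"
    then obtain p k where pk: "prime p" "k > 0" "n = p ^ k" by (auto simp: primepow_def)
    have "q dvd p" using n pk q prime_dvd_power by blast
    hence qp: "q = p" using q pk primes_dvd_imp_eq by blast
    have "k \<le> x" using primepow_le_self[OF q2, of k] pk n qp by auto
    thus "n \<in> (\<lambda>k. q ^ k) ` {1..x}" using pk qp by auto
  qed
  have "(\<Sum>n\<in>{n\<in>{1..x}. q dvd n}. h n) = (\<Sum>n\<in>{n\<in>{1..x}. q dvd n \<and> primepow n}. h n)"
    by (rule sum.mono_neutral_right) (auto simp: h_def mangoldt_def)
  also have "\<dots> \<le> (\<Sum>n\<in>(\<lambda>k. q ^ k) ` {1..x}. h n)" using sub h0 by (intro sum_mono2) auto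
  also have "\<dots> \<le> (\<Sum>k=1..x. h (q ^ k))"
    using sum_image_le[of "{1..x}" h "\<lambda>k. q ^ k"] h0 by (simp add: o_def)
  also have "\<dots> = ln (real q) * (\<Sum>k=1..x. 1 / real q ^ k)"
    unfolding sum_distrib_left using q by (intro sum.cong) (auto simp: h_def)
  also have "\<dots> \<le> ln (real q) * (2 / real q)"
    using q2 sum_inverse_power_le[OF q2] by (intro mult_left_mono) auto
  also have "\<dots> \<le> ln (real q) * 1" using q2 by (intro mult_left_mono) (auto simp: divide_le_eq)
  finally have le: "(\<Sum>n\<in>{n\<in>{1..x}. q dvd n}. h n) \<le> ln (real q)" by simp
  have "Re (CS 0 x) = (\<Sum>n=1..x. h n - (if q dvd n then h n else 0))"
    unfolding CS_def Re_sum by (intro sum.cong) (auto simp: dchar_0 h_def)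
  also have "\<dots> = (\<Sum>n=1..x. h n) - (\<Sum>n\<in>{n\<in>{1..x}. q dvd n}. h n)"
    unfolding sum_subtractf by (subst sum.inter_filter) auto
  also have "\<dots> \<ge> (ln (real x) - 1) - ln (real q)"
    using sum_mangoldt_div_ge[OF assms] le unfolding h_def by (intro diff_mono)
  finally show ?thesis .
qed

text \<open>As no L value vanishes, only the term j = 0 of the orthogonality relation is
  unbounded.\<close>

lemma D_ge_ln: "\<exists>C. \<forall>x\<ge>1. ln (real x) \<le> real (q - 1) * D x + C"
proof -
  have "\<forall>j. \<exists>C. 0 < j \<and> j < q - 1 \<longrightarrow> (\<forall>x. norm (CS j x) \<le> C)"
    using bounded_character.S_bounded[OF bounded_character_dchar Lval_nonzero] CS_eq by metis
  then obtain C where C: "\<And>j x. 0 < j \<Longrightarrow> j < q - 1 \<Longrightarrow> norm (CS j x) \<le> C j" by metis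
  have "ln (real x) \<le> real (q - 1) * D x + (1 + ln (real q) + (\<Sum>j\<in>{1..<q - 1}. C j))" if x: "x \<ge> 1" for x
  proof -
    have "{..<q - 1} = insert 0 {1..<q - 1}" using q_gt_1 by auto
    hence "real (q - 1) * D x = Re (CS 0 x) + (\<Sum>j\<in>{1..<q - 1}. Re (CS j x))"
      unfolding sum_CS_eq_D[symmetric] by simp
    moreover have "(\<Sum>j\<in>{1..<q - 1}. Re (CS j x)) \<ge> (\<Sum>j\<in>{1..<q - 1}. - C j)"
    proof (rule sum_mono)
      fix j assume "j \<in> {1..<q - 1}"
      hence "norm (CS j x) \<le> C j" by (intro C) auto
      thus "- C j \<le> Re (CS j x)" using abs_Re_le_cmod[of "CS j x"] by linarith
    qed
    ultimately show ?thesis using CS_0_ge[OF x] by (simp add: sum_negf)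
  qed
  thus ?thesis by blast
qed

lemma D_le_primes:
  "D x \<le> (\<Sum>p\<in>{p\<in>{1..x}. prime p \<and> [p = 1] (mod q)}. ln (real p) / real p) + 8"
proof -
  define h where "h = (\<lambda>n. mangoldt n / real n)"
  have h0: "h n \<ge> 0" for n unfolding h_def by (intro divide_nonneg_nonneg mangoldt_nonneg) simp
  have "D x = (\<Sum>n\<in>{n\<in>{1..x}. [n = 1] (mod q)}. h n)"
    unfolding D_def h_def by (rule sum.inter_filter[symmetric]) simp
  also have "{n\<in>{1..x}. [n = 1] (mod q)} =
      {p\<in>{1..x}. prime p \<and> [p = 1] (mod q)} \<union> {n\<in>{1..x}. \<not> prime n \<and> [n = 1] (mod q)}" by auto
  also have "(\<Sum>n\<in>\<dots>. h n) = (\<Sum>p\<in>{p\<in>{1..x}. prime p \<and> [p = 1] (mod q)}. h p) +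
      (\<Sum>n\<in>{n\<in>{1..x}. \<not> prime n \<and> [n = 1] (mod q)}. h n)"
    by (rule sum.union_disjoint) auto
  also have "(\<Sum>n\<in>{n\<in>{1..x}. \<not> prime n \<and> [n = 1] (mod q)}. h n) \<le> (\<Sum>n\<in>{n\<in>{1..x}. \<not> prime n}. h n)"
    using h0 by (intro sum_mono2) auto
  also have "\<dots> \<le> 8" unfolding h_def by (rule sum_mangoldt_nonprime_le)
  also have "(\<Sum>p\<in>{p\<in>{1..x}. prime p \<and> [p = 1] (mod q)}. h p) =
      (\<Sum>p\<in>{p\<in>{1..x}. prime p \<and> [p = 1] (mod q)}. ln (real p) / real p)"
    by (intro sum.cong) (auto simp: h_def)
  finally show ?thesis by simp
qed

end

text \<open>If the sums of 1 / p were bounded, those over primes beyond some y would stay below e =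
  1 / (2 (q - 1)). With ln p \<le> ln x there, the sum of ln p / p up to x would be at most a
  constant plus e ln x, half of the growth that \<open>D_ge_ln\<close> demands.\<close>

lemma sum_inverse_primes_1_mod_unbounded:
  fixes q :: nat and W :: real
  assumes q: "prime q" and U: "finite U"
  shows "\<exists>T. finite T \<and> T \<subseteq> {p. prime p \<and> p \<notin> U \<and> [p = 1] (mod q)} \<and> W < (\<Sum>p\<in>T. 1 / real p)"
proof (rule ccontr)
  assume neg: "\<not> ?thesis"
  define P where "P = {p. prime p \<and> p \<notin> U \<and> [p = 1] (mod q)}"
  have W: "(\<Sum>p\<in>T. 1 / real p) \<le> W" if "finite T" "T \<subseteq> P" for T
    using neg that unfolding P_def by (meson not_le)
  define f where "f = (\<lambda>n. if n \<in> P then 1 / real n else 0)"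
  have fs: "sum f A = (\<Sum>p\<in>{p\<in>A. p \<in> P}. 1 / real p)" if "finite A" for A
    unfolding f_def using that by (rule sum.inter_filter[symmetric])
  obtain g where "residue_primroot q g" using prime_primitive_root_exists[of q] q prime_gt_1_nat by auto
  then interpret prime_generator q g using q by unfold_locales
  define e where "e = 1 / (2 * real (q - 1))"
  have e: "e > 0" using q_gt_1 by (simp add: e_def)
  have "summable f"
  proof (rule summableI_nonneg_bounded)
    fix n show "sum f {..<n} \<le> W" by (subst fs) (auto intro!: W)
  qed (simp add: f_def)
  then obtain y where y: "\<And>n. norm (sum f {y..<n}) < e" using e unfolding summable_Cauchy by blast
  define V where "V = (\<Sum>p\<in>U \<union> {..<y}. \<bar>ln (real p) / real p\<bar>)"
  obtain C where C: "\<And>x. x \<ge> 1 \<Longrightarrow> ln (real x) \<le> real (q - 1) * D x + C" using D_ge_ln by blast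
  have "ln (real x) \<le> 2 * (real (q - 1) * (V + 8) + C)" if x: "x \<ge> 1" for x
  proof -
    let ?A = "{p\<in>{1..x}. prime p \<and> [p = 1] (mod q)}"
    let ?B = "{p\<in>{y..<Suc x}. p \<in> P}"
    have "(\<Sum>p\<in>?A. ln (real p) / real p) \<le> (\<Sum>p\<in>(U \<union> {..<y}) \<union> ?B. \<bar>ln (real p) / real p\<bar>)"
    proof (rule order_trans[OF sum_mono sum_mono2])
      show "?A \<subseteq> (U \<union> {..<y}) \<union> ?B" by (auto simp: P_def not_less)
    qed (use U in auto)
    also have "\<dots> \<le> V + (\<Sum>p\<in>?B. \<bar>ln (real p) / real p\<bar>)"
    proof -
      have "(\<Sum>p\<in>(U \<union> {..<y}) \<union> ?B. \<bar>ln (real p) / real p\<bar>) =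
          V + (\<Sum>p\<in>?B - (U \<union> {..<y}). \<bar>ln (real p) / real p\<bar>)"
        unfolding V_def using U by (subst Un_Diff_cancel[symmetric], intro sum.union_disjoint) auto
      also have "(\<Sum>p\<in>?B - (U \<union> {..<y}). \<bar>ln (real p) / real p\<bar>) \<le> (\<Sum>p\<in>?B. \<bar>ln (real p) / real p\<bar>)"
        by (intro sum_mono2) auto
      finally show ?thesis by simp
    qed
    also have "(\<Sum>p\<in>?B. \<bar>ln (real p) / real p\<bar>) \<le> (\<Sum>p\<in>?B. ln (real x) * (1 / real p))"
    proof (rule sum_mono)
      fix p assume p: "p \<in> ?B"
      hence "prime p" "p \<le> x" by (auto simp: P_def)
      hence "1 \<le> p" "p \<le> x" using prime_gt_0_nat[of p] by auto
      thus "\<bar>ln (real p) / real p\<bar> \<le> ln (real x) * (1 / real p)" by (simp add: divide_right_mono)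
    qed
    also have "\<dots> = ln (real x) * sum f {y..<Suc x}"
      unfolding fs[OF finite_atLeastLessThan] sum_distrib_left ..
    also have "\<dots> \<le> ln (real x) * e"
      using y[of "Suc x"] x by (intro mult_left_mono) auto
    finally have "D x \<le> V + ln (real x) * e + 8" using D_le_primes[of x] by simp
    hence "real (q - 1) * D x \<le> real (q - 1) * (V + ln (real x) * e + 8)" by (intro mult_left_mono) auto
    also have "\<dots> = real (q - 1) * (V + 8) + ln (real x) / 2"
    proof -
      have "real (q - 1) * e = 1 / 2" using q_gt_1 by (simp add: e_def)
      moreover have "real (q - 1) * (V + ln (real x) * e + 8) =
          real (q - 1) * (V + 8) + ln (real x) * (real (q - 1) * e)" by (simp only: algebra_simps)
      ultimately show ?thesis by (simp only: mult_1_right times_divide_eq_right)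
    qed
    finally show ?thesis using C[OF x] by simp
  qed
  thus False using ln_nat_unbounded by (metis not_le)
qed

section \<open>The form\<close>

text \<open>Testing the period at s times the zeroth unit vector for s = 0 and s = v $ 0 and
  eliminating c gives (2 ^ (k q) - 2) (v $ 0) ^ (k q) = 0, so v $ 0 and c vanish. For odd k, c = 0
  still allows cancellation among the other entries. Hence the second test, at the vector with
  single entry v $ i: adding v multiplies the inner sum by 2 ^ k - 1, which exceeds 1 as k \<ge>
  2.\<close>

lemma Fthm_period_eq_zero:
  fixes v :: "rat vec"
  assumes v: "v \<in> carrier_vec (m + 1)" and k: "k \<ge> 2" and q: "q \<ge> 2"
    and per: "\<And>y. y \<in> carrier_vec (m + 1) \<Longrightarrow> Fthm k q m (y + v) = Fthm k q m y"
  shows "v = 0\<^sub>v (m + 1)"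
proof -
  define c where "c = (\<Sum>i\<in>{1..m}. (v $ i) ^ k)"
  have e: "(s + v $ 0) ^ (k * q) + 2 * c ^ q = s ^ (k * q)" for s :: rat
  proof -
    let ?y = "vec (m + 1) (\<lambda>i. if i = 0 then s else 0)"
    have "Fthm k q m (?y + v) = Fthm k q m ?y" by (rule per) simp
    moreover have "(\<Sum>i\<in>{1..m}. ((?y + v) $ i) ^ k) = c"
      unfolding c_def using v by (intro sum.cong) auto
    moreover have "(\<Sum>i\<in>{1..m}. (?y $ i) ^ k) = 0"
      using k by (intro sum.neutral) auto
    ultimately show ?thesis using v q by (simp add: Fthm_def zero_power)
  qed
  have kq: "k * q \<ge> 2" using k q by (metis mult_le_mono One_nat_def Suc_1 Suc_leD mult.right_neutral)
  have two: "(2::rat) < 2 ^ j" if "j \<ge> 2" for j :: nat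
    using power_strict_increasing[of 1 j "2::rat"] that by simp
  have v0: "v $ 0 = 0"
  proof (rule ccontr)
    assume "v $ 0 \<noteq> 0"
    moreover have "2 ^ (k * q) * (v $ 0) ^ (k * q) = 2 * (v $ 0) ^ (k * q)"
    proof -
      have "v $ 0 + v $ 0 = 2 * v $ 0" by simp
      hence "2 ^ (k * q) * (v $ 0) ^ (k * q) + 2 * c ^ q = (v $ 0) ^ (k * q)"
        using e[of "v $ 0"] by (simp only: power_mult_distrib)
      moreover have "(v $ 0) ^ (k * q) + 2 * c ^ q = 0" using e[of 0] k q by (simp add: zero_power)
      ultimately show ?thesis by linarith
    qed
    ultimately have "(2::rat) ^ (k * q) = 2" by simp
    with two[OF kq] show False by simp
  qed
  have c0: "c = 0" using e[of 0] v0 k q by (simp add: zero_power)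
  have vi: "v $ i = 0" if i: "i \<in> {1..m}" for i
  proof (rule ccontr)
    assume nz: "v $ i \<noteq> 0"
    let ?y = "vec (m + 1) (\<lambda>j. if j = i then v $ i else 0)"
    have per': "Fthm k q m (?y + v) = Fthm k q m ?y" by (rule per) simp
    have "(\<Sum>j\<in>{1..m}. ((?y + v) $ j) ^ k) =
        (\<Sum>j\<in>{1..m}. (v $ j) ^ k + (if j = i then (2 ^ k - 1) * (v $ i) ^ k else 0))"
    proof (rule sum.cong)
      fix j assume j: "j \<in> {1..m}"
      have "(v $ i + v $ i) ^ k = 2 ^ k * (v $ i) ^ k" by (metis mult_2 power_mult_distrib)
      thus "((?y + v) $ j) ^ k = (v $ j) ^ k + (if j = i then (2 ^ k - 1) * (v $ i) ^ k else 0)"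
        using v j by (auto simp: left_diff_distrib)
    qed simp
    also have "\<dots> = (2 ^ k - 1) * (v $ i) ^ k" using i c0 by (simp add: sum.distrib c_def)
    finally have 1: "(\<Sum>j\<in>{1..m}. ((?y + v) $ j) ^ k) = (2 ^ k - 1) * (v $ i) ^ k" .
    have "(\<Sum>j\<in>{1..m}. (?y $ j) ^ k) = (\<Sum>j\<in>{1..m}. if j = i then (v $ i) ^ k else 0)"
      using k by (intro sum.cong) auto
    hence 2: "(\<Sum>j\<in>{1..m}. (?y $ j) ^ k) = (v $ i) ^ k" using i by simp
    have 3: "(?y + v) $ 0 = 0" "?y $ 0 = 0" using v v0 i by auto
    from per' have "(2 ^ k - 1) ^ q * ((v $ i) ^ k) ^ q = 1 * ((v $ i) ^ k) ^ q"
      unfolding Fthm_def 1 2 3 by (simp add: power_mult_distrib)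
    hence "(2 ^ k - 1 :: rat) ^ q = 1" using nz by simp
    moreover have "1 < (2 ^ k - 1 :: rat) ^ q"
      using two[OF k] q by (intro one_less_power) auto
    ultimately show False by simp
  qed
  show ?thesis
  proof (rule eq_vecI)
    fix i assume "i < dim_vec (0\<^sub>v (m + 1) :: rat vec)"
    thus "v $ i = 0\<^sub>v (m + 1) $ i" using v0 vi[of i] by (cases "i = 0") auto
  qed (use v in simp)
qed

text \<open>If variable j is missing after the substitution A, the form is invariant under
  translation by column j of A, which is nonzero because A is invertible.\<close>

lemma form_order_eq_dim:
  fixes F :: "rat vec \<Rightarrow> rat"
  assumes "\<And>v. v \<in> carrier_vec r \<Longrightarrow> (\<And>y. y \<in> carrier_vec r \<Longrightarrow> F (y + v) = F y) \<Longrightarrow> v = 0\<^sub>v r"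
  shows "form_order r F = r"
  unfolding form_order_def
proof (rule Least_equality)
  show "\<exists>A\<in>carrier_mat r r. invertible_mat A \<and> (\<exists>S\<subseteq>{..<r}. card S = r \<and>
      (\<forall>x\<in>carrier_vec r. \<forall>y\<in>carrier_vec r. (\<forall>i\<in>S. x $ i = y $ i) \<longrightarrow> F (A *\<^sub>v x) = F (A *\<^sub>v y)))"
  proof (intro bexI[of _ "1\<^sub>m r"] conjI exI[of _ "{..<r}"] ballI impI)
    show "invertible_mat (1\<^sub>m r :: rat mat)"
      by (auto simp: invertible_mat_def inverts_mat_def intro!: exI[of _ "1\<^sub>m r"])
    fix x y :: "rat vec"
    assume "x \<in> carrier_vec r" "y \<in> carrier_vec r" "\<forall>i\<in>{..<r}. x $ i = y $ i"
    hence "x = y" by (intro eq_vecI) auto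
    thus "F (1\<^sub>m r *\<^sub>v x) = F (1\<^sub>m r *\<^sub>v y)" by simp
  qed auto
next
  fix m' assume "\<exists>A\<in>carrier_mat r r. invertible_mat A \<and> (\<exists>S\<subseteq>{..<r}. card S = m' \<and>
      (\<forall>x\<in>carrier_vec r. \<forall>y\<in>carrier_vec r. (\<forall>i\<in>S. x $ i = y $ i) \<longrightarrow> F (A *\<^sub>v x) = F (A *\<^sub>v y)))"
  then obtain A S where A: "A \<in> carrier_mat r r" and inv: "invertible_mat A"
    and S: "S \<subseteq> {..<r}" "card S = m'"
    and FA: "\<And>x y. x \<in> carrier_vec r \<Longrightarrow> y \<in> carrier_vec r \<Longrightarrow> (\<forall>i\<in>S. x $ i = y $ i)
      \<Longrightarrow> F (A *\<^sub>v x) = F (A *\<^sub>v y)" by blast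
  from inv obtain B0 where "inverts_mat A B0" "inverts_mat B0 A"
    unfolding invertible_mat_def by blast
  then obtain B where B: "B \<in> carrier_mat r r" "A * B = 1\<^sub>m r" "B * A = 1\<^sub>m r"
    using A unfolding inverts_mat_def
    by (metis carrier_matD(1) carrier_matD(2) carrier_matI index_mult_mat(3) index_one_mat(3) index_mult_mat(2))
  show "r \<le> m'"
  proof (rule ccontr)
    assume "\<not> r \<le> m'"
    hence "S \<noteq> {..<r}" using S by auto
    then obtain j where j: "j < r" "j \<notin> S" using S by blast
    define v where "v = A *\<^sub>v unit_vec r j"
    have v: "v \<in> carrier_vec r" using A by (simp add: v_def)
    have "v = 0\<^sub>v r"
    proof (rule assms[OF v])
      fix y :: "rat vec" assume y: "y \<in> carrier_vec r"
      have By: "B *\<^sub>v y \<in> carrier_vec r" using B y mult_mat_vec_carrier by blast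
      have y': "y = A *\<^sub>v (B *\<^sub>v y)"
        using A B y by (simp flip: assoc_mult_mat_vec)
      have "y + v = A *\<^sub>v (B *\<^sub>v y + unit_vec r j)"
        unfolding v_def using mult_add_distrib_mat_vec[OF A By unit_vec_carrier[of r j]] y' by simp
      moreover have "F (A *\<^sub>v (B *\<^sub>v y + unit_vec r j)) = F (A *\<^sub>v (B *\<^sub>v y))"
      proof (rule FA)
        show "\<forall>i\<in>S. (B *\<^sub>v y + unit_vec r j) $ i = (B *\<^sub>v y) $ i"
          using S j B by (auto simp: unit_vec_def)
      qed (use By in auto)
      ultimately show "F (y + v) = F y" using y' by simp
    qed
    hence "unit_vec r j = B *\<^sub>v 0\<^sub>v r"
      using A B assoc_mult_mat_vec[OF B(1) A, of "unit_vec r j"] by (simp add: v_def)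
    hence "unit_vec r j $ j = (0::rat)" using j B by simp
    thus False using j by simp
  qed
qed

section \<open>Valuations of values and quotients of the form\<close>

text \<open>Once the q-th power of gcd a b is split off, the rest is prime to p: if p divided it and
  b', it would divide a' too; if it divided the rest but not b', a' / b' would give a root modulo
  p.\<close>

lemma multiplicity_power_add_twice_power:
  fixes a b :: int and p q :: nat
  assumes p: "prime p" and q: "q \<ge> 1" and nr: "\<nexists>r::nat. p dvd r ^ q + 2"
    and nz: "a ^ q + 2 * b ^ q \<noteq> 0"
  shows "q dvd multiplicity (int p) (a ^ q + 2 * b ^ q)"
proof -
  have pi: "prime (int p)" using p by simp
  have "gcd a b \<noteq> 0" using nz q by (auto simp: zero_power)
  then obtain a' b' where ab: "a = a' * gcd a b" "b = b' * gcd a b" "coprime a' b'"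
    using gcd_coprime_exists by blast
  define g where "g = gcd a b"
  have N: "a ^ q + 2 * b ^ q = g ^ q * (a' ^ q + 2 * b' ^ q)"
    unfolding g_def by (subst ab(1), subst (2) ab(2)) (simp add: power_mult_distrib algebra_simps)
  have nd: "\<not> int p dvd a' ^ q + 2 * b' ^ q"
  proof
    assume d: "int p dvd a' ^ q + 2 * b' ^ q"
    show False
    proof (cases "int p dvd b'")
      case True
      hence "int p dvd 2 * b' ^ q" using q by (intro dvd_mult) (auto intro: dvd_trans dvd_power)
      hence "int p dvd a' ^ q" using d by (simp add: dvd_add_left_iff)
      hence "int p dvd a'" using pi prime_dvd_power by blast
      thus False using True ab(3) pi by (meson coprime_common_divisor not_prime_unit)
    next
      case False
      hence "coprime b' (int p)" using prime_imp_coprime[OF pi] by (metis coprime_commute)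
      then obtain c where c: "[b' * c = 1] (mod int p)" using cong_solve_coprime_int by blast
      define r where "r = nat ((a' * c) mod int p)"
      have "p > 0" using p by (simp add: prime_gt_0_nat)
      hence r: "[int r = a' * c] (mod int p)" by (simp add: r_def cong_def)
      have "[int r ^ q + 2 = (a' * c) ^ q + 2 * 1 ^ q] (mod int p)"
        using r by (auto intro!: cong_add cong_pow)
      also have "[(a' * c) ^ q + 2 * 1 ^ q = (a' * c) ^ q + 2 * (b' * c) ^ q] (mod int p)"
        using c by (intro cong_add cong_mult cong_pow cong_refl) (rule cong_sym)
      also have "(a' * c) ^ q + 2 * (b' * c) ^ q = (a' ^ q + 2 * b' ^ q) * c ^ q"
        by (simp add: power_mult_distrib algebra_simps)
      finally have "int p dvd int r ^ q + 2" using d by (metis cong_dvd_iff dvd_mult2)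
      hence "p dvd r ^ q + 2" by (metis of_nat_add of_nat_dvd_iff of_nat_numeral of_nat_power)
      thus False using nr by blast
    qed
  qed
  have "g ^ q \<noteq> 0" "a' ^ q + 2 * b' ^ q \<noteq> 0" using nz N by auto
  hence "multiplicity (int p) (a ^ q + 2 * b ^ q) = q * multiplicity (int p) g"
    unfolding N using pi nd
    by (subst prime_elem_multiplicity_mult_distrib)
       (auto simp: prime_elem_multiplicity_power_distrib not_dvd_imp_multiplicity_0)
  thus ?thesis by simp
qed

lemma Fthm_integral:
  assumes "x \<in> carrier_vec (m + 1)" "\<forall>i<m+1. x $ i \<in> \<int>"
  obtains a b :: int where "Fthm k q m x = of_int (a ^ q + 2 * b ^ q)"
proof -
  from assms(2) have "\<forall>i. \<exists>z::int. i < m + 1 \<longrightarrow> x $ i = of_int z" by (auto elim!: Ints_cases)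
  then obtain z :: "nat \<Rightarrow> int" where z: "\<And>i. i < m + 1 \<Longrightarrow> x $ i = of_int (z i)" by metis
  have "(\<Sum>i\<in>{1..m}. (x $ i) ^ k) = of_int (\<Sum>i\<in>{1..m}. z i ^ k)" using z by simp
  hence "Fthm k q m x = of_int ((z 0 ^ k) ^ q + 2 * (\<Sum>i\<in>{1..m}. z i ^ k) ^ q)"
    using z by (simp add: Fthm_def power_mult)
  thus ?thesis using that by blast
qed

text \<open>The number out of reach is p itself: a quotient that agrees with p modulo p ^ 2 has
  valuation exactly 1, which is no multiple of q.\<close>

lemma not_padic_dense_ratio_set:
  assumes p: "prime p" and q: "q \<ge> 2" and nr: "\<nexists>r::nat. p dvd r ^ q + 2"
  shows "\<not> padic_dense p (ratio_set (m + 1) (Fthm k q m))"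
proof
  assume dense: "padic_dense p (ratio_set (m + 1) (Fthm k q m))"
  have pi: "prime (int p)" using p by simp
  from dense obtain t where t: "t \<in> ratio_set (m + 1) (Fthm k q m)"
    "t = of_nat p \<or> padic_val p (t - of_nat p) \<ge> 2" unfolding padic_dense_def by metis
  from t(1) obtain x y where xy: "t = Fthm k q m x / Fthm k q m y" "x \<in> carrier_vec (m + 1)"
    "y \<in> carrier_vec (m + 1)" "\<forall>i<m+1. x $ i \<in> \<int>" "\<forall>i<m+1. y $ i \<in> \<int>" "Fthm k q m y \<noteq> 0"
    unfolding ratio_set_def by blast
  obtain a b where ab: "Fthm k q m x = of_int (a ^ q + 2 * b ^ q)" by (rule Fthm_integral[OF xy(2,4)])
  obtain c d where cd: "Fthm k q m y = of_int (c ^ q + 2 * d ^ q)" by (rule Fthm_integral[OF xy(3,5)])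
  define M where "M = a ^ q + 2 * b ^ q"
  define N where "N = c ^ q + 2 * d ^ q"
  have t': "t = of_int M / of_int N" using xy(1) unfolding ab cd M_def N_def .
  have N0: "N \<noteq> 0" using xy(6) unfolding cd N_def by (metis of_int_0)
  define e where "e = multiplicity (int p) N"
  have mpN: "multiplicity (int p) (int p * N) = e + 1"
    unfolding e_def using N0 pi by (subst multiplicity_times_same) auto
  \<comment> \<open>Denominators are cleared: e is the valuation of N, and p ^ (e + 2) is one power
    beyond what divides p N, so M inherits the valuation e + 1.\<close>
  have key: "M = int p * N \<or> int p ^ (e + 2) dvd M - int p * N"
  \<comment> \<open>\<open>padic_val p 0\<close> is 0 and not infinite, so exact equality is treated
    apart.\<close>
  proof (cases "t = of_nat p")
    case True
    hence "of_int M = (of_int (int p * N) :: rat)" using t' N0 by (simp add: field_simps)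
    thus ?thesis by (simp only: of_int_eq_iff) simp
  next
    case False
    with t have pv: "padic_val p (t - of_nat p) \<ge> 2" by simp
    obtain u v where uv: "quotient_of (t - of_nat p) = (u, v)" by force
    have v: "v > 0" using quotient_of_denom_pos[OF uv] .
    have tuv: "t - of_nat p = of_int u / of_int v" using quotient_of_div[OF uv] .
    hence u: "u \<noteq> 0" using False by auto
    have "of_int (u * N) = (of_int (v * (M - int p * N)) :: rat)"
      using tuv t' v N0 by (simp add: field_simps)
    hence eq: "u * N = v * (M - int p * N)" by (simp only: of_int_eq_iff)
    hence nz: "M - int p * N \<noteq> 0" using u N0 by auto
    have "multiplicity (int p) u + e = multiplicity (int p) v + multiplicity (int p) (M - int p * N)"
      using arg_cong[OF eq, of "multiplicity (int p)"] u N0 v nz pi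
      by (simp add: prime_elem_multiplicity_mult_distrib e_def)
    moreover have "multiplicity (int p) u \<ge> 2 + multiplicity (int p) v"
      using pv uv by (simp add: padic_val_def)
    ultimately have "e + 2 \<le> multiplicity (int p) (M - int p * N)" by linarith
    thus ?thesis by (intro disjI2 multiplicity_dvd')
  qed
  have Mmult: "M \<noteq> 0 \<and> multiplicity (int p) M = e + 1"
  proof
    have nd: "\<not> int p ^ (e + 2) dvd int p * N"
    proof -
      have "int p * N \<noteq> 0" "\<not> is_unit (int p)" using N0 p pi not_prime_unit by auto
      thus ?thesis using mpN by (subst power_dvd_iff_le_multiplicity) auto
    qed
    show M0: "M \<noteq> 0"
    proof
      assume "M = 0" with key nd N0 p show False by auto
    qed
    have d1: "int p ^ (e + 1) dvd int p * N" using mpN by (metis multiplicity_dvd)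
    have "int p ^ (e + 1) dvd M"
      using key
    proof
      assume "int p ^ (e + 2) dvd M - int p * N"
      hence "int p ^ (e + 1) dvd M - int p * N" by (rule power_le_dvd) simp
      with d1 show ?thesis by (metis diff_add_cancel dvd_add)
    qed (use d1 in simp)
    moreover have "\<not> int p ^ Suc (e + 1) dvd M"
    proof
      assume d: "int p ^ Suc (e + 1) dvd M"
      from key show False
      proof
        assume "M = int p * N" with d nd show False by simp
      next
        assume "int p ^ (e + 2) dvd M - int p * N"
        moreover have "int p ^ (e + 2) dvd M" using d by simp
        ultimately have "int p ^ (e + 2) dvd M - (M - int p * N)" by (rule dvd_diff[rotated])
        hence "int p ^ (e + 2) dvd int p * N" by (simp only: diff_diff_eq2 add_diff_cancel_left')
        with nd show False by contradiction
      qed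
    qed
    ultimately show "multiplicity (int p) M = e + 1" by (rule multiplicity_eqI)
  qed
  have "q dvd e" unfolding e_def N_def
    using multiplicity_power_add_twice_power[OF p _ nr] q N0 by (simp add: N_def)
  moreover have "q dvd e + 1"
    using multiplicity_power_add_twice_power[OF p _ nr, of a b] q Mmult by (simp add: M_def)
  ultimately have "q dvd 1" by (metis dvd_add_right_iff)
  thus False using q by simp
qed

lemma infinite_primes_no_root:
  assumes q: "prime q"
  shows "infinite {p. prime p \<and> (\<nexists>r::nat. p dvd r ^ q + 2)}"
proof
  assume fin: "finite {p. prime p \<and> (\<nexists>r::nat. p dvd r ^ q + 2)}"
  have q2: "q \<ge> 2" using q by (rule prime_ge_2_nat)
  \<comment> \<open>The small primes serve the counting bound; adding the supposedly finite set of
    primes without a root leaves a root modulo every prime outside U.\<close>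
  define U where "U = {p. prime p \<and> p \<le> fact q * 2 ^ q} \<union> {p. prime p \<and> (\<nexists>r::nat. p dvd r ^ q + 2)}"
  have U: "finite U" "\<And>p. p \<in> U \<Longrightarrow> prime p" using fin by (auto simp: U_def)
  have "2 \<le> fact q * (2::nat) ^ q"
    using mult_le_mono[OF fact_ge_1[of q, where 'a=nat] self_le_power[of "2::nat" q]] q2 by simp
  hence two: "2 \<in> U" by (simp add: U_def)
  have bound: "(\<Sum>n\<in>sqfree_avoiding U X. root_count q n) \<le> fact q * 2 ^ q * 3 ^ q * X" if "X \<ge> 1" for X
    using q2 that by (rule sum_root_count_le) (simp add: U_def)
  have roots: "\<exists>r::nat. p dvd r ^ q + 2" if "prime p" "p \<notin> U" for p using that by (auto simp: U_def)
  obtain W :: real where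
    "\<And>T. finite T \<Longrightarrow> T \<subseteq> {p. prime p \<and> p \<notin> U \<and> [p = 1] (mod q)} \<Longrightarrow> (\<Sum>p\<in>T. 1 / real p) \<le> W"
    using sum_inverse_primes_bounded[OF U two q2 bound roots] by blast
  thus False using sum_inverse_primes_1_mod_unbounded[OF q U(1), of W] by (meson not_le)
qed

theorem theorem1p5:
  fixes n q k m :: nat
  assumes "n > 1" and "\<not> prime n"
    and "prime q" and "q dvd n" and "n = q * k"
    and "m > 0"
  shows "form_order (m + 1) (Fthm k q m) = m + 1 \<and>
         infinite {p. prime p \<and> \<not> padic_dense p (ratio_set (m + 1) (Fthm k q m))}"
proof
  have q2: "q \<ge> 2" using assms(3) by (rule prime_ge_2_nat)
  \<comment> \<open>Compositeness enters here: k = 1 would make n = q prime, and the inner form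
    would be linear, collapsing its m variables to one.\<close>
  have "k \<noteq> 0" "k \<noteq> 1" using assms by auto
  hence k2: "k \<ge> 2" by simp
  show "form_order (m + 1) (Fthm k q m) = m + 1"
    using Fthm_period_eq_zero[OF _ k2 q2] by (intro form_order_eq_dim) blast
  show "infinite {p. prime p \<and> \<not> padic_dense p (ratio_set (m + 1) (Fthm k q m))}"
  proof (rule infinite_super[OF _ infinite_primes_no_root[OF assms(3)]])
    show "{p. prime p \<and> (\<nexists>r::nat. p dvd r ^ q + 2)} \<subseteq>
        {p. prime p \<and> \<not> padic_dense p (ratio_set (m + 1) (Fthm k q m))}"
      using not_padic_dense_ratio_set[OF _ q2] by blast
  qed
qed

end
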